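(* Let $k$ be an algebraically closed field of characteristic $p>0$, let $G$ be a finite $p$-nilpotent group, let $N=O_{p'}(G)$ and let $P\in\mathrm{Syl}_p(G)$. Then the centralizer algebra $kG^P$ is a Frobenius algebra if and only if $P$ is abelian and, for every irreducible $kN$-module $M$, the endomorphism algebra $E_{T_P(M)}(M)$ is a Frobenius algebra.
   Context: $kG^P=\{a\in kG: xax^{-1}=a \text{ for all } x\in P\}$ is the subalgebra of $kG$ fixed by conjugation by $P$. For an irreducible $kN$-module $M$ and a subgroup $H\le G$, $T_H(M)$ denotes the inertia group of $M$ in $H$, i.e. the set of $h\in H$ whose conjugate module ${}^hM$ is isomorphic to $M$. There is a unique irreducible $kT_G(M)$-module whose restriction to $N$ equals $M$; it is also denoted $M$, and $E_{T_P(M)}(M)=\mathrm{End}_{kT_P(M)}(M)$ is the endomorphism algebra of its restriction to $T_P(M)$. An algebra $\Lambda$ is Frobenius if ${}_\Lambda\Lambda\simeq \mathrm{Hom}_k(\Lambda_\Lambda,k)$ as left modules. *)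

theory Defs
  imports "HOL-Algebra.Coset" "HOL-Algebra.Generated_Groups"
    "HOL-Computational_Algebra.Polynomial"
    "Jordan_Normal_Form.Matrix"
begin

definition lin_functional ::
  "'a set \<Rightarrow> ('a \<Rightarrow> 'a \<Rightarrow> 'a) \<Rightarrow> ('k::field \<Rightarrow> 'a \<Rightarrow> 'a) \<Rightarrow> ('a \<Rightarrow> 'k) \<Rightarrow> bool" where
  "lin_functional A addf smultf \<phi> \<longleftrightarrow>
     (\<forall>x\<in>A. \<forall>y\<in>A. \<phi> (addf x y) = \<phi> x + \<phi> y) \<and>
     (\<forall>c. \<forall>x\<in>A. \<phi> (smultf c x) = c * \<phi> x)"

text \<open>Lambda is Frobenius iff the left regular module is isomorphic to
  Hom_k(Lambda_Lambda, k) with left action (a.phi)(x) = phi(x a):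
  there is a bijective k-linear map theta from A onto the linear functionals
  on A (functionals compared on A) with theta(a b) = a . theta(b).\<close>
definition frobenius_alg ::
  "'a set \<Rightarrow> ('a \<Rightarrow> 'a \<Rightarrow> 'a) \<Rightarrow> ('k::field \<Rightarrow> 'a \<Rightarrow> 'a) \<Rightarrow> ('a \<Rightarrow> 'a \<Rightarrow> 'a) \<Rightarrow> bool" where
  "frobenius_alg A addf smultf multf \<longleftrightarrow>
     (\<exists>\<theta> :: 'a \<Rightarrow> 'a \<Rightarrow> 'k.
        (\<forall>a\<in>A. lin_functional A addf smultf (\<theta> a)) \<and>
        (\<forall>a\<in>A. \<forall>b\<in>A. \<forall>x\<in>A. \<theta> (addf a b) x = \<theta> a x + \<theta> b x) \<and>
        (\<forall>c. \<forall>a\<in>A. \<forall>x\<in>A. \<theta> (smultf c a) x = c * \<theta> a x) \<and>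
        (\<forall>a\<in>A. \<forall>b\<in>A. \<forall>x\<in>A. \<theta> (multf a b) x = \<theta> b (multf x a)) \<and>
        (\<forall>a\<in>A. \<forall>b\<in>A. (\<forall>x\<in>A. \<theta> a x = \<theta> b x) \<longrightarrow> a = b) \<and>
        (\<forall>\<phi>. lin_functional A addf smultf \<phi> \<longrightarrow> (\<exists>a\<in>A. \<forall>x\<in>A. \<theta> a x = \<phi> x)))"

definition abelian_set :: "('g, 'b) monoid_scheme \<Rightarrow> 'g set \<Rightarrow> bool" where
  "abelian_set G H \<longleftrightarrow> (\<forall>x\<in>H. \<forall>y\<in>H. x \<otimes>\<^bsub>G\<^esub> y = y \<otimes>\<^bsub>G\<^esub> x)"

definition sylow_subgroup :: "('g, 'b) monoid_scheme \<Rightarrow> nat \<Rightarrow> 'g set \<Rightarrow> bool" where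
  "sylow_subgroup G p P \<longleftrightarrow>
     subgroup P G \<and> card P = p ^ multiplicity p (card (carrier G))"

text \<open>O_{p'}(G): the subgroup generated by all normal p'-subgroups
  (which is the largest normal p'-subgroup).\<close>
definition O_p' :: "('g, 'b) monoid_scheme \<Rightarrow> nat \<Rightarrow> 'g set" where
  "O_p' G p = generate G (\<Union>{H. H \<lhd> G \<and> \<not> p dvd card H})"

definition p_nilpotent :: "('g, 'b) monoid_scheme \<Rightarrow> nat \<Rightarrow> bool" where
  "p_nilpotent G p \<longleftrightarrow>
     (\<exists>K. K \<lhd> G \<and> \<not> p dvd card K \<and> (\<exists>e. card (carrier G) = card K * p ^ e))"

definition group_alg :: "('g, 'b) monoid_scheme \<Rightarrow> ('g \<Rightarrow> 'k::field) set" where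
  "group_alg G = {a. \<forall>g. g \<notin> carrier G \<longrightarrow> a g = 0}"

definition ga_add :: "('g \<Rightarrow> 'k::field) \<Rightarrow> ('g \<Rightarrow> 'k) \<Rightarrow> 'g \<Rightarrow> 'k" where
  "ga_add a b = (\<lambda>g. a g + b g)"

definition ga_smult :: "'k::field \<Rightarrow> ('g \<Rightarrow> 'k) \<Rightarrow> 'g \<Rightarrow> 'k" where
  "ga_smult c a = (\<lambda>g. c * a g)"

definition ga_mult :: "('g, 'b) monoid_scheme \<Rightarrow> ('g \<Rightarrow> 'k::field) \<Rightarrow> ('g \<Rightarrow> 'k) \<Rightarrow> 'g \<Rightarrow> 'k" where
  "ga_mult G a b = (\<lambda>g. if g \<in> carrier G
      then (\<Sum>h\<in>carrier G. a h * b (inv\<^bsub>G\<^esub> h \<otimes>\<^bsub>G\<^esub> g)) else 0)"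

text \<open>x a x^{-1} for x in G and a in kG: coefficient at h is a(x^{-1} h x).\<close>
definition ga_conj :: "('g, 'b) monoid_scheme \<Rightarrow> 'g \<Rightarrow> ('g \<Rightarrow> 'k::field) \<Rightarrow> 'g \<Rightarrow> 'k" where
  "ga_conj G x a = (\<lambda>h. if h \<in> carrier G
      then a (inv\<^bsub>G\<^esub> x \<otimes>\<^bsub>G\<^esub> h \<otimes>\<^bsub>G\<^esub> x) else 0)"

definition centralizer_alg :: "('g, 'b) monoid_scheme \<Rightarrow> 'g set \<Rightarrow> ('g \<Rightarrow> 'k::field) set" where
  "centralizer_alg G P = {a \<in> group_alg G. \<forall>x\<in>P. ga_conj G x a = a}"

definition is_rep :: "('g, 'b) monoid_scheme \<Rightarrow> 'g set \<Rightarrow> nat \<Rightarrow> ('g \<Rightarrow> 'k::field mat) \<Rightarrow> bool" where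
  "is_rep G H n \<rho> \<longleftrightarrow>
     (\<forall>h\<in>H. \<rho> h \<in> carrier_mat n n) \<and> \<rho> \<one>\<^bsub>G\<^esub> = 1\<^sub>m n \<and>
     (\<forall>g\<in>H. \<forall>h\<in>H. \<rho> (g \<otimes>\<^bsub>G\<^esub> h) = \<rho> g * \<rho> h)"

definition subspace_vec :: "nat \<Rightarrow> 'k::field vec set \<Rightarrow> bool" where
  "subspace_vec n W \<longleftrightarrow> W \<subseteq> carrier_vec n \<and> 0\<^sub>v n \<in> W \<and>
     (\<forall>v\<in>W. \<forall>w\<in>W. v + w \<in> W) \<and> (\<forall>c. \<forall>w\<in>W. c \<cdot>\<^sub>v w \<in> W)"

definition irreducible_rep :: "('g, 'b) monoid_scheme \<Rightarrow> 'g set \<Rightarrow> nat \<Rightarrow> ('g \<Rightarrow> 'k::field mat) \<Rightarrow> bool" where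
  "irreducible_rep G H n \<rho> \<longleftrightarrow> is_rep G H n \<rho> \<and> n > 0 \<and>
     (\<forall>W. subspace_vec n W \<and> (\<forall>h\<in>H. \<forall>w\<in>W. \<rho> h *\<^sub>v w \<in> W)
          \<longrightarrow> W = {0\<^sub>v n} \<or> W = carrier_vec n)"

definition rep_iso :: "'g set \<Rightarrow> nat \<Rightarrow> ('g \<Rightarrow> 'k::field mat) \<Rightarrow> ('g \<Rightarrow> 'k mat) \<Rightarrow> bool" where
  "rep_iso H n \<rho> \<sigma> \<longleftrightarrow>
     (\<exists>S\<in>carrier_mat n n. \<exists>S'\<in>carrier_mat n n. S * S' = 1\<^sub>m n \<and> S' * S = 1\<^sub>m n \<and>
        (\<forall>h\<in>H. S * \<rho> h = \<sigma> h * S))"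

definition conj_rep :: "('g, 'b) monoid_scheme \<Rightarrow> 'g \<Rightarrow> ('g \<Rightarrow> 'k::field mat) \<Rightarrow> 'g \<Rightarrow> 'k mat" where
  "conj_rep G h \<rho> = (\<lambda>g. \<rho> (inv\<^bsub>G\<^esub> h \<otimes>\<^bsub>G\<^esub> g \<otimes>\<^bsub>G\<^esub> h))"

definition inertia :: "('g, 'b) monoid_scheme \<Rightarrow> 'g set \<Rightarrow> 'g set \<Rightarrow> nat \<Rightarrow> ('g \<Rightarrow> 'k::field mat) \<Rightarrow> 'g set" where
  "inertia G N H n \<rho> = {h \<in> H. rep_iso N n (conj_rep G h \<rho>) \<rho>}"

definition end_alg :: "'g set \<Rightarrow> nat \<Rightarrow> ('g \<Rightarrow> 'k::field mat) \<Rightarrow> 'k mat set" where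
  "end_alg H n \<rho> = {A \<in> carrier_mat n n. \<forall>h\<in>H. A * \<rho> h = \<rho> h * A}"

end

theory Submission
  imports Defs "HOL-Library.Function_Algebras" "HOL-Algebra.Multiplicative_Group"
    "Jordan_Normal_Form.Char_Poly"
begin

text \<open>An algebra is Frobenius iff it carries a linear form \<open>\<mu>\<close> such that \<open>a \<mapsto> \<mu>(_ a)\<close> is a bijection onto
  the linear forms. Write \<open>G = NP\<close>.

  If \<open>kG\<^sup>P\<close> is Frobenius, represent \<open>a \<mapsto> \<Sum>\<^bsub>n\<in>N\<^esub> a(n)\<close> as \<open>\<mu>(_ u)\<close>. For a noncentral \<open>x \<in> P\<close> let \<open>C\<close> be the
  indicator of \<open>N\<close> times the class of \<open>x\<close>. The form vanishes on the left ideal generated by \<open>C\<close>, so \<open>Cu = 0\<close>.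
  But \<open>P\<close> is a \<open>p\<close>-group, so \<open>kP C\<close> contains a nonzero fixed vector, that is a multiple of
  \<open>\<sigma> = \<Sum>\<^bsub>g\<in>G\<^esub> g\<close>, whence \<open>\<sigma> u = 0\<close>; this contradicts that the form has the value \<open>|N| \<noteq> 0\<close> at \<open>\<sigma>\<close>.

  If \<open>P\<close> is abelian, then \<open>kG\<^sup>P = (kN)\<^sup>P \<otimes> kP\<close>, which is Frobenius iff \<open>(kN)\<^sup>P\<close> is. By semisimplicity of \<open>kN\<close>,
  \<open>(kN)\<^sup>P\<close> is the product of the algebras \<open>E\<^bsub>T\<^esub>(M)\<close>, \<open>T = T\<^sub>P(M)\<close>, over the \<open>P\<close>-orbits of irreducible
  \<open>kN\<close>-modules \<open>M\<close>.\<close>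

section \<open>Frobenius forms\<close>

text \<open>Both passages to a smaller Frobenius algebra, from kG^P to (kN)^P and from (kN)^P to
  E_T(M), use one mechanism: the small algebra is embedded linearly as a two-sided ideal on which
  the large algebra acts through the small one. For kG^P the ideal is (kN)^P s, where s is the sum
  of the elements of P; merely restricting a form to the subalgebra (kN)^P might make it degenerate.
  Characteristic p acts in two ways. Orders of nontrivial stabilizers in P vanish in k, so orbit
  sums must run over distinct conjugates and not over P. On the other hand |N| and the dimensions of
  the irreducible kN-modules are invertible in k, which gives Maschke's projections and Fourier
  inversion. The condition on M is quantified over all extensions of M to its inertia group, so it
  says something about M only once an extension is known to exist. Orbits of modules are labelled by
  kernels of representations of (kN)^P, which can be compared between modules of different
  dimensions.\<close>

definition frobenius_form ::
  "'a set \<Rightarrow> ('a \<Rightarrow> 'a \<Rightarrow> 'a) \<Rightarrow> ('k::field \<Rightarrow> 'a \<Rightarrow> 'a) \<Rightarrow> ('a \<Rightarrow> 'a \<Rightarrow> 'a) \<Rightarrow> ('a \<Rightarrow> 'k) \<Rightarrow> bool" where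
  "frobenius_form A addf smultf multf \<mu> \<longleftrightarrow>
     lin_functional A addf smultf \<mu> \<and>
     (\<forall>a\<in>A. \<forall>b\<in>A. (\<forall>x\<in>A. \<mu> (multf x a) = \<mu> (multf x b)) \<longrightarrow> a = b) \<and>
     (\<forall>\<phi>. lin_functional A addf smultf \<phi> \<longrightarrow> (\<exists>a\<in>A. \<forall>x\<in>A. \<phi> x = \<mu> (multf x a)))"

lemma lin_functional_add:
  "lin_functional A addf smultf \<phi> \<Longrightarrow> x \<in> A \<Longrightarrow> y \<in> A \<Longrightarrow> \<phi> (addf x y) = \<phi> x + \<phi> y"
  and lin_functional_smult:
  "lin_functional A addf smultf \<phi> \<Longrightarrow> x \<in> A \<Longrightarrow> \<phi> (smultf c x) = c * \<phi> x"
  by (auto simp: lin_functional_def)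

lemma frobenius_formD:
  assumes "frobenius_form A addf smultf multf \<mu>"
  shows "lin_functional A addf smultf \<mu>"
    and "\<lbrakk>a \<in> A; b \<in> A; \<And>x. x \<in> A \<Longrightarrow> \<mu> (multf x a) = \<mu> (multf x b)\<rbrakk> \<Longrightarrow> a = b"
    and "lin_functional A addf smultf \<phi> \<Longrightarrow> \<exists>a\<in>A. \<forall>x\<in>A. \<phi> x = \<mu> (multf x a)"
  using assms unfolding frobenius_form_def by blast+

text \<open>All operations are parameters, so that both functions on G and matrices qualify. Square
  matrices of all sizes share one type and have no common zero, so the laws are formulated without a
  zero element.\<close>

locale unital_alg =
  fixes A :: "'a set" and addf :: "'a \<Rightarrow> 'a \<Rightarrow> 'a" and smultf :: "'k::field \<Rightarrow> 'a \<Rightarrow> 'a"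
    and multf :: "'a \<Rightarrow> 'a \<Rightarrow> 'a" and onef :: 'a
  assumes add_closed: "x \<in> A \<Longrightarrow> y \<in> A \<Longrightarrow> addf x y \<in> A"
    and smult_closed: "x \<in> A \<Longrightarrow> smultf c x \<in> A"
    and mult_closed: "x \<in> A \<Longrightarrow> y \<in> A \<Longrightarrow> multf x y \<in> A"
    and one_closed: "onef \<in> A"
    and assoc: "x \<in> A \<Longrightarrow> y \<in> A \<Longrightarrow> z \<in> A \<Longrightarrow> multf (multf x y) z = multf x (multf y z)"
    and distl: "x \<in> A \<Longrightarrow> y \<in> A \<Longrightarrow> z \<in> A \<Longrightarrow> multf x (addf y z) = addf (multf x y) (multf x z)"
    and distr: "x \<in> A \<Longrightarrow> y \<in> A \<Longrightarrow> z \<in> A \<Longrightarrow> multf (addf x y) z = addf (multf x z) (multf y z)"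
    and smultl: "x \<in> A \<Longrightarrow> y \<in> A \<Longrightarrow> multf (smultf c x) y = smultf c (multf x y)"
    and smultr: "x \<in> A \<Longrightarrow> y \<in> A \<Longrightarrow> multf x (smultf c y) = smultf c (multf x y)"
    and onel: "x \<in> A \<Longrightarrow> multf onef x = x"
    and oner: "x \<in> A \<Longrightarrow> multf x onef = x"
begin

text \<open>A module map \<open>\<theta>\<close> out of the regular module is determined by its
  value at the unit: \<open>\<theta> a x = \<theta> (a 1) x = \<theta> 1 (x a)\<close>. Hence
  \<open>\<mu> = \<theta> onef\<close>.\<close>

lemma frobenius_iff_form:
  "frobenius_alg A addf smultf multf \<longleftrightarrow> (\<exists>\<mu>. frobenius_form A addf smultf multf \<mu>)"
proof
  assume "frobenius_alg A addf smultf multf"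
  then obtain \<theta> where \<theta>:
    "\<And>a. a \<in> A \<Longrightarrow> lin_functional A addf smultf (\<theta> a)"
    "\<And>a b x. a \<in> A \<Longrightarrow> b \<in> A \<Longrightarrow> x \<in> A \<Longrightarrow> \<theta> (multf a b) x = \<theta> b (multf x a)"
    "\<And>a b. a \<in> A \<Longrightarrow> b \<in> A \<Longrightarrow> (\<forall>x\<in>A. \<theta> a x = \<theta> b x) \<Longrightarrow> a = b"
    "\<And>\<phi>. lin_functional A addf smultf \<phi> \<Longrightarrow> \<exists>a\<in>A. \<forall>x\<in>A. \<theta> a x = \<phi> x"
    unfolding frobenius_alg_def
    apply (elim exE conjE)
    subgoal for \<theta> by (rule that[of \<theta>]; blast)
    done
  have *: "\<theta> a x = \<theta> onef (multf x a)" if "a \<in> A" "x \<in> A" for a x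
    using \<theta>(2)[OF that(1) one_closed that(2)] oner[OF that(1)] by simp
  have "frobenius_form A addf smultf multf (\<theta> onef)"
    unfolding frobenius_form_def using \<theta>(1)[OF one_closed] \<theta>(3,4) * by metis
  then show "\<exists>\<mu>. frobenius_form A addf smultf multf \<mu>" by blast
next
  assume "\<exists>\<mu>. frobenius_form A addf smultf multf \<mu>"
  then obtain \<mu> where \<mu>: "frobenius_form A addf smultf multf \<mu>" ..
  note l = frobenius_formD(1)[OF \<mu>] and i = frobenius_formD(2)[OF \<mu>] and s = frobenius_formD(3)[OF \<mu>]
  show "frobenius_alg A addf smultf multf"
    unfolding frobenius_alg_def
  proof (rule exI[of _ "\<lambda>a x. \<mu> (multf x a)"], intro conjI ballI allI impI)
    fix a assume "a \<in> A"
    then show "lin_functional A addf smultf (\<lambda>x. \<mu> (multf x a))"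
      using l by (auto simp: lin_functional_def distr smultl mult_closed)
  next
    fix \<phi> assume "lin_functional A addf smultf \<phi>"
    from s[OF this] show "\<exists>a\<in>A. \<forall>x\<in>A. \<mu> (multf x a) = \<phi> x" by metis
  qed (use l i in \<open>auto simp: lin_functional_def distl smultr mult_closed assoc\<close>)
qed

end

text \<open>The image of \<open>\<Phi>\<close> is a two-sided ideal of B on which B acts through
  \<open>r\<close>; \<open>\<Phi>\<close> itself need not be multiplicative. The form on E is
  \<open>\<mu>\<close> after \<open>\<Phi>\<close>. Injectivity holds because b
  \<open>\<Phi>\<close>(a) is \<open>\<Phi>\<close>(r(b) a), so testing \<open>\<Phi>\<close>(a)
  against B amounts to testing a against E. To represent \<open>\<phi>\<close>, extend it along
  \<open>\<Phi>\<close> to B, represent the extension by some b and take r(b).\<close>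

lemma frobenius_alg_descend:
  assumes B: "unital_alg B addB smB multB oneB" and E: "unital_alg E addE smE multE oneE"
    and frob: "frobenius_alg B addB smB multB"
    and \<Phi>: "\<And>x. x \<in> E \<Longrightarrow> \<Phi> x \<in> B" and r: "\<And>b. b \<in> B \<Longrightarrow> r b \<in> E"
    and inj: "inj_on \<Phi> E"
    and add: "\<And>x y. x \<in> E \<Longrightarrow> y \<in> E \<Longrightarrow> \<Phi> (addE x y) = addB (\<Phi> x) (\<Phi> y)"
    and smult: "\<And>c x. x \<in> E \<Longrightarrow> \<Phi> (smE c x) = smB c (\<Phi> x)"
    and left: "\<And>b x. b \<in> B \<Longrightarrow> x \<in> E \<Longrightarrow> multB b (\<Phi> x) = \<Phi> (multE (r b) x)"
    and right: "\<And>b x. b \<in> B \<Longrightarrow> x \<in> E \<Longrightarrow> multB (\<Phi> x) b = \<Phi> (multE x (r b))"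
    and ext: "\<And>\<phi>. lin_functional E addE smE \<phi> \<Longrightarrow>
        \<exists>\<psi>. lin_functional B addB smB \<psi> \<and> (\<forall>x\<in>E. \<psi> (\<Phi> x) = \<phi> x)"
  shows "frobenius_alg E addE smE multE"
proof -
  interpret B: unital_alg B addB smB multB oneB by fact
  interpret E: unital_alg E addE smE multE oneE by fact
  from frob obtain \<mu> where \<mu>: "frobenius_form B addB smB multB \<mu>"
    unfolding B.frobenius_iff_form by blast
  note l = frobenius_formD(1)[OF \<mu>] and i = frobenius_formD(2)[OF \<mu>] and s = frobenius_formD(3)[OF \<mu>]
  have "frobenius_form E addE smE multE (\<lambda>x. \<mu> (\<Phi> x))"
    unfolding frobenius_form_def
  proof (intro conjI ballI allI impI)
    show "lin_functional E addE smE (\<lambda>x. \<mu> (\<Phi> x))"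
      using l \<Phi> add smult by (auto simp: lin_functional_def)
  next
    fix a b assume ab: "a \<in> E" "b \<in> E" and *: "\<forall>x\<in>E. \<mu> (\<Phi> (multE x a)) = \<mu> (\<Phi> (multE x b))"
    have "\<Phi> a = \<Phi> b"
      using ab \<Phi> left * r by (intro i) auto
    then show "a = b" using inj ab by (auto dest: inj_onD)
  next
    fix \<phi> assume "lin_functional E addE smE \<phi>"
    from ext[OF this] obtain \<psi> where \<psi>: "lin_functional B addB smB \<psi>" "\<forall>x\<in>E. \<psi> (\<Phi> x) = \<phi> x" by blast
    from s[OF \<psi>(1)] obtain b where "b \<in> B" "\<forall>x\<in>B. \<psi> x = \<mu> (multB x b)" by blast
    with \<psi>(2) right \<Phi> r show "\<exists>a\<in>E. \<forall>x\<in>E. \<phi> x = \<mu> (\<Phi> (multE x a))"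
      by (intro bexI[of _ "r b"]) auto
  qed
  then show ?thesis unfolding E.frobenius_iff_form by blast
qed

section \<open>Finite products of Frobenius algebras\<close>

lemma lin_functional_sum:
  fixes f :: "'i \<Rightarrow> 'v::ab_group_add"
  assumes \<phi>: "lin_functional B (+) sm \<phi>" and 0: "0 \<in> B"
    and cl: "\<And>x y. x \<in> B \<Longrightarrow> y \<in> B \<Longrightarrow> x + y \<in> B" and f: "\<And>i. i \<in> I \<Longrightarrow> f i \<in> B"
  shows "\<phi> (sum f I) = (\<Sum>i\<in>I. \<phi> (f i)) \<and> sum f I \<in> B"
proof -
  have "\<phi> 0 = \<phi> 0 + \<phi> 0" using lin_functional_add[OF \<phi> 0 0] by simp
  then have z: "\<phi> 0 = 0" by (metis add_cancel_left_right)
  show ?thesis using f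
  proof (induction I rule: infinite_finite_induct)
    case (insert i I)
    then show ?case using cl lin_functional_add[OF \<phi>, of "f i" "sum f I"] by auto
  qed (use z 0 in auto)
qed

text \<open>B is the product of the \<open>E i\<close>, described by its projections
  \<open>r i\<close> and embeddings \<open>\<Phi> i\<close>; the sum of the forms of the factors,
  pulled back along the projections, is a Frobenius form. The zero of \<open>E j\<close> is spelled
  \<open>smE 0 (oneE j)\<close>, since for matrices it depends on the size.\<close>

lemma frobenius_alg_product:
  fixes B :: "'v::ab_group_add set" and E :: "'i \<Rightarrow> 'e set" and smB :: "'k::field \<Rightarrow> 'v \<Rightarrow> 'v"
  assumes B: "unital_alg B (+) smB multB oneB" and 0: "0 \<in> B"
    and fin: "finite I"
    and E: "\<And>i. i \<in> I \<Longrightarrow> unital_alg (E i) addE smE multE (oneE i)"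
    and frob: "\<And>i. i \<in> I \<Longrightarrow> frobenius_alg (E i) addE smE multE"
    and r: "\<And>i b. i \<in> I \<Longrightarrow> b \<in> B \<Longrightarrow> r i b \<in> E i"
    and radd: "\<And>i b c. i \<in> I \<Longrightarrow> b \<in> B \<Longrightarrow> c \<in> B \<Longrightarrow> r i (b + c) = addE (r i b) (r i c)"
    and rsm: "\<And>i b c. i \<in> I \<Longrightarrow> b \<in> B \<Longrightarrow> r i (smB c b) = smE c (r i b)"
    and rmult: "\<And>i b c. i \<in> I \<Longrightarrow> b \<in> B \<Longrightarrow> c \<in> B \<Longrightarrow> r i (multB b c) = multE (r i b) (r i c)"
    and rinj: "\<And>b c. b \<in> B \<Longrightarrow> c \<in> B \<Longrightarrow> (\<And>i. i \<in> I \<Longrightarrow> r i b = r i c) \<Longrightarrow> b = c"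
    and \<Phi>: "\<And>i x. i \<in> I \<Longrightarrow> x \<in> E i \<Longrightarrow> \<Phi> i x \<in> B"
    and \<Phi>add: "\<And>i x y. i \<in> I \<Longrightarrow> x \<in> E i \<Longrightarrow> y \<in> E i \<Longrightarrow> \<Phi> i (addE x y) = \<Phi> i x + \<Phi> i y"
    and \<Phi>sm: "\<And>i c x. i \<in> I \<Longrightarrow> x \<in> E i \<Longrightarrow> \<Phi> i (smE c x) = smB c (\<Phi> i x)"
    and r\<Phi>: "\<And>i x. i \<in> I \<Longrightarrow> x \<in> E i \<Longrightarrow> r i (\<Phi> i x) = x"
    and r\<Phi>': "\<And>i j x. i \<in> I \<Longrightarrow> j \<in> I \<Longrightarrow> i \<noteq> j \<Longrightarrow> x \<in> E i \<Longrightarrow> r j (\<Phi> i x) = smE 0 (oneE j)"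
  shows "frobenius_alg B (+) smB multB"
proof -
  interpret B: unital_alg B "(+)" smB multB oneB by fact
  have "\<exists>\<mu>. frobenius_form (E i) addE smE multE \<mu>" if "i \<in> I" for i
    using frob[OF that] unital_alg.frobenius_iff_form[OF E[OF that]] by blast
  then obtain \<nu> where \<nu>: "\<And>i. i \<in> I \<Longrightarrow> frobenius_form (E i) addE smE multE (\<nu> i)" by metis
  note l = frobenius_formD(1)[OF \<nu>] and i = frobenius_formD(2)[OF \<nu>] and s = frobenius_formD(3)[OF \<nu>]
  define \<mu> where "\<mu> b = (\<Sum>i\<in>I. \<nu> i (r i b))" for b
  have lin: "lin_functional B (+) smB \<mu>"
    unfolding lin_functional_def \<mu>_def
    using l r by (auto simp: radd rsm lin_functional_def sum.distrib sum_distrib_left intro!: sum.cong)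
  have key: "\<nu> j (multE (r j (\<Phi> i x)) y) = (if i = j then \<nu> i (multE x y) else 0)"
    "\<nu> j (multE y (r j (\<Phi> i x))) = (if i = j then \<nu> i (multE y x) else 0)"
    if "i \<in> I" "j \<in> I" "x \<in> E i" "y \<in> E j" for i j x y
  proof -
    interpret Ej: unital_alg "E j" addE smE multE "oneE j" using E that by blast
    have "\<nu> j (multE (smE 0 (oneE j)) y) = 0" "\<nu> j (multE y (smE 0 (oneE j))) = 0"
      using that l[OF that(2)] by (auto simp: Ej.smultl Ej.smultr Ej.one_closed Ej.mult_closed lin_functional_def)
    then show "\<nu> j (multE (r j (\<Phi> i x)) y) = (if i = j then \<nu> i (multE x y) else 0)"
      "\<nu> j (multE y (r j (\<Phi> i x))) = (if i = j then \<nu> i (multE y x) else 0)"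
      using that r\<Phi> r\<Phi>' by auto
  qed
  have \<mu>\<Phi>: "\<mu> (multB (\<Phi> i x) b) = \<nu> i (multE x (r i b))" "\<mu> (multB b (\<Phi> i x)) = \<nu> i (multE (r i b) x)"
    if "i \<in> I" "x \<in> E i" "b \<in> B" for i x b
    using that fin by (simp_all add: \<mu>_def rmult \<Phi> key r sum.delta)
  have mult: "\<mu> (multB b (\<Sum>i\<in>I. \<Phi> i (X i))) = (\<Sum>i\<in>I. \<nu> i (multE (r i b) (X i)))"
    if b: "b \<in> B" and X: "\<And>i. i \<in> I \<Longrightarrow> X i \<in> E i" for b X
  proof -
    have "lin_functional B (+) smB (\<lambda>c. \<mu> (multB b c))"
      using lin b by (auto simp: lin_functional_def B.distl B.smultr B.mult_closed)
    from lin_functional_sum[OF this 0 B.add_closed, of I "\<lambda>i. \<Phi> i (X i)"] \<Phi> X b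
    show ?thesis by (simp add: \<mu>\<Phi>)
  qed
  have decomp: "(\<Sum>i\<in>I. \<Phi> i (X i)) \<in> B" "i \<in> I \<Longrightarrow> r i (\<Sum>j\<in>I. \<Phi> j (X j)) = X i"
    if X: "\<And>i. i \<in> I \<Longrightarrow> X i \<in> E i" for X i
  proof -
    show cl: "(\<Sum>i\<in>I. \<Phi> i (X i)) \<in> B"
      using lin_functional_sum[OF lin 0 B.add_closed, of I "\<lambda>i. \<Phi> i (X i)"] \<Phi> X by blast
    assume i: "i \<in> I"
    \<comment> \<open>Summation inside \<open>E i\<close> is avoided: the two sides are compared
      under the nondegenerate form \<open>\<nu> i\<close>, which moves the sum into the
      field.\<close>
    show "r i (\<Sum>j\<in>I. \<Phi> j (X j)) = X i"
    proof (rule frobenius_formD(2)[OF \<nu>[OF i]])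
      fix x assume x: "x \<in> E i"
      have "\<nu> i (multE x (r i (\<Sum>j\<in>I. \<Phi> j (X j)))) = \<mu> (multB (\<Phi> i x) (\<Sum>j\<in>I. \<Phi> j (X j)))"
        using \<mu>\<Phi>(1)[OF i x cl] by simp
      also have "\<dots> = (\<Sum>j\<in>I. \<nu> j (multE (r j (\<Phi> i x)) (X j)))"
        using X \<Phi> i x by (intro mult) auto
      also have "\<dots> = (\<Sum>j\<in>I. if i = j then \<nu> i (multE x (X i)) else 0)"
        using key i x X by (intro sum.cong) auto
      finally show "\<nu> i (multE x (r i (\<Sum>j\<in>I. \<Phi> j (X j)))) = \<nu> i (multE x (X i))"
        using fin i by simp
    qed (use X i r cl in auto)
  qed
  have "frobenius_form B (+) smB multB \<mu>"
    unfolding frobenius_form_def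
  proof (intro conjI ballI allI impI)
    fix a b assume ab: "a \<in> B" "b \<in> B" and *: "\<forall>x\<in>B. \<mu> (multB x a) = \<mu> (multB x b)"
    show "a = b"
    proof (rule rinj[OF ab])
      fix j assume j: "j \<in> I"
      show "r j a = r j b"
      proof (rule i[OF j])
        fix x assume "x \<in> E j"
        then show "\<nu> j (multE x (r j a)) = \<nu> j (multE x (r j b))"
          using \<mu>\<Phi>(1)[OF j] * ab \<Phi>[OF j] by metis
      qed (use r j ab in auto)
    qed
  next
    fix \<phi> assume \<phi>: "lin_functional B (+) smB \<phi>"
    have "\<exists>X. X \<in> E i \<and> (\<forall>x\<in>E i. \<phi> (\<Phi> i x) = \<nu> i (multE x X))" if i: "i \<in> I" for i
    proof -
      have "lin_functional (E i) addE smE (\<lambda>x. \<phi> (\<Phi> i x))"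
        using \<phi> \<Phi> i by (auto simp: lin_functional_def \<Phi>add \<Phi>sm)
      from s[OF i this] show ?thesis by blast
    qed
    then obtain X where X: "\<And>i. i \<in> I \<Longrightarrow> X i \<in> E i"
      "\<And>i x. i \<in> I \<Longrightarrow> x \<in> E i \<Longrightarrow> \<phi> (\<Phi> i x) = \<nu> i (multE x (X i))"
      by metis
    show "\<exists>a\<in>B. \<forall>x\<in>B. \<phi> x = \<mu> (multB x a)"
    proof (intro bexI[of _ "\<Sum>i\<in>I. \<Phi> i (X i)"] ballI)
      fix b assume b: "b \<in> B"
      \<comment> \<open>The element b is the sum of its components, since both sides have the same
        projections.\<close>
      have b': "b = (\<Sum>i\<in>I. \<Phi> i (r i b))"
        using b r decomp[of "\<lambda>i. r i b"] by (intro rinj) auto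
      have "\<phi> b = (\<Sum>i\<in>I. \<phi> (\<Phi> i (r i b)))"
        by (subst b') (use lin_functional_sum[OF \<phi> 0 B.add_closed, of I "\<lambda>i. \<Phi> i (r i b)"] \<Phi> r b in auto)
      also have "\<dots> = \<mu> (multB b (\<Sum>i\<in>I. \<Phi> i (X i)))"
        using X r b by (simp add: mult)
      finally show "\<phi> b = \<mu> (multB b (\<Sum>i\<in>I. \<Phi> i (X i)))" .
    qed (use decomp X in auto)
  qed (fact lin)
  then show ?thesis unfolding B.frobenius_iff_form by blast
qed

section \<open>The group algebra\<close>

definition delta :: "'g \<Rightarrow> 'g \<Rightarrow> 'k::field" where
  "delta x = (\<lambda>g. if g = x then 1 else 0)"

lemma delta_apply: "delta x g = (if g = x then 1 else 0)"
  by (simp add: delta_def)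

lemma ga_smult_apply: "ga_smult c a g = c * a g"
  by (simp add: ga_smult_def)

lemma ga_smult_zero [simp]: "ga_smult c 0 = 0" "ga_smult 0 a = 0"
  by (simp_all add: ga_smult_def fun_eq_iff)

lemma ga_add_eq: "ga_add = (+)"
  by (auto simp: ga_add_def fun_eq_iff)

locale fin_group = group G for G (structure) +
  assumes fin [simp]: "finite (carrier G)"
begin

lemma sum_translate:
  assumes "x \<in> carrier G"
  shows "(\<Sum>h\<in>carrier G. f (x \<otimes> h)) = (\<Sum>h\<in>carrier G. f h)"
  using assms
  by (intro sum.reindex_bij_witness[of _ "\<lambda>h. inv x \<otimes> h" "\<lambda>h. x \<otimes> h"])
     (auto simp: m_assoc[symmetric])

lemma sum_translate_right:
  assumes "x \<in> carrier G"
  shows "(\<Sum>h\<in>carrier G. f (h \<otimes> x)) = (\<Sum>h\<in>carrier G. f h)"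
  using assms
  by (intro sum.reindex_bij_witness[of _ "\<lambda>h. h \<otimes> inv x" "\<lambda>h. h \<otimes> x"]) (auto simp: m_assoc)

lemma sum_conj:
  assumes "x \<in> carrier G"
  shows "(\<Sum>h\<in>carrier G. f (inv x \<otimes> h \<otimes> x)) = (\<Sum>h\<in>carrier G. f h)"
  using assms sum_translate_right[of x "\<lambda>h. f (inv x \<otimes> h)"] sum_translate[of "inv x" f]
  by (simp add: m_assoc)

lemma group_algD: "a \<in> group_alg G \<Longrightarrow> g \<notin> carrier G \<Longrightarrow> a g = 0"
  by (simp add: group_alg_def)

lemma group_alg_eqI:
  assumes "a \<in> group_alg G" "b \<in> group_alg G" "\<And>g. g \<in> carrier G \<Longrightarrow> a g = b g"
  shows "a = b"
proof
  fix g show "a g = b g"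
    by (cases "g \<in> carrier G") (use assms group_algD[OF assms(1)] group_algD[OF assms(2)] in auto)
qed

lemma ga_mult_in [simp]: "ga_mult G a b \<in> group_alg G"
  by (auto simp: ga_mult_def group_alg_def)

lemma ga_add_in [simp]: "a \<in> group_alg G \<Longrightarrow> b \<in> group_alg G \<Longrightarrow> a + b \<in> group_alg G"
  and ga_smult_in [simp]: "a \<in> group_alg G \<Longrightarrow> ga_smult c a \<in> group_alg G"
  and zero_in_group_alg [simp]: "0 \<in> group_alg G"
  and delta_in [simp]: "x \<in> carrier G \<Longrightarrow> delta x \<in> group_alg G"
  and ga_conj_in [simp]: "ga_conj G x a \<in> group_alg G"
  by (auto simp: group_alg_def ga_smult_def delta_def ga_conj_def)

lemma ga_mult_apply:
  "g \<in> carrier G \<Longrightarrow> ga_mult G a b g = (\<Sum>h\<in>carrier G. a h * b (inv h \<otimes> g))"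
  by (simp add: ga_mult_def)

lemma ga_mult_assoc: "ga_mult G (ga_mult G a b) c = ga_mult G a (ga_mult G b c)"
proof (rule group_alg_eqI)
  fix g assume g: "g \<in> carrier G"
  have "ga_mult G (ga_mult G a b) c g =
      (\<Sum>h\<in>carrier G. \<Sum>l\<in>carrier G. a l * b (inv l \<otimes> h) * c (inv h \<otimes> g))"
    using g by (simp add: ga_mult_apply sum_distrib_right)
  also have "\<dots> = (\<Sum>l\<in>carrier G. \<Sum>h\<in>carrier G. a l * b (inv l \<otimes> h) * c (inv h \<otimes> g))"
    by (rule sum.swap)
  also have "\<dots> = (\<Sum>l\<in>carrier G. \<Sum>m\<in>carrier G. a l * b m * c (inv m \<otimes> (inv l \<otimes> g)))"
  proof (rule sum.cong[OF refl])
    fix l assume l: "l \<in> carrier G"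
    have "(\<Sum>m\<in>carrier G. a l * b (inv l \<otimes> (l \<otimes> m)) * c (inv (l \<otimes> m) \<otimes> g))
        = (\<Sum>h\<in>carrier G. a l * b (inv l \<otimes> h) * c (inv h \<otimes> g))"
      by (rule sum_translate[OF l])
    then show "(\<Sum>h\<in>carrier G. a l * b (inv l \<otimes> h) * c (inv h \<otimes> g)) =
        (\<Sum>m\<in>carrier G. a l * b m * c (inv m \<otimes> (inv l \<otimes> g)))"
      using l g by (simp add: m_assoc[symmetric] inv_mult_group)
  qed
  also have "\<dots> = ga_mult G a (ga_mult G b c) g"
    using g by (simp add: ga_mult_apply sum_distrib_left mult.assoc)
  finally show "ga_mult G (ga_mult G a b) c g = ga_mult G a (ga_mult G b c) g" .
qed auto

lemma ga_mult_distl: "ga_mult G a (b + c) = ga_mult G a b + ga_mult G a c"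
  and ga_mult_distr: "ga_mult G (a + b) c = ga_mult G a c + ga_mult G b c"
  and ga_mult_smultl: "ga_mult G (ga_smult t a) b = ga_smult t (ga_mult G a b)"
  and ga_mult_smultr: "ga_mult G a (ga_smult t b) = ga_smult t (ga_mult G a b)"
  by (auto simp: ga_mult_def ga_smult_def fun_eq_iff algebra_simps sum.distrib sum_distrib_left)

lemma ga_mult_zero [simp]: "ga_mult G 0 a = 0" "ga_mult G a 0 = 0"
  by (auto simp: ga_mult_def fun_eq_iff)

lemma delta_mult:
  assumes "x \<in> carrier G" "g \<in> carrier G"
  shows "ga_mult G (delta x) b g = b (inv x \<otimes> g)"
proof -
  have "ga_mult G (delta x) b g = (\<Sum>h\<in>carrier G. if h = x then b (inv h \<otimes> g) else 0)"
    unfolding ga_mult_apply[OF assms(2)] by (rule sum.cong) (auto simp: delta_apply)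
  then show ?thesis using assms by (simp add: sum.delta)
qed

lemma mult_delta:
  assumes "x \<in> carrier G" "g \<in> carrier G"
  shows "ga_mult G b (delta x) g = b (g \<otimes> inv x)"
proof -
  have "h = g \<otimes> inv x" if "h \<in> carrier G" "inv h \<otimes> g = x" for h
  proof -
    have "g = h \<otimes> x" using that assms by (simp add: inv_solve_left')
    then show ?thesis using that assms by (simp add: m_assoc)
  qed
  moreover have "inv (g \<otimes> inv x) \<otimes> g = x"
    using assms by (simp add: inv_mult_group m_assoc)
  ultimately have eq: "inv h \<otimes> g = x \<longleftrightarrow> h = g \<otimes> inv x" if "h \<in> carrier G" for h
    using that by blast
  have "ga_mult G b (delta x) g = (\<Sum>h\<in>carrier G. if h = g \<otimes> inv x then b h else 0)"
    unfolding ga_mult_apply[OF assms(2)]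
  proof (rule sum.cong[OF refl])
    fix h assume h: "h \<in> carrier G"
    show "b h * delta x (inv h \<otimes> g) = (if h = g \<otimes> inv x then b h else 0)"
      unfolding delta_apply eq[OF h] by simp
  qed
  then show ?thesis using assms by (simp add: sum.delta)
qed

lemma delta_one_mult [simp]:
  assumes "a \<in> group_alg G"
  shows "ga_mult G (delta \<one>) a = a" "ga_mult G a (delta \<one>) = a"
  using assms by (auto intro!: group_alg_eqI simp: delta_mult mult_delta)

lemma delta_mult_delta:
  assumes "x \<in> carrier G" "y \<in> carrier G"
  shows "ga_mult G (delta x) (delta y) = delta (x \<otimes> y)"
  using assms by (intro group_alg_eqI) (auto simp: delta_mult delta_apply m_assoc[symmetric] inv_solve_left)

lemma ga_conj_eq:
  assumes "x \<in> carrier G" "a \<in> group_alg G"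
  shows "ga_conj G x a = ga_mult G (ga_mult G (delta x) a) (delta (inv x))"
  using assms by (intro group_alg_eqI) (simp_all add: delta_mult mult_delta, simp add: ga_conj_def m_assoc)

lemma ga_conj_mult:
  assumes x: "x \<in> carrier G" and "a \<in> group_alg G" "b \<in> group_alg G"
  shows "ga_conj G x (ga_mult G a b) = ga_mult G (ga_conj G x a) (ga_conj G x b)"
proof (rule group_alg_eqI)
  fix g assume g: "g \<in> carrier G"
  have "(\<Sum>h\<in>carrier G. a (inv x \<otimes> h \<otimes> x) * b (inv (inv x \<otimes> h \<otimes> x) \<otimes> (inv x \<otimes> g \<otimes> x)))
      = (\<Sum>h\<in>carrier G. a h * b (inv h \<otimes> (inv x \<otimes> g \<otimes> x)))"
    using x by (rule sum_conj)
  moreover have "inv (inv x \<otimes> h \<otimes> x) \<otimes> (inv x \<otimes> g \<otimes> x) = inv x \<otimes> (inv h \<otimes> g) \<otimes> x"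
    if "h \<in> carrier G" for h
  proof -
    have "x \<otimes> (inv x \<otimes> (g \<otimes> x)) = g \<otimes> x"
      using x g by (simp add: m_assoc[symmetric])
    then show ?thesis
      using x g that by (simp add: inv_mult_group m_assoc)
  qed
  ultimately show "ga_conj G x (ga_mult G a b) g = ga_mult G (ga_conj G x a) (ga_conj G x b) g"
    using x g by (simp add: ga_conj_def ga_mult_apply)
qed auto

lemma ga_conj_conj:
  assumes "x \<in> carrier G" "y \<in> carrier G"
  shows "ga_conj G x (ga_conj G y a) = ga_conj G (x \<otimes> y) a"
  using assms by (auto simp: ga_conj_def fun_eq_iff inv_mult_group m_assoc)

lemma ga_conj_add: "ga_conj G x (a + b) = ga_conj G x a + ga_conj G x b"
  and ga_conj_smult: "ga_conj G x (ga_smult c a) = ga_smult c (ga_conj G x a)"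
  and ga_conj_zero [simp]: "ga_conj G x 0 = 0"
  by (auto simp: ga_conj_def ga_smult_def fun_eq_iff)

lemma ga_conj_delta_one:
  assumes x: "x \<in> carrier G"
  shows "ga_conj G x (delta \<one>) = delta \<one>"
  using x by (simp add: ga_conj_eq delta_mult_delta)

lemma centralizer_alg_iff:
  assumes "P \<subseteq> carrier G"
  shows "a \<in> centralizer_alg G P \<longleftrightarrow>
    a \<in> group_alg G \<and> (\<forall>x\<in>P. \<forall>g\<in>carrier G. a (inv x \<otimes> g \<otimes> x) = a g)"
  using assms by (auto simp: centralizer_alg_def ga_conj_def fun_eq_iff group_alg_def)

lemma delta_commute:
  assumes "a \<in> centralizer_alg G P" "x \<in> P" "P \<subseteq> carrier G"
  shows "ga_mult G (delta x) a = ga_mult G a (delta x)"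
proof (rule group_alg_eqI)
  fix g assume g: "g \<in> carrier G"
  have x: "x \<in> carrier G" using assms by auto
  have "a (inv x \<otimes> (g \<otimes> inv x) \<otimes> x) = a (g \<otimes> inv x)"
    using assms g x by (auto simp: centralizer_alg_iff)
  then show "ga_mult G (delta x) a g = ga_mult G a (delta x) g"
    using g x by (simp add: delta_mult mult_delta m_assoc)
qed auto

text \<open>For a subgroup N this is kN, embedded in kG by extending functions by zero.\<close>

definition supp_on :: "'a set \<Rightarrow> ('a \<Rightarrow> 'k::field) set" where
  "supp_on N = {a. \<forall>g. g \<notin> N \<longrightarrow> a g = 0}"

lemma supp_on_mult:
  assumes N: "subgroup N G" and a: "a \<in> supp_on N" and b: "b \<in> supp_on N"
  shows "ga_mult G a b \<in> supp_on N"
  unfolding supp_on_def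
proof (intro CollectI allI impI)
  fix g assume g: "g \<notin> N"
  have "a h * b (inv h \<otimes> g) = 0" if "g \<in> carrier G" "h \<in> carrier G" for h
  proof (cases "h \<in> N")
    case True
    have "h \<otimes> (inv h \<otimes> g) = g" using that by (simp add: m_assoc[symmetric])
    then have "inv h \<otimes> g \<notin> N"
      using g subgroup.m_closed[OF N True, of "inv h \<otimes> g"] by auto
    then have "b (inv h \<otimes> g) = 0" using b unfolding supp_on_def by blast
    then show ?thesis by simp
  next
    case False
    then have "a h = 0" using a unfolding supp_on_def by blast
    then show ?thesis by simp
  qed
  then show "ga_mult G a b g = 0" unfolding ga_mult_def by (simp add: sum.neutral)
qed

lemma supp_on_subset: "N \<subseteq> carrier G \<Longrightarrow> supp_on N \<subseteq> group_alg G"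
  by (auto simp: supp_on_def group_alg_def)

text \<open>Serves both (kN)^P and, with N the whole group, kG^P.\<close>

lemma centralizer_subalgebra:
  assumes P: "P \<subseteq> carrier G" and N: "subgroup N G"
  shows "unital_alg (centralizer_alg G P \<inter> supp_on N :: ('a \<Rightarrow> 'k::field) set)
    (+) ga_smult (ga_mult G) (delta \<one>)" (is "unital_alg ?A _ _ _ _")
proof -
  have add: "x + y \<in> ?A" if "x \<in> ?A" "y \<in> ?A" for x y
    using that by (simp add: centralizer_alg_def ga_conj_add supp_on_def)
  have smult: "ga_smult c x \<in> ?A" if "x \<in> ?A" for c x
    using that by (simp add: centralizer_alg_def ga_conj_smult supp_on_def ga_smult_apply)
  have mult: "ga_mult G x y \<in> ?A" if "x \<in> ?A" "y \<in> ?A" for x y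
    using that subsetD[OF P] supp_on_mult[OF N, of x y] by (simp add: centralizer_alg_def ga_conj_mult)
  have one: "delta \<one> \<in> ?A"
    using subsetD[OF P] subgroup.one_closed[OF N]
    by (auto simp: centralizer_alg_def ga_conj_delta_one supp_on_def delta_apply)
  have sub: "x \<in> group_alg G" if "x \<in> ?A" for x
    using that by (simp add: centralizer_alg_def)
  show ?thesis
    by unfold_locales
      (rule add smult mult one ga_mult_assoc ga_mult_distl ga_mult_distr ga_mult_smultl ga_mult_smultr
        delta_one_mult(1)[OF sub] delta_one_mult(2)[OF sub]; assumption)+
qed

lemma supp_on_carrier: "supp_on (carrier G) = group_alg G"
  by (auto simp: supp_on_def group_alg_def)

lemma centralizer_algebra:
  assumes "P \<subseteq> carrier G"
  shows "unital_alg (centralizer_alg G P :: ('a \<Rightarrow> 'k::field) set) (+) ga_smult (ga_mult G) (delta \<one>)"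
proof -
  have "centralizer_alg G P \<inter> supp_on (carrier G) = (centralizer_alg G P :: ('a \<Rightarrow> 'k) set)"
    by (auto simp: supp_on_carrier centralizer_alg_def)
  then show ?thesis using centralizer_subalgebra[OF assms subgroup_self] by metis
qed

end

section \<open>Fixed points of $p$-groups\<close>

context fin_group
begin

text \<open>The element \<open>inv n' \<otimes> n = x' \<otimes> inv x\<close> lies in both
  subgroups.\<close>

lemma complement_unique:
  assumes N: "subgroup N G" and P: "subgroup P G" and int: "N \<inter> P = {\<one>}"
    and mem: "n \<in> N" "n' \<in> N" "x \<in> P" "x' \<in> P" and eq: "n \<otimes> x = n' \<otimes> x'"
  shows "n = n' \<and> x = x'"
proof -
  interpret N: subgroup N G by fact
  interpret P: subgroup P G by fact
  have "inv n' \<otimes> n = inv n' \<otimes> (n \<otimes> x) \<otimes> inv x" using mem by (simp add: m_assoc)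
  also have "\<dots> = inv n' \<otimes> (n' \<otimes> x') \<otimes> inv x" by (simp only: eq)
  also have "inv n' \<otimes> (n' \<otimes> x') = x'" using mem by (simp add: m_assoc[symmetric])
  finally have e: "inv n' \<otimes> n = x' \<otimes> inv x" .
  have "inv n' \<otimes> n \<in> N" using mem by simp
  moreover have "inv n' \<otimes> n \<in> P" unfolding e using mem by simp
  ultimately have 1: "inv n' \<otimes> n = \<one>" using int by blast
  have "n = n' \<otimes> (inv n' \<otimes> n)" using mem by (simp add: m_assoc[symmetric])
  also have "\<dots> = n'" using 1 mem by simp
  finally have n: "n = n'" .
  have "x' = x' \<otimes> inv x \<otimes> x" using mem by (simp add: m_assoc)
  also have "\<dots> = x" using 1 e mem by simp
  finally show ?thesis using n by simp
qed

text \<open>The fibre of \<open>\<lambda>x. act x s\<close> over \<open>act y s\<close> is the left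
  coset of the stabilizer of \<open>s\<close> that contains \<open>y\<close>. The action laws are
  demanded at the single point \<open>s\<close>, so that actions on a subset of a type are
  covered.\<close>

lemma card_eq_card_orbit_stabilizer:
  assumes P: "subgroup P G" and one: "act \<one> s = s"
    and act: "\<And>x y. x \<in> P \<Longrightarrow> y \<in> P \<Longrightarrow> act (x \<otimes> y) s = act x (act y s)"
  shows "card P = card ((\<lambda>x. act x s) ` P) * card {x \<in> P. act x s = s}"
proof -
  interpret P: subgroup P G by fact
  have finP: "finite P" using P.subset finite_subset fin by blast
  have inj: "act x s = act y s \<longleftrightarrow> act (inv x \<otimes> y) s = s" if "x \<in> P" "y \<in> P" for x y
  proof
    assume "act x s = act y s"
    then show "act (inv x \<otimes> y) s = s"
      using that act[of "inv x" y] act[of "inv x" x] one by simp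
  next
    assume *: "act (inv x \<otimes> y) s = s"
    have "y = x \<otimes> (inv x \<otimes> y)" using that by (simp add: m_assoc[symmetric])
    then show "act x s = act y s"
      using that act[of x "inv x \<otimes> y"] * by simp
  qed
  have "card {x \<in> P. act x s = o'} = card {x \<in> P. act x s = s}" if "o' \<in> (\<lambda>x. act x s) ` P" for o'
  proof -
    from that obtain y where y: "y \<in> P" "o' = act y s" by auto
    have "bij_betw (\<lambda>x. inv y \<otimes> x) {x \<in> P. act x s = o'} {x \<in> P. act x s = s}"
    proof (rule bij_betwI[where g = "\<lambda>x. y \<otimes> x"])
      show "(\<lambda>x. inv y \<otimes> x) \<in> {x \<in> P. act x s = o'} \<rightarrow> {x \<in> P. act x s = s}"
      proof
        fix x assume x: "x \<in> {x \<in> P. act x s = o'}"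
        then have "act y s = act x s" using y by simp
        then show "inv y \<otimes> x \<in> {x \<in> P. act x s = s}" using inj[of y x] x y by simp
      qed
      show "(\<lambda>x. y \<otimes> x) \<in> {x \<in> P. act x s = s} \<rightarrow> {x \<in> P. act x s = o'}"
        using y act by simp
      show "y \<otimes> (inv y \<otimes> x) = x" if "x \<in> {x \<in> P. act x s = o'}" for x
        using y that by (simp add: m_assoc[symmetric])
      show "inv y \<otimes> (y \<otimes> x) = x" if "x \<in> {x \<in> P. act x s = s}" for x
        using y that by (simp add: m_assoc[symmetric])
    qed
    then show ?thesis by (rule bij_betw_same_card)
  qed
  moreover have "card P = (\<Sum>o'\<in>(\<lambda>x. act x s) ` P. card {x \<in> P. act x s = o'})"
    using finP card_eq_sum[of P] sum.image_gen[OF finP, of "\<lambda>_. 1::nat" "\<lambda>x. act x s"] by simp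
  ultimately show ?thesis by simp
qed

text \<open>Every orbit has p-power length greater than 1, so an invariant function sums to zero
  over it. The induction removes one orbit at a time; its complement is again stable under
  P.\<close>

lemma sum_invariant_eq_0:
  fixes f :: "'s \<Rightarrow> 'k::field"
  assumes P: "subgroup P G" and card: "card P = p ^ e" and p: "prime p" "CHAR('k) = p"
    and S: "finite S"
    and cl: "\<And>x s. x \<in> P \<Longrightarrow> s \<in> S \<Longrightarrow> act x s \<in> S"
    and one: "\<And>s. s \<in> S \<Longrightarrow> act \<one> s = s"
    and act: "\<And>x y s. x \<in> P \<Longrightarrow> y \<in> P \<Longrightarrow> s \<in> S \<Longrightarrow> act (x \<otimes> y) s = act x (act y s)"
    and inv: "\<And>x s. x \<in> P \<Longrightarrow> s \<in> S \<Longrightarrow> f (act x s) = f s"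
    and nofix: "\<And>s. s \<in> S \<Longrightarrow> \<exists>x\<in>P. act x s \<noteq> s"
  shows "sum f S = 0"
  using S cl one act inv nofix
proof (induction "card S" arbitrary: S rule: less_induct)
  case less
  interpret P: subgroup P G by fact
  have finP: "finite P" using P.subset finite_subset fin by blast
  show ?case
  proof (cases "S = {}")
    case False
    then obtain s where s: "s \<in> S" by auto
    let ?O = "(\<lambda>x. act x s) ` P"
    have c: "card P = card ?O * card {x \<in> P. act x s = s}"
      using s less.prems by (intro card_eq_card_orbit_stabilizer P) auto
    have "card {x \<in> P. act x s = s} < card P"
      using less.prems(6)[OF s] finP by (intro psubset_card_mono) auto
    then have "card ?O \<noteq> 1" using c by auto
    moreover have "card ?O dvd p ^ e" using c card by (metis dvd_triv_left)
    ultimately have "p dvd card ?O"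
      using p by (metis divides_primepow_nat dvd_power gr0I power_0)
    then have 0: "of_nat (card ?O) = (0::'k)" using p by (simp add: of_nat_eq_0_iff_char_dvd)
    have O: "?O \<subseteq> S" using less.prems s by auto
    have sO: "s \<in> ?O" using less.prems(3)[OF s] by (metis P.one_closed image_eqI)
    have "sum f (S - ?O) = 0"
    proof (rule less.hyps)
      show "card (S - ?O) < card S" using s sO less.prems(1) by (intro psubset_card_mono) auto
    next
      fix x t assume x: "x \<in> P" and t: "t \<in> S - ?O"
      have "act x t \<notin> ?O"
      proof
        assume "act x t \<in> ?O"
        then obtain y where y: "y \<in> P" "act x t = act y s" by auto
        have "t = act (inv x) (act x t)"
          using x t less.prems(3)[of t] less.prems(4)[of "inv x" x t] by simp
        also have "\<dots> = act (inv x \<otimes> y) s" using y x s less.prems(4) by simp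
        finally show False using t x y by auto
      qed
      then show "act x t \<in> S - ?O" using less.prems(2) x t by auto
    qed (use less.prems in auto)
    moreover have "sum f ?O = of_nat (card ?O) * f s"
      using less.prems(5) s by (subst sum.cong[OF refl, of _ _ "\<lambda>_. f s"]) auto
    ultimately show ?thesis
      using O less.prems(1) 0 sum.subset_diff[OF O less.prems(1), of f] by simp
  qed simp
qed

text \<open>Let \<open>W\<close> be the finite additive group generated by the \<open>P\<close>-translates of \<open>a\<close>. Translation by \<open>a\<close> shows
  \<open>p | |W|\<close>, while \<open>P\<close> acting on \<open>W - {0}\<close> without fixed points would give \<open>p | |W| - 1\<close>.\<close>
lemma exists_fixed_vector:
  fixes a :: "'a \<Rightarrow> 'k::field"
  assumes P: "subgroup P G" and card: "card P = p ^ e" and p: "prime p" "CHAR('k) = p"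
    and a: "a \<in> group_alg G" "a \<noteq> 0"
  shows "\<exists>c. ga_mult G c a \<noteq> 0 \<and> (\<forall>y\<in>P. ga_mult G (delta y) (ga_mult G c a) = ga_mult G c a)"
proof -
  interpret P: subgroup P G by fact
  have finP: "finite P" using P.subset finite_subset fin by blast
  \<comment> \<open>\<open>R\<close> is the prime field, so \<open>C\<close> is the finite group
    ring of P over it and \<open>W = C a\<close> is finite; over k itself, which is infinite,
    counting would be impossible.\<close>
  define R where "R = range (of_nat :: nat \<Rightarrow> 'k)"
  have "R \<subseteq> of_nat ` {..<p}"
  proof
    fix r assume "r \<in> R"
    then obtain n where "r = of_nat n" by (auto simp: R_def)
    moreover have "of_nat n = (of_nat (n mod p) :: 'k)"
      using p of_nat_CHAR[where 'a = 'k]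
      by (metis add_0 div_mult_mod_eq mult_zero_right of_nat_add of_nat_mult)
    ultimately show "r \<in> of_nat ` {..<p}" using p prime_gt_0_nat by auto
  qed
  then have finR: "finite R" by (rule finite_subset) simp
  have R: "0 \<in> R" "1 \<in> R" "r \<in> R \<Longrightarrow> s \<in> R \<Longrightarrow> r + s \<in> R" for r s
    unfolding R_def by (auto simp: image_iff intro: exI[of _ 0] exI[of _ 1]) (metis of_nat_add)
  define C where "C = {c. \<forall>x. (x \<in> P \<longrightarrow> c x \<in> R) \<and> (x \<notin> P \<longrightarrow> c x = 0)}"
  have finC: "finite C" unfolding C_def using finite_set_of_finite_funs[OF finP finR] by simp
  have Cin: "c \<in> group_alg G" if "c \<in> C" for c
    using that P.subset by (auto simp: C_def group_alg_def)
  have "0 \<in> C" using R by (simp add: C_def)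
  have Cadd: "c + delta \<one> \<in> C" if "c \<in> C" for c
    using that R P.one_closed by (auto simp: C_def delta_apply)
  have Cmult: "ga_mult G (delta y) c \<in> C" if "c \<in> C" "y \<in> P" for c y
  proof -
    have "ga_mult G (delta y) c g \<in> R" if "g \<in> P" for g
      using that \<open>c \<in> C\<close> \<open>y \<in> P\<close> by (simp add: delta_mult C_def)
    moreover have "ga_mult G (delta y) c g = 0" if g: "g \<notin> P" for g
    proof (cases "g \<in> carrier G")
      case True
      have "inv y \<otimes> g \<notin> P"
      proof
        assume "inv y \<otimes> g \<in> P"
        then have "y \<otimes> (inv y \<otimes> g) \<in> P" using \<open>y \<in> P\<close> by blast
        then show False using g True \<open>y \<in> P\<close> by (simp add: m_assoc[symmetric])
      qed
      then show ?thesis using True \<open>c \<in> C\<close> \<open>y \<in> P\<close> by (simp add: delta_mult C_def)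
    next
      case False
      then show ?thesis by (simp add: ga_mult_def)
    qed
    ultimately show ?thesis by (simp add: C_def)
  qed
  define W where "W = (\<lambda>c. ga_mult G c a) ` C"
  have finW: "finite W" unfolding W_def using finC by simp
  have W0: "0 \<in> W" unfolding W_def using \<open>0 \<in> C\<close> by (metis ga_mult_zero(1) image_eqI)
  have Wadd: "w + a \<in> W" if "w \<in> W" for w
  proof -
    from that obtain c where c: "c \<in> C" "w = ga_mult G c a" by (auto simp: W_def)
    then have "w + a = ga_mult G (c + delta \<one>) a" using a by (simp add: ga_mult_distr)
    then show ?thesis unfolding W_def using Cadd[OF c(1)] by blast
  qed
  have Wact: "ga_mult G (delta y) w \<in> W" if "w \<in> W" "y \<in> P" for w y
    using that Cmult by (auto simp: W_def ga_mult_assoc[symmetric])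
  have Win: "w \<in> group_alg G" if "w \<in> W" for w using that by (auto simp: W_def)
  have card0: "of_nat (card W) = (0::'k)"
  proof -
    \<comment> \<open>Summing the coordinate at g over W before and after the translation by a
      yields |W| a(g) = 0 in k.\<close>
    from a(2) obtain g where g: "a g \<noteq> 0" by (auto simp: fun_eq_iff)
    have "(\<lambda>w. w + a) ` W = W"
      using Wadd finW by (intro card_subset_eq card_image) (auto simp: inj_on_def)
    then have "(\<Sum>w\<in>W. w g) = (\<Sum>w\<in>(\<lambda>w. w + a) ` W. w g)" by simp
    also have "\<dots> = (\<Sum>w\<in>W. w g + a g)"
      by (subst sum.reindex) (auto simp: inj_on_def)
    finally show ?thesis using g by (simp add: sum.distrib)
  qed
  show ?thesis
  proof (rule ccontr)
    assume contr: "\<not> ?thesis"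
    have "(\<Sum>w\<in>W - {0}. 1::'k) = 0"
    proof (rule sum_invariant_eq_0[OF P card p, where act = "\<lambda>x. ga_mult G (delta x)"])
      fix x w assume xw: "x \<in> P" "w \<in> W - {0}"
      have "ga_mult G (delta (inv x)) (ga_mult G (delta x) w) = w"
        using xw Win by (simp add: ga_mult_assoc[symmetric] delta_mult_delta)
      then show "ga_mult G (delta x) w \<in> W - {0}"
        using xw Wact by auto
    next
      fix w assume w: "w \<in> W - {0}"
      then show "\<exists>x\<in>P. ga_mult G (delta x) w \<noteq> w" using contr by (auto simp: W_def)
    qed (use finW Win in \<open>auto simp: ga_mult_assoc[symmetric] delta_mult_delta\<close>)
    then have "of_nat (card (W - {0})) = (0::'k)" by simp
    moreover have "card W = Suc (card (W - {0}))" using W0 finW by (metis card.remove)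
    ultimately show False using card0 by simp
  qed
qed

end

text \<open>The type argument \<open>k_type\<close> only records the coefficient field.\<close>
locale p_nilpotent_group = fin_group G for G (structure) +
  fixes p e :: nat and N P :: "'a set" and k_type :: "'k::alg_closed_field itself"
  assumes prime_p: "prime p" and CHAR: "CHAR('k) = p"
    and normal_N: "N \<lhd> G" and subgroup_P: "subgroup P G"
    and card_P: "card P = p ^ e" and card_N: "\<not> p dvd card N"
    and N_Int_P: "N \<inter> P = {\<one>}"
    and decomp: "g \<in> carrier G \<Longrightarrow> \<exists>n\<in>N. \<exists>x\<in>P. g = n \<otimes> x"
begin

sublocale N: normal N G by (rule normal_N)
sublocale P: subgroup P G by (rule subgroup_P)

lemma finite_N [simp]: "finite N" and finite_P [simp]: "finite P"
  using N.subset P.subset finite_subset fin by blast+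

lemma card_N_nonzero: "of_nat (card N) \<noteq> (0::'k)"
  using card_N CHAR by (simp add: of_nat_eq_0_iff_char_dvd)

lemmas decomp_unique = complement_unique[OF N.subgroup_axioms subgroup_P N_Int_P]

lemma conj_N: "x \<in> carrier G \<Longrightarrow> n \<in> N \<Longrightarrow> x \<otimes> n \<otimes> inv x \<in> N"
  and conj_N': "x \<in> carrier G \<Longrightarrow> n \<in> N \<Longrightarrow> inv x \<otimes> n \<otimes> x \<in> N"
  using N.inv_op_closed1 N.inv_op_closed2 by auto

section \<open>Commutativity of P\<close>

lemma abelian_if_frobenius:
  assumes frob: "frobenius_alg (centralizer_alg G P :: ('a \<Rightarrow> 'k) set) (+) ga_smult (ga_mult G)"
  shows "abelian_set G P"
proof (rule ccontr)
  assume "\<not> abelian_set G P"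
  then obtain x y where xy: "x \<in> P" "y \<in> P" "x \<otimes> y \<noteq> y \<otimes> x" by (auto simp: abelian_set_def)
  let ?A = "centralizer_alg G P :: ('a \<Rightarrow> 'k) set"
  interpret A: unital_alg ?A "(+)" ga_smult "ga_mult G" "delta \<one>"
    by (rule centralizer_algebra[OF P.subset])
  obtain \<mu> where \<mu>: "frobenius_form ?A (+) ga_smult (ga_mult G) \<mu>"
    using frob A.frobenius_iff_form by blast
  note A_iff = centralizer_alg_iff[OF P.subset]
  define \<phi> where "\<phi> a = (\<Sum>n\<in>N. a n)" for a :: "'a \<Rightarrow> 'k"
  have "lin_functional ?A (+) ga_smult \<phi>"
    by (simp add: lin_functional_def \<phi>_def sum.distrib ga_smult_apply sum_distrib_left)
  from frobenius_formD(3)[OF \<mu> this]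
  obtain u where u: "u \<in> ?A" "\<And>a. a \<in> ?A \<Longrightarrow> \<phi> a = \<mu> (ga_mult G a u)" by blast
  define X where "X = {g. \<exists>n\<in>N. \<exists>z\<in>P. g = n \<otimes> (z \<otimes> x \<otimes> inv z)}"
  have X_carrier: "X \<subseteq> carrier G" using xy by (auto simp: X_def)
  have X_conj: "inv w \<otimes> g \<otimes> w \<in> X" if w: "w \<in> P" and g: "g \<in> X" for w g
  proof -
    from g obtain n z where nz: "n \<in> N" "z \<in> P" "g = n \<otimes> (z \<otimes> x \<otimes> inv z)" by (auto simp: X_def)
    have "w \<otimes> (inv w \<otimes> h) = h" if "h \<in> carrier G" for h
      using w that by (simp add: m_assoc[symmetric])
    then have "inv w \<otimes> g \<otimes> w = (inv w \<otimes> n \<otimes> w) \<otimes> ((inv w \<otimes> z) \<otimes> x \<otimes> inv (inv w \<otimes> z))"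
      using nz xy w by (simp add: m_assoc inv_mult_group)
    moreover have "inv w \<otimes> n \<otimes> w \<in> N" "inv w \<otimes> z \<in> P" using w nz conj_N' by auto
    ultimately show ?thesis unfolding X_def by blast
  qed
  have X_conj': "w \<otimes> g \<otimes> inv w \<in> X" if w: "w \<in> P" and g: "g \<in> X" for w g
    using X_conj[OF P.m_inv_closed[OF w] g] w by simp
  have X_conj_iff: "inv w \<otimes> g \<otimes> w \<in> X \<longleftrightarrow> g \<in> X" if w: "w \<in> P" and g: "g \<in> carrier G" for w g
  proof -
    have "w \<otimes> (inv w \<otimes> g \<otimes> w) \<otimes> inv w = g"
      using w g by (simp add: m_assoc) (simp add: m_assoc[symmetric])
    then show ?thesis using X_conj X_conj' w by metis
  qed
  have X_N: "n \<otimes> g \<in> X" if n: "n \<in> N" and g: "g \<in> X" for n g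
  proof -
    from g obtain m z where nz: "m \<in> N" "z \<in> P" "g = m \<otimes> (z \<otimes> x \<otimes> inv z)" by (auto simp: X_def)
    then have "n \<otimes> g = (n \<otimes> m) \<otimes> (z \<otimes> x \<otimes> inv z)" using n xy by (simp add: m_assoc)
    then show ?thesis unfolding X_def using n nz by blast
  qed
  have X_N_iff: "n \<otimes> g \<in> X \<longleftrightarrow> g \<in> X" if n: "n \<in> N" and g: "g \<in> carrier G" for n g
  proof -
    have "inv n \<otimes> (n \<otimes> g) = g" using n g by (simp add: m_assoc[symmetric])
    then show ?thesis using X_N n by (metis N.m_inv_closed)
  qed
  have X_N_iff': "g \<otimes> n \<in> X \<longleftrightarrow> g \<in> X" if n: "n \<in> N" and g: "g \<in> carrier G" for n g
  proof -
    have "g \<otimes> n = (g \<otimes> n \<otimes> inv g) \<otimes> g" using n g by (simp add: m_assoc)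
    then show ?thesis using X_N_iff conj_N n g by metis
  qed
  define C where "C g = (if g \<in> X then 1 else 0 :: 'k)" for g
  have "x \<in> X" unfolding X_def
    using xy by (auto intro!: bexI[of _ \<one>])
  then have C0: "C \<noteq> 0" by (auto simp: C_def fun_eq_iff)
  have C_A: "C \<in> ?A" using X_carrier X_conj_iff by (auto simp: A_iff C_def group_alg_def)
  have \<phi>C: "\<phi> (ga_mult G c C) = 0" if c: "c \<in> ?A" for c
  proof -
    \<comment> \<open>Conjugation by P acts on the elements h with inverse in \<open>X\<close>, and
      c is constant on the orbits. There is no fixed point: write
      \<open>inv h = n \<otimes> t\<close> with t conjugate to x in P. If h is fixed by P,
      uniqueness of this decomposition forces t to be central, hence t = x, and x would commute with
      y.\<close>
    have "(\<Sum>h\<in>{h \<in> carrier G. inv h \<in> X}. c h) = 0"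
    proof (rule sum_invariant_eq_0[OF subgroup_P card_P prime_p CHAR, where act = "\<lambda>w h. w \<otimes> h \<otimes> inv w"])
      fix w h assume w: "w \<in> P" and h: "h \<in> {h \<in> carrier G. inv h \<in> X}"
      have "inv (w \<otimes> h \<otimes> inv w) = w \<otimes> inv h \<otimes> inv w"
        using w h by (simp add: inv_mult_group m_assoc)
      then show "w \<otimes> h \<otimes> inv w \<in> {h \<in> carrier G. inv h \<in> X}"
        using w h X_conj'[OF w, of "inv h"] by simp
      show "c (w \<otimes> h \<otimes> inv w) = c h"
        using c w h unfolding A_iff by (metis (no_types, lifting) P.m_inv_closed P.mem_carrier inv_inv mem_Collect_eq)
    next
      fix h assume h: "h \<in> {h \<in> carrier G. inv h \<in> X}"
      then obtain n z where nz: "n \<in> N" "z \<in> P" "inv h = n \<otimes> (z \<otimes> x \<otimes> inv z)" by (auto simp: X_def)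
      define t where "t = z \<otimes> x \<otimes> inv z"
      have t: "t \<in> P" using nz xy by (simp add: t_def)
      show "\<exists>w\<in>P. w \<otimes> h \<otimes> inv w \<noteq> h"
      proof (rule ccontr)
        assume "\<not> ?thesis"
        then have fixed: "w \<otimes> h \<otimes> inv w = h" if "w \<in> P" for w using that by blast
        have central: "w \<otimes> t \<otimes> inv w = t" if w: "w \<in> P" for w
        proof -
          have "inv (w \<otimes> h \<otimes> inv w) = inv h" using fixed[OF w] by simp
          then have "w \<otimes> inv h \<otimes> inv w = inv h"
            using w h by (simp add: inv_mult_group m_assoc)
          moreover have "w \<otimes> (n \<otimes> t) \<otimes> inv w = (w \<otimes> n \<otimes> inv w) \<otimes> (w \<otimes> t \<otimes> inv w)"
          proof -
            have "inv w \<otimes> (w \<otimes> (t \<otimes> inv w)) = t \<otimes> inv w" using w t by (simp add: m_assoc[symmetric])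
            then show ?thesis using w t nz by (simp add: m_assoc)
          qed
          ultimately have "(w \<otimes> n \<otimes> inv w) \<otimes> (w \<otimes> t \<otimes> inv w) = n \<otimes> t"
            using nz by (simp add: t_def)
          from decomp_unique[OF _ _ _ _ this] show ?thesis using w t nz conj_N by auto
        qed
        have "inv z \<otimes> t \<otimes> inv (inv z) = t" using central nz by blast
        moreover have "inv z \<otimes> t \<otimes> inv (inv z) = x"
        proof -
          have "inv z \<otimes> (z \<otimes> x) = x" using nz xy by (simp add: m_assoc[symmetric])
          then show ?thesis using nz xy by (simp add: t_def m_assoc)
        qed
        ultimately have "y \<otimes> x \<otimes> inv y = x" using central xy by metis
        then have "y \<otimes> x \<otimes> inv y \<otimes> y = x \<otimes> y" by simp
        then show False using xy by (simp add: m_assoc)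
      qed
    next
      fix w v h assume "w \<in> P" "v \<in> P" "h \<in> {h \<in> carrier G. inv h \<in> X}"
      then show "w \<otimes> v \<otimes> h \<otimes> inv (w \<otimes> v) = w \<otimes> (v \<otimes> h \<otimes> inv v) \<otimes> inv w"
        by (simp add: m_assoc inv_mult_group)
    qed auto
    \<comment> \<open>\<open>X\<close> is stable under right translation by N, so the coefficient of
      the product at n is the same for all n in N.\<close>
    moreover have "ga_mult G c C n = (\<Sum>h\<in>{h \<in> carrier G. inv h \<in> X}. c h)" if n: "n \<in> N" for n
    proof -
      have "ga_mult G c C n = (\<Sum>h\<in>carrier G. if inv h \<in> X then c h else 0)"
        unfolding ga_mult_apply[OF N.mem_carrier[OF n]]
        by (rule sum.cong) (use n X_N_iff' in \<open>auto simp: C_def\<close>)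
      also have "\<dots> = (\<Sum>h\<in>{h \<in> carrier G. inv h \<in> X}. c h)"
        by (intro sum.mono_neutral_cong_right) auto
      finally show ?thesis .
    qed
    ultimately show ?thesis by (simp add: \<phi>_def)
  qed
  have zero_A: "0 \<in> ?A" by (simp add: A_iff)
  have \<mu>0: "\<mu> 0 = 0"
    using lin_functional_smult[OF frobenius_formD(1)[OF \<mu>] zero_A, of 0]
    by (simp only: ga_smult_zero mult_zero_left)
  have Cu: "ga_mult G C u = 0"
  proof (rule frobenius_formD(2)[OF \<mu>])
    fix c assume c: "c \<in> ?A"
    have "\<mu> (ga_mult G c (ga_mult G C u)) = \<phi> (ga_mult G c C)"
      using u c C_A by (simp add: ga_mult_assoc[symmetric] A.mult_closed)
    then show "\<mu> (ga_mult G c (ga_mult G C u)) = \<mu> (ga_mult G c 0)"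
      by (simp only: \<phi>C[OF c] \<mu>0 ga_mult_zero)
  qed (use C_A u zero_A A.mult_closed in auto)
  have "C \<in> group_alg G" using C_A by (simp add: A_iff)
  from exists_fixed_vector[OF subgroup_P card_P prime_p CHAR this C0]
  obtain c where c: "ga_mult G c C \<noteq> 0"
    "\<And>y. y \<in> P \<Longrightarrow> ga_mult G (delta y) (ga_mult G c C) = ga_mult G c C" by blast
  define w where "w = ga_mult G c C"
  have w_P: "w (z \<otimes> g) = w g" if "z \<in> P" "g \<in> carrier G" for z g
    using c(2)[of "inv z"] delta_mult[of "inv z" g w] that by (simp add: w_def)
  \<comment> \<open>\<open>C\<close> is constant on the cosets of the normal subgroup N, and left
    multiples of \<open>C\<close> inherit this because \<open>inv h \<otimes> n = (inv h \<otimes> n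
    \<otimes> h) \<otimes> inv h\<close>.\<close>
  have w_N: "w (n \<otimes> g) = w g" if n: "n \<in> N" and g: "g \<in> carrier G" for n g
  proof -
    have "C (inv h \<otimes> (n \<otimes> g)) = C (inv h \<otimes> g)" if h: "h \<in> carrier G" for h
    proof -
      have "inv h \<otimes> (n \<otimes> g) = (inv h \<otimes> n \<otimes> h) \<otimes> (inv h \<otimes> g)"
      proof -
        have "h \<otimes> (inv h \<otimes> g) = g" using h g by (simp add: m_assoc[symmetric])
        then show ?thesis using h g n by (simp add: m_assoc)
      qed
      then show ?thesis using X_N_iff[OF conj_N'[OF h n], of "inv h \<otimes> g"] h g by (simp add: C_def)
    qed
    then show ?thesis using n g by (simp add: w_def ga_mult_apply)
  qed
  \<comment> \<open>Being invariant under left translation by N and by P, the nonzero multiple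
    \<open>w\<close> of \<open>C\<close> is constant on G = NP. This is how \<open>\<sigma>\<close>
    enters the left ideal generated by \<open>C\<close>.\<close>
  have w_const: "w g = w \<one>" if g: "g \<in> carrier G" for g
  proof -
    obtain n z where nz: "n \<in> N" "z \<in> P" "g = n \<otimes> z" using decomp[OF g] by blast
    then show ?thesis using w_N[of n z] w_P[of z \<one>] by simp
  qed
  define \<sigma> where "\<sigma> g = (if g \<in> carrier G then 1 else 0 :: 'k)" for g
  have \<sigma>A: "\<sigma> \<in> ?A" by (simp add: A_iff \<sigma>_def group_alg_def)
  have w: "w = ga_smult (w \<one>) \<sigma>"
    using w_const by (auto simp: ga_smult_def \<sigma>_def fun_eq_iff w_def ga_mult_def)
  have w1: "w \<one> \<noteq> 0"
  proof
    assume "w \<one> = 0"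
    then have "w = ga_smult 0 \<sigma>" using w by metis
    then show False using c(1) by (simp add: w_def)
  qed
  have "ga_smult (w \<one>) (ga_mult G \<sigma> u) = ga_mult G w u"
    using arg_cong[OF w, of "\<lambda>v. ga_mult G v u"] by (simp only: ga_mult_smultl)
  also have "\<dots> = 0" by (simp add: w_def ga_mult_assoc Cu)
  finally have "ga_mult G \<sigma> u = 0" using w1 by (auto simp: ga_smult_def fun_eq_iff)
  then have "\<phi> \<sigma> = 0"
    by (simp only: u(2)[OF \<sigma>A] \<mu>0)
  moreover have "\<phi> \<sigma> = of_nat (card N)" by (simp add: \<phi>_def \<sigma>_def)
  ultimately show False using card_N_nonzero by simp
qed

end

section \<open>Reduction to the fixed points of $kN$\<close>

context fin_group
begin

lemma ga_mult_sum_left: "ga_mult G (sum f I) d = (\<Sum>i\<in>I. ga_mult G (f i) d)"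
  and ga_mult_sum_right: "ga_mult G d (sum f I) = (\<Sum>i\<in>I. ga_mult G d (f i))"
  by (induction I rule: infinite_finite_induct)
    (simp_all only: sum.infinite sum.empty sum.insert ga_mult_zero ga_mult_distl ga_mult_distr not_False_eq_True)

end

context p_nilpotent_group
begin

definition fixed_alg :: "('a \<Rightarrow> 'k) set" where
  "fixed_alg = centralizer_alg G P \<inter> supp_on N"

definition rest :: "('a \<Rightarrow> 'k) \<Rightarrow> 'a \<Rightarrow> 'k" where
  "rest c = (\<lambda>g. if g \<in> N then c g else 0)"

lemma rest_in [simp]: "rest c \<in> supp_on N" "rest c \<in> group_alg G"
  by (auto simp: rest_def supp_on_def group_alg_def)

lemma rest_add: "rest (a + b) = rest a + rest b"
  and rest_smult: "rest (ga_smult t a) = ga_smult t (rest a)"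
  by (auto simp: rest_def ga_smult_def fun_eq_iff)

lemma rest_zero [simp]: "rest 0 = 0"
  by (auto simp: rest_def fun_eq_iff)

lemma rest_sum: "rest (sum f I) = (\<Sum>i\<in>I. rest (f i))"
  by (induction I rule: infinite_finite_induct) (simp_all only: sum.infinite sum.empty sum.insert rest_zero rest_add not_False_eq_True)

lemma supp_in: "c \<in> supp_on N \<Longrightarrow> c \<in> group_alg G"
  using supp_on_subset[OF N.subset] by blast

lemma conj_mem_N_iff: "x \<in> carrier G \<Longrightarrow> g \<in> carrier G \<Longrightarrow> inv x \<otimes> g \<otimes> x \<in> N \<longleftrightarrow> g \<in> N"
proof
  assume xg: "x \<in> carrier G" "g \<in> carrier G" and n: "inv x \<otimes> g \<otimes> x \<in> N"
  have "x \<otimes> (inv x \<otimes> g \<otimes> x) \<otimes> inv x = g"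
    using xg by (simp add: m_assoc) (simp add: m_assoc[symmetric])
  then show "g \<in> N" using conj_N[OF xg(1) n] by simp
qed (rule conj_N')

lemma rest_fixed:
  assumes "c \<in> centralizer_alg G P"
  shows "rest c \<in> fixed_alg"
proof -
  have "rest c (inv x \<otimes> g \<otimes> x) = rest c g" if "x \<in> P" "g \<in> carrier G" for x g
    using assms that conj_mem_N_iff[OF P.mem_carrier, of x g]
    by (simp add: rest_def centralizer_alg_iff[OF P.subset])
  then show ?thesis by (simp add: fixed_alg_def centralizer_alg_iff[OF P.subset])
qed

text \<open>Translation by an element of N preserves both N and its complement in G. Thus the
  projection \<open>rest\<close> of kG onto kN is linear over kN, here on the left and in
  \<open>rest_mult_right\<close> on the right.\<close>

lemma rest_mult_left:
  assumes d: "d \<in> supp_on N"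
  shows "rest (ga_mult G d c) = ga_mult G d (rest c)"
proof (rule group_alg_eqI)
  fix g assume g: "g \<in> carrier G"
  have "d h * rest c (inv h \<otimes> g) = (if g \<in> N then d h * c (inv h \<otimes> g) else 0)" if h: "h \<in> carrier G" for h
  proof (cases "h \<in> N")
    case True
    have "inv h \<otimes> g \<in> N \<longleftrightarrow> g \<in> N"
    proof
      assume "inv h \<otimes> g \<in> N"
      then have "h \<otimes> (inv h \<otimes> g) \<in> N" using True by blast
      then show "g \<in> N" using h g by (simp add: m_assoc[symmetric])
    qed (use True in auto)
    then show ?thesis by (simp add: rest_def)
  next
    case False
    then have "d h = 0" using d unfolding supp_on_def by blast
    then show ?thesis by simp
  qed
  then show "rest (ga_mult G d c) g = ga_mult G d (rest c) g"
    using g by (simp add: rest_def[of "ga_mult G d c"] ga_mult_apply cong: sum.cong)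
qed auto

lemma rest_mult_right:
  assumes b: "b \<in> supp_on N"
  shows "rest (ga_mult G c b) = ga_mult G (rest c) b"
proof (rule group_alg_eqI)
  fix g assume g: "g \<in> carrier G"
  have "rest c h * b (inv h \<otimes> g) = (if g \<in> N then c h * b (inv h \<otimes> g) else 0)" if h: "h \<in> carrier G" for h
  proof (cases "inv h \<otimes> g \<in> N")
    case True
    have "h \<in> N \<longleftrightarrow> g \<in> N"
    proof
      assume "h \<in> N"
      then have "h \<otimes> (inv h \<otimes> g) \<in> N" using True by blast
      then show "g \<in> N" using h g by (simp add: m_assoc[symmetric])
    next
      assume "g \<in> N"
      then have "g \<otimes> inv (inv h \<otimes> g) \<in> N" using True by blast
      moreover have "g \<otimes> inv (inv h \<otimes> g) = h"
        using h g by (simp add: inv_mult_group m_assoc[symmetric])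
      ultimately show "h \<in> N" by simp
    qed
    then show ?thesis by (simp add: rest_def)
  next
    case False
    then have "b (inv h \<otimes> g) = 0" using b unfolding supp_on_def by blast
    then show ?thesis by simp
  qed
  then show "rest (ga_mult G c b) g = ga_mult G (rest c) b g"
    using g by (simp add: rest_def[of "ga_mult G c b"] ga_mult_apply cong: sum.cong)
qed auto

lemma zero_fixed [simp]: "0 \<in> fixed_alg"
  by (simp add: fixed_alg_def centralizer_alg_def supp_on_def)

lemma unital_fixed: "unital_alg fixed_alg (+) ga_smult (ga_mult G) (delta \<one>)"
  unfolding fixed_alg_def by (rule centralizer_subalgebra[OF P.subset N.subgroup_axioms])

text \<open>Right multiplication by this element identifies kN with the left ideal kG
  \<open>sum_P\<close>, a copy of the permutation module on the cosets gP, because each such coset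
  contains exactly one element of N.\<close>

definition sum_P :: "'a \<Rightarrow> 'k" where
  "sum_P = (\<lambda>g. if g \<in> P then 1 else 0)"

lemma conj_mem_P_iff: "x \<in> P \<Longrightarrow> g \<in> carrier G \<Longrightarrow> inv x \<otimes> g \<otimes> x \<in> P \<longleftrightarrow> g \<in> P"
proof
  assume xg: "x \<in> P" "g \<in> carrier G" and n: "inv x \<otimes> g \<otimes> x \<in> P"
  have "x \<otimes> (inv x \<otimes> g \<otimes> x) \<otimes> inv x = g"
    using xg by (simp add: m_assoc) (simp add: m_assoc[symmetric])
  moreover have "x \<otimes> (inv x \<otimes> g \<otimes> x) \<otimes> inv x \<in> P" using xg n by blast
  ultimately show "g \<in> P" by simp
qed auto

lemma sum_P_in: "sum_P \<in> centralizer_alg G P"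
  unfolding centralizer_alg_iff[OF P.subset] using conj_mem_P_iff
  by (auto simp: sum_P_def group_alg_def)

lemma mult_sum_P:
  assumes g: "g \<in> carrier G"
  shows "ga_mult G c sum_P g = (\<Sum>y\<in>P. c (g \<otimes> y))"
proof -
  have "ga_mult G c sum_P g = (\<Sum>h\<in>carrier G. if inv h \<otimes> g \<in> P then c h else 0)"
    unfolding ga_mult_apply[OF g] by (rule sum.cong) (auto simp: sum_P_def)
  also have "\<dots> = (\<Sum>h\<in>{h\<in>carrier G. inv h \<otimes> g \<in> P}. c h)"
    by (intro sum.mono_neutral_cong_right) auto
  also have "\<dots> = (\<Sum>y\<in>P. c (g \<otimes> y))"
  proof (rule sum.reindex_bij_witness[of _ "\<lambda>y. g \<otimes> y" "\<lambda>h. inv g \<otimes> h"])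
    fix h assume h: "h \<in> {h \<in> carrier G. inv h \<otimes> g \<in> P}"
    then have "inv (inv h \<otimes> g) \<in> P" by blast
    then show "inv g \<otimes> h \<in> P" using h g by (simp add: inv_mult_group)
    show e: "g \<otimes> (inv g \<otimes> h) = h" using h g by (simp add: m_assoc[symmetric])
    show "c (g \<otimes> (inv g \<otimes> h)) = c h" by (simp only: e)
  next
    fix y assume y: "y \<in> P"
    show "inv g \<otimes> (g \<otimes> y) = y" using y g by (simp add: m_assoc[symmetric])
    have "inv (g \<otimes> y) \<otimes> g = inv y" using y g by (simp add: inv_mult_group m_assoc)
    then show "g \<otimes> y \<in> {h \<in> carrier G. inv h \<otimes> g \<in> P}" using y g by simp
  qed
  finally show ?thesis .
qed

lemma sum_P_mult:
  assumes g: "g \<in> carrier G"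
  shows "ga_mult G sum_P c g = (\<Sum>y\<in>P. c (y \<otimes> g))"
proof -
  have "ga_mult G sum_P c g = (\<Sum>h\<in>carrier G. if h \<in> P then c (inv h \<otimes> g) else 0)"
    unfolding ga_mult_apply[OF g] by (rule sum.cong) (auto simp: sum_P_def)
  also have "\<dots> = (\<Sum>h\<in>P. c (inv h \<otimes> g))"
    by (intro sum.mono_neutral_cong_right) auto
  also have "\<dots> = (\<Sum>y\<in>P. c (y \<otimes> g))"
    by (rule sum.reindex_bij_witness[of _ "\<lambda>y. inv y" "\<lambda>y. inv y"]) auto
  finally show ?thesis .
qed

lemma sum_P_commute:
  assumes c: "c \<in> centralizer_alg G P"
  shows "ga_mult G sum_P c = ga_mult G c sum_P"
proof (rule group_alg_eqI)
  fix g assume g: "g \<in> carrier G"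
  have "c (y \<otimes> g) = c (g \<otimes> y)" if y: "y \<in> P" for y
  proof -
    have "c (inv y \<otimes> (y \<otimes> g) \<otimes> y) = c (y \<otimes> g)"
      using c y g by (simp add: centralizer_alg_iff[OF P.subset])
    moreover have "inv y \<otimes> (y \<otimes> g) = g" using y g by (simp add: m_assoc[symmetric])
    ultimately show ?thesis by simp
  qed
  then show "ga_mult G sum_P c g = ga_mult G c sum_P g"
    using g by (simp add: mult_sum_P sum_P_mult)
qed auto

text \<open>Among the elements \<open>n \<otimes> x \<otimes> y\<close> of the coset only the one
  with \<open>y = inv x\<close> lies in N.\<close>

lemma supp_mult_sum_P:
  assumes b: "b \<in> supp_on N" and n: "n \<in> N" and x: "x \<in> P"
  shows "ga_mult G b sum_P (n \<otimes> x) = b n"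
proof -
  have "b (n \<otimes> x \<otimes> y) = (if y = inv x then b n else 0)" if y: "y \<in> P" for y
  proof (cases "y = inv x")
    case True
    then show ?thesis using n x by (simp add: m_assoc)
  next
    case False
    have "n \<otimes> x \<otimes> y \<notin> N"
    proof
      assume m: "n \<otimes> x \<otimes> y \<in> N"
      have "(n \<otimes> x \<otimes> y) \<otimes> \<one> = n \<otimes> (x \<otimes> y)" using n x y by (simp add: m_assoc)
      from decomp_unique[OF m n _ _ this] have "\<one> = x \<otimes> y" using x y by simp
      then have "inv x \<otimes> \<one> = inv x \<otimes> (x \<otimes> y)" by simp
      also have "\<dots> = y" using x y by (simp add: m_assoc[symmetric])
      finally show False using False x by simp
    qed
    then have "b (n \<otimes> x \<otimes> y) = 0" using b unfolding supp_on_def by blast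
    then show ?thesis using False by simp
  qed
  then have "ga_mult G b sum_P (n \<otimes> x) = (\<Sum>y\<in>P. if y = inv x then b n else 0)"
    using n x by (simp add: mult_sum_P)
  then show ?thesis using x by (simp add: sum.delta)
qed

text \<open>The value at n in N is the sum of c over the coset nP. For c in kG^P this is the element
  of (kN)^P that has the same product with \<open>sum_P\<close>, hence the map through which kG^P
  acts on the ideal (kN)^P \<open>sum_P\<close>.\<close>

definition collapse :: "('a \<Rightarrow> 'k) \<Rightarrow> 'a \<Rightarrow> 'k" where
  "collapse c = rest (ga_mult G c sum_P)"

lemma collapse_in: "c \<in> centralizer_alg G P \<Longrightarrow> collapse c \<in> fixed_alg"
  using unital_alg.mult_closed[OF centralizer_algebra[OF P.subset] _ sum_P_in]
  unfolding collapse_def by (intro rest_fixed)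

lemma collapse_sum_P: "ga_mult G (collapse c) sum_P = ga_mult G c sum_P"
proof (rule group_alg_eqI)
  fix g assume "g \<in> carrier G"
  then obtain n x where nx: "n \<in> N" "x \<in> P" "g = n \<otimes> x" using decomp by blast
  have "ga_mult G (collapse c) sum_P g = collapse c n"
    using nx by (simp add: supp_mult_sum_P collapse_def)
  also have "\<dots> = (\<Sum>y\<in>P. c (n \<otimes> y))" using nx by (simp add: collapse_def rest_def mult_sum_P)
  also have "\<dots> = (\<Sum>y\<in>P. c (g \<otimes> y))"
  proof (rule sum.reindex_bij_witness[of _ "\<lambda>y. x \<otimes> y" "\<lambda>y. inv x \<otimes> y"])
    fix y assume y: "y \<in> P"
    show e: "x \<otimes> (inv x \<otimes> y) = y" "inv x \<otimes> (x \<otimes> y) = y" "inv x \<otimes> y \<in> P" "x \<otimes> y \<in> P"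
      using nx y by (simp_all add: m_assoc[symmetric])
    show "c (g \<otimes> (inv x \<otimes> y)) = c (n \<otimes> y)"
      using nx y e by (simp add: m_assoc)
  qed
  finally show "ga_mult G (collapse c) sum_P g = ga_mult G c sum_P g"
    using nx by (simp add: mult_sum_P)
qed auto

text \<open>\<open>sum_P\<close> commutes with kG^P, so (kN)^P \<open>sum_P\<close> is a two-sided
  ideal of kG^P, to which \<open>frobenius_alg_descend\<close> applies. Since \<open>rest\<close>
  undoes the multiplication by \<open>sum_P\<close>, linear forms extend to kG^P by composition with
  \<open>rest\<close>.\<close>

lemma frobenius_fixed_if_centralizer:
  assumes frob: "frobenius_alg (centralizer_alg G P :: ('a \<Rightarrow> 'k) set) (+) ga_smult (ga_mult G)"
  shows "frobenius_alg fixed_alg (+) ga_smult (ga_mult G)"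
proof (rule frobenius_alg_descend[OF centralizer_algebra[OF P.subset] unital_fixed frob,
      where \<Phi> = "\<lambda>b. ga_mult G b sum_P" and r = collapse])
  let ?A = "centralizer_alg G P :: ('a \<Rightarrow> 'k) set"
  interpret A: unital_alg ?A "(+)" ga_smult "ga_mult G" "delta \<one>"
    by (rule centralizer_algebra[OF P.subset])
  have rest_Phi: "rest (ga_mult G b sum_P) = b" if b: "b \<in> fixed_alg" for b
  proof
    fix g
    have "g = g \<otimes> \<one>" if "g \<in> N" using that by simp
    then show "rest (ga_mult G b sum_P) g = b g"
      using b supp_mult_sum_P[of b g \<one>] by (auto simp: rest_def fixed_alg_def supp_on_def)
  qed
  then show "inj_on (\<lambda>b. ga_mult G b sum_P) fixed_alg" by (rule inj_on_inverseI[where g = rest])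
  show "ga_mult G b sum_P \<in> ?A" if "b \<in> fixed_alg" for b
    using that A.mult_closed[OF _ sum_P_in] by (auto simp: fixed_alg_def)
  show "collapse b \<in> fixed_alg" if "b \<in> ?A" for b using that by (rule collapse_in)
  show "ga_mult G b (ga_mult G x sum_P) = ga_mult G (ga_mult G (collapse b) x) sum_P"
    if "b \<in> ?A" and x: "x \<in> fixed_alg" for b x
  proof -
    have commute: "ga_mult G x sum_P = ga_mult G sum_P x" using x by (simp add: sum_P_commute fixed_alg_def)
    have "ga_mult G b (ga_mult G x sum_P) = ga_mult G (ga_mult G b sum_P) x"
      unfolding ga_mult_assoc commute ..
    also have "\<dots> = ga_mult G (ga_mult G (collapse b) sum_P) x" by (simp only: collapse_sum_P)
    also have "\<dots> = ga_mult G (collapse b) (ga_mult G x sum_P)" unfolding ga_mult_assoc commute ..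
    finally show ?thesis by (simp only: ga_mult_assoc)
  qed
  show "ga_mult G (ga_mult G x sum_P) b = ga_mult G (ga_mult G x (collapse b)) sum_P"
    if "b \<in> ?A" for b x
    unfolding ga_mult_assoc collapse_sum_P sum_P_commute[OF that] ..
  show "\<exists>\<psi>. lin_functional ?A (+) ga_smult \<psi> \<and> (\<forall>x\<in>fixed_alg. \<psi> (ga_mult G x sum_P) = \<phi> x)"
    if "lin_functional fixed_alg (+) ga_smult \<phi>" for \<phi> :: "('a \<Rightarrow> 'k) \<Rightarrow> 'k"
  proof (intro exI[of _ "\<lambda>c. \<phi> (rest c)"] conjI ballI)
    show "lin_functional ?A (+) ga_smult (\<lambda>c. \<phi> (rest c))"
      using that rest_fixed by (auto simp: lin_functional_def rest_add rest_smult)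
  qed (simp add: rest_Phi)
qed (simp_all add: ga_mult_distr ga_mult_smultl)

text \<open>For abelian P the elements of P lie in kG^P, which is therefore the direct sum of the
  (kN)^P x with x in P. The form on the tensor product with kP is the product of
  \<open>\<mu>\<close> with the form on kP that reads off the coefficient at the unit.\<close>

lemma frobenius_centralizer_if_fixed:
  assumes ab: "abelian_set G P" and frob: "frobenius_alg fixed_alg (+) ga_smult (ga_mult G)"
  shows "frobenius_alg (centralizer_alg G P :: ('a \<Rightarrow> 'k) set) (+) ga_smult (ga_mult G)"
proof -
  let ?A = "centralizer_alg G P :: ('a \<Rightarrow> 'k) set"
  interpret A: unital_alg ?A "(+)" ga_smult "ga_mult G" "delta \<one>"
    by (rule centralizer_algebra[OF P.subset])
  interpret B: unital_alg fixed_alg "(+)" ga_smult "ga_mult G" "delta \<one>" by (rule unital_fixed)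
  have BA: "b \<in> ?A" "b \<in> supp_on N" if "b \<in> fixed_alg" for b using that by (auto simp: fixed_alg_def)
  have Ain: "c \<in> group_alg G" if "c \<in> ?A" for c using that by (simp add: centralizer_alg_def)
  obtain \<mu> where \<mu>: "frobenius_form fixed_alg (+) ga_smult (ga_mult G) \<mu>"
    using frob B.frobenius_iff_form by blast
  note l = frobenius_formD(1)[OF \<mu>] and i = frobenius_formD(2)[OF \<mu>] and s = frobenius_formD(3)[OF \<mu>]
  have delta_A: "delta x \<in> ?A" if x: "x \<in> P" for x
  proof -
    have "ga_conj G y (delta x :: 'a \<Rightarrow> 'k) = delta x" if y: "y \<in> P" for y
    proof -
      have "y \<otimes> x \<otimes> inv y = x \<otimes> y \<otimes> inv y" using ab x y by (simp add: abelian_set_def)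
      then have "y \<otimes> x \<otimes> inv y = x" using x y by (simp add: m_assoc)
      then show ?thesis using x y by (simp add: ga_conj_eq delta_mult_delta)
    qed
    then show ?thesis using x by (simp add: centralizer_alg_def)
  qed
  \<comment> \<open>The component of c in (kN)^P that stands at x in P.\<close>
  define comp where "comp x c = rest (ga_mult G c (delta (inv x)))" for x c
  have comp_in: "comp x c \<in> fixed_alg" if "x \<in> P" "c \<in> ?A" for x c
    unfolding comp_def using that by (intro rest_fixed A.mult_closed delta_A) auto
  have comp_apply: "comp x c n = c (n \<otimes> x)" if "x \<in> P" "n \<in> N" for x c n
    using that by (simp add: comp_def rest_def mult_delta)
  have eqI: "c = c'" if "c \<in> ?A" "c' \<in> ?A" and *: "\<And>x. x \<in> P \<Longrightarrow> comp x c = comp x c'" for c c'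
  proof (rule group_alg_eqI)
    fix g assume "g \<in> carrier G"
    then obtain n x where "n \<in> N" "x \<in> P" "g = n \<otimes> x" using decomp by blast
    then show "c g = c' g"
      using comp_apply[of x n c] comp_apply[of x n c'] *[of x] by simp
  qed (rule Ain[OF that(1)], rule Ain[OF that(2)])
  define \<nu> where "\<nu> c = \<mu> (rest c)" for c
  have lin: "lin_functional ?A (+) ga_smult \<nu>"
    using l rest_fixed by (auto simp: lin_functional_def \<nu>_def rest_add rest_smult)
  \<comment> \<open>Closure under sums is the second half of \<open>lin_functional_sum\<close>, for
    which \<open>\<nu>\<close> serves as the linear form.\<close>
  have sum_A: "sum f I \<in> ?A" if "\<And>i. i \<in> I \<Longrightarrow> f i \<in> ?A" for f :: "'a \<Rightarrow> 'a \<Rightarrow> 'k" and I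
    by (rule conjunct2[OF lin_functional_sum[OF lin BA(1)[OF zero_fixed] A.add_closed]]) (simp_all add: that)
  have comp_mult: "rest (ga_mult G c (ga_mult G b (delta (inv x)))) = ga_mult G (comp x c) b"
    if "x \<in> P" "b \<in> fixed_alg" for c b x
  proof -
    have "ga_mult G b (delta (inv x)) = ga_mult G (delta (inv x)) b"
      using delta_commute[OF BA(1)[OF that(2)] P.m_inv_closed[OF that(1)] P.subset] by simp
    then have "ga_mult G c (ga_mult G b (delta (inv x))) = ga_mult G (ga_mult G c (delta (inv x))) b"
      by (simp add: ga_mult_assoc)
    then show ?thesis using BA(2)[OF that(2)] by (simp add: rest_mult_right comp_def)
  qed
  have recon: "c = (\<Sum>x\<in>P. ga_mult G (comp x c) (delta x))" if c: "c \<in> ?A" for c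
  proof (rule eqI)
    show "(\<Sum>x\<in>P. ga_mult G (comp x c) (delta x)) \<in> ?A"
      using comp_in BA c delta_A by (intro sum_A A.mult_closed) auto
    fix y assume y: "y \<in> P"
    have "comp y (ga_mult G (comp x c) (delta x)) = (if x = y then comp y c else 0)" if x: "x \<in> P" for x
    proof -
      have "comp y (ga_mult G (comp x c) (delta x)) = ga_mult G (comp x c) (rest (delta (x \<otimes> inv y)))"
        using x y BA(2)[OF comp_in[OF x c]]
        by (simp add: comp_def[of y] ga_mult_assoc delta_mult_delta rest_mult_left)
      moreover have "rest (delta (x \<otimes> inv y)) = (if x = y then delta \<one> else 0)"
      proof (cases "x = y")
        case True
        then show ?thesis using y by (auto simp: rest_def delta_apply fun_eq_iff)
      next
        case False
        have "x \<otimes> inv y \<notin> N"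
        proof
          assume "x \<otimes> inv y \<in> N"
          then have "x \<otimes> inv y \<in> N \<inter> P" using x y by simp
          then have "x \<otimes> inv y = \<one>" using N_Int_P by simp
          then have "x \<otimes> inv y \<otimes> y = y" using y by simp
          then show False using False x y by (simp add: m_assoc)
        qed
        then show ?thesis using False by (auto simp: rest_def delta_apply fun_eq_iff)
      qed
      ultimately show ?thesis using Ain[OF BA(1)[OF comp_in[OF y c]]] by simp
    qed
    moreover have "comp y (\<Sum>x\<in>P. ga_mult G (comp x c) (delta x)) =
        (\<Sum>x\<in>P. comp y (ga_mult G (comp x c) (delta x)))"
      by (simp only: comp_def[of y] ga_mult_sum_left rest_sum)
    ultimately show "comp y c = comp y (\<Sum>x\<in>P. ga_mult G (comp x c) (delta x))"
      using y by (simp add: sum.delta cong: sum.cong)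
  qed (fact c)
  have "frobenius_form ?A (+) ga_smult (ga_mult G) \<nu>"
    unfolding frobenius_form_def
  proof (intro conjI ballI allI impI)
    fix c c' assume c: "c \<in> ?A" "c' \<in> ?A" and *: "\<forall>d\<in>?A. \<nu> (ga_mult G d c) = \<nu> (ga_mult G d c')"
    show "c = c'"
    proof (rule eqI[OF c])
      fix x assume x: "x \<in> P"
      \<comment> \<open>Testing with d x^{-1} isolates the component at x, which reduces injectivity
        to that of \<open>\<mu>\<close>.\<close>
      have e: "rest (ga_mult G (ga_mult G d (delta (inv x))) c) = ga_mult G d (comp x c)"
        if "c \<in> ?A" "d \<in> fixed_alg" for d c
        unfolding ga_mult_assoc delta_commute[OF that(1) P.m_inv_closed[OF x] P.subset]
          rest_mult_left[OF BA(2)[OF that(2)]] comp_def ..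
      show "comp x c = comp x c'"
      proof (rule i)
        fix d assume d: "d \<in> fixed_alg"
        have "ga_mult G d (delta (inv x)) \<in> ?A"
          using d x BA by (intro A.mult_closed delta_A) auto
        from bspec[OF * this]
        show "\<mu> (ga_mult G d (comp x c)) = \<mu> (ga_mult G d (comp x c'))"
          unfolding \<nu>_def e[OF c(1) d] e[OF c(2) d] .
      qed (rule comp_in[OF x c(1)], rule comp_in[OF x c(2)])
    qed
  next
    fix \<phi> assume \<phi>: "lin_functional ?A (+) ga_smult \<phi>"
    have "\<exists>b. b \<in> fixed_alg \<and> (\<forall>d\<in>fixed_alg. \<phi> (ga_mult G d (delta x)) = \<mu> (ga_mult G d b))" if x: "x \<in> P" for x
    proof -
      have "ga_mult G d (delta x) \<in> ?A" if "d \<in> fixed_alg" for d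
        using that x BA by (intro A.mult_closed delta_A) auto
      then have "lin_functional fixed_alg (+) ga_smult (\<lambda>d. \<phi> (ga_mult G d (delta x)))"
        using \<phi> by (auto simp: lin_functional_def ga_mult_distr ga_mult_smultl)
      from s[OF this] show ?thesis by blast
    qed
    then obtain b where b: "\<And>x. x \<in> P \<Longrightarrow> b x \<in> fixed_alg"
      "\<And>x d. x \<in> P \<Longrightarrow> d \<in> fixed_alg \<Longrightarrow> \<phi> (ga_mult G d (delta x)) = \<mu> (ga_mult G d (b x))"
      by metis
    show "\<exists>a\<in>?A. \<forall>x\<in>?A. \<phi> x = \<nu> (ga_mult G x a)"
    \<comment> \<open>For the coefficient form on kP the basis dual to the elements x consists of
      the inverses of the x, hence \<open>inv x\<close> next to \<open>b x\<close>, where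
      \<open>b x\<close> represents \<open>\<phi>\<close> on the summand (kN)^P x.\<close>
    proof (intro bexI[of _ "\<Sum>x\<in>P. ga_mult G (b x) (delta (inv x))"] ballI)
      have bA: "ga_mult G (b x) (delta (inv x)) \<in> ?A" if "x \<in> P" for x
        using that b BA delta_A by (intro A.mult_closed) auto
      then show "(\<Sum>x\<in>P. ga_mult G (b x) (delta (inv x))) \<in> ?A" by (intro sum_A)
      fix c assume c: "c \<in> ?A"
      have "\<phi> c = \<phi> (\<Sum>x\<in>P. ga_mult G (comp x c) (delta x))" using recon[OF c] by simp
      also have "\<dots> = (\<Sum>x\<in>P. \<phi> (ga_mult G (comp x c) (delta x)))"
        using lin_functional_sum[OF \<phi> BA(1)[OF zero_fixed] A.add_closed, of P "\<lambda>x. ga_mult G (comp x c) (delta x)"]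
          A.mult_closed[OF BA(1)[OF comp_in[OF _ c]] delta_A] by simp
      also have "\<dots> = (\<Sum>x\<in>P. \<mu> (ga_mult G (comp x c) (b x)))"
        using b comp_in c by (intro sum.cong) auto
      also have "\<dots> = (\<Sum>x\<in>P. \<nu> (ga_mult G c (ga_mult G (b x) (delta (inv x)))))"
        using b by (intro sum.cong) (auto simp: \<nu>_def comp_mult)
      also have "\<dots> = \<nu> (\<Sum>x\<in>P. ga_mult G c (ga_mult G (b x) (delta (inv x))))"
        using lin_functional_sum[OF lin BA(1)[OF zero_fixed] A.add_closed, of P "\<lambda>x. ga_mult G c (ga_mult G (b x) (delta (inv x)))"]
          A.mult_closed[OF c bA] by simp
      also have "(\<Sum>x\<in>P. ga_mult G c (ga_mult G (b x) (delta (inv x)))) =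
          ga_mult G c (\<Sum>x\<in>P. ga_mult G (b x) (delta (inv x)))"
        by (simp only: ga_mult_sum_right)
      finally show "\<phi> c = \<nu> (ga_mult G c (\<Sum>x\<in>P. ga_mult G (b x) (delta (inv x))))" .
    qed
  qed (fact lin)
  then show ?thesis unfolding A.frobenius_iff_form by blast
qed

end

section \<open>Schur's lemma and matrix coefficients\<close>

text \<open>If n < m, pad S with zero columns and R with zero rows to square matrices. Their product
  is still the identity, but the padded S kills \<open>unit_vec m n\<close>.\<close>

lemma right_inverse_dim_le:
  fixes S :: "'k::field mat"
  assumes S: "S \<in> carrier_mat m n" and R: "R \<in> carrier_mat n m" and SR: "S * R = 1\<^sub>m m"
  shows "m \<le> n"
proof (rule ccontr)
  assume "\<not> m \<le> n"
  then have nm: "n < m" by simp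
  define S' where "S' = mat m m (\<lambda>(i,j). if j < n then S $$ (i,j) else 0)"
  define R' where "R' = mat m m (\<lambda>(i,j). if i < n then R $$ (i,j) else 0)"
  have "S' * R' = S * R"
  proof (rule eq_matI)
    fix i j assume "i < dim_row (S * R)" "j < dim_col (S * R)"
    then have ij: "i < m" "j < m" using S R by auto
    have "(S' * R') $$ (i,j) = (\<Sum>k\<in>{0..<m}. S' $$ (i,k) * R' $$ (k,j))"
      using ij by (simp add: S'_def R'_def scalar_prod_def)
    also have "\<dots> = (\<Sum>k\<in>{0..<n}. S $$ (i,k) * R $$ (k,j))"
      using ij nm by (intro sum.mono_neutral_cong_right) (auto simp: S'_def R'_def)
    also have "\<dots> = (S * R) $$ (i,j)" using ij S R by (simp add: scalar_prod_def)
    finally show "(S' * R') $$ (i,j) = (S * R) $$ (i,j)" .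
  qed (use S R in \<open>auto simp: S'_def R'_def\<close>)
  then have "det S' * det R' = 1"
    using SR det_mult[of S' m R'] by (simp add: S'_def R'_def)
  then have "det S' \<noteq> 0" by auto
  moreover have "S' *\<^sub>v unit_vec m n = 0\<^sub>v m"
  proof (rule eq_vecI)
    fix i assume i: "i < dim_vec (0\<^sub>v m :: 'k vec)"
    then have "(S' *\<^sub>v unit_vec m n) $ i = (\<Sum>k\<in>{0..<m}. S' $$ (i,k) * (if k = n then 1 else 0))"
      using nm by (simp add: S'_def scalar_prod_def unit_vec_def)
    also have "\<dots> = 0" using i nm by (intro sum.neutral) (auto simp: S'_def)
    finally show "(S' *\<^sub>v unit_vec m n) $ i = 0\<^sub>v m $ i" using i by simp
  qed (simp add: S'_def)
  moreover have "S' \<in> carrier_mat m m" by (simp add: S'_def)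
  ultimately show False using det_0_iff_vec_prod_zero[of S' m] nm unit_vec_nonzero[of n m] unit_vec_carrier by metis
qed

lemma mat_eqI_mult_vec:
  fixes A :: "'k::field mat"
  assumes "A \<in> carrier_mat m n" "B \<in> carrier_mat m n"
    and "\<And>v. v \<in> carrier_vec n \<Longrightarrow> A *\<^sub>v v = B *\<^sub>v v"
  shows "A = B"
proof (rule eq_matI)
  fix i j assume "i < dim_row B" "j < dim_col B"
  then have ij: "i < m" "j < n" using assms by auto
  have "(A *\<^sub>v unit_vec n j) $ i = (B *\<^sub>v unit_vec n j) $ i" using assms by simp
  then show "A $$ (i,j) = B $$ (i,j)" using ij assms(1,2) by simp
qed (use assms in auto)

lemma zero_mat_mult_vec:
  "v \<in> carrier_vec n \<Longrightarrow> (0\<^sub>m m n :: 'k::field mat) *\<^sub>v v = 0\<^sub>v m"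
  by (intro eq_vecI) (auto simp: scalar_prod_def)

lemma smult_mat_mult_vec:
  fixes A :: "'k::field mat"
  assumes "A \<in> carrier_mat m n" "v \<in> carrier_vec n"
  shows "(c \<cdot>\<^sub>m A) *\<^sub>v v = c \<cdot>\<^sub>v (A *\<^sub>v v)"
  using assms by (intro eq_vecI) (auto simp: scalar_prod_def sum_distrib_left mult.assoc)

definition mtrace :: "'k::field mat \<Rightarrow> 'k" where
  "mtrace A = (\<Sum>i<dim_row A. A $$ (i,i))"

lemma mtrace_mult:
  assumes "A \<in> carrier_mat m n" "B \<in> carrier_mat n m"
  shows "mtrace (A * B) = (\<Sum>i<m. \<Sum>j<n. A $$ (i,j) * B $$ (j,i))"
  using assms by (simp add: mtrace_def scalar_prod_def atLeast0LessThan)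

lemma mtrace_comm:
  assumes "A \<in> carrier_mat m n" "B \<in> carrier_mat n m"
  shows "mtrace (A * B) = mtrace (B * A)"
  unfolding mtrace_mult[OF assms] mtrace_mult[OF assms(2,1)]
  by (subst sum.swap) (simp add: mult.commute)

text \<open>The shape is passed explicitly, so that even an empty sum is a zero matrix of the right
  size.\<close>

definition msum :: "nat \<Rightarrow> nat \<Rightarrow> 'g set \<Rightarrow> ('g \<Rightarrow> 'k::field mat) \<Rightarrow> 'k mat" where
  "msum m n N f = mat m n (\<lambda>(i,j). \<Sum>g\<in>N. f g $$ (i,j))"

lemma msum_carrier [simp]: "msum m n N f \<in> carrier_mat m n"
  and msum_dim [simp]: "dim_row (msum m n N f) = m" "dim_col (msum m n N f) = n"
  and msum_index [simp]: "i < m \<Longrightarrow> j < n \<Longrightarrow> msum m n N f $$ (i,j) = (\<Sum>g\<in>N. f g $$ (i,j))"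
  by (auto simp: msum_def)

lemma msum_cong: "N = N' \<Longrightarrow> (\<And>g. g \<in> N' \<Longrightarrow> f g = f' g) \<Longrightarrow> msum m n N f = msum m n N' f'"
  by (auto simp: msum_def intro!: sum.cong)

lemma mult_msum:
  assumes "A \<in> carrier_mat l m" "\<And>g. g \<in> N \<Longrightarrow> f g \<in> carrier_mat m n"
  shows "A * msum m n N f = msum l n N (\<lambda>g. A * f g)"
proof (rule eq_matI)
  fix i j assume "i < dim_row (msum l n N (\<lambda>g. A * f g))" "j < dim_col (msum l n N (\<lambda>g. A * f g))"
  then have ij: "i < l" "j < n" by auto
  have "(A * msum m n N f) $$ (i,j) = (\<Sum>k\<in>{0..<m}. \<Sum>g\<in>N. A $$ (i,k) * f g $$ (k,j))"
    using ij assms(1) by (simp add: scalar_prod_def sum_distrib_left)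
  also have "\<dots> = (\<Sum>g\<in>N. \<Sum>k\<in>{0..<m}. A $$ (i,k) * f g $$ (k,j))" by (rule sum.swap)
  also have "\<dots> = (\<Sum>g\<in>N. (A * f g) $$ (i,j))"
  proof (rule sum.cong[OF refl])
    fix g assume "g \<in> N"
    then show "(\<Sum>k\<in>{0..<m}. A $$ (i,k) * f g $$ (k,j)) = (A * f g) $$ (i,j)"
      using ij assms(1) assms(2)[of g] by (simp add: scalar_prod_def)
  qed
  finally show "(A * msum m n N f) $$ (i,j) = msum l n N (\<lambda>g. A * f g) $$ (i,j)" using ij by simp
qed (use assms(1) in auto)

lemma msum_mult:
  assumes "A \<in> carrier_mat n l" "\<And>g. g \<in> N \<Longrightarrow> f g \<in> carrier_mat m n"
  shows "msum m n N f * A = msum m l N (\<lambda>g. f g * A)"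
proof (rule eq_matI)
  fix i j assume "i < dim_row (msum m l N (\<lambda>g. f g * A))" "j < dim_col (msum m l N (\<lambda>g. f g * A))"
  then have ij: "i < m" "j < l" by auto
  have "(msum m n N f * A) $$ (i,j) = (\<Sum>k\<in>{0..<n}. \<Sum>g\<in>N. f g $$ (i,k) * A $$ (k,j))"
    using ij assms(1) by (simp add: scalar_prod_def sum_distrib_right)
  also have "\<dots> = (\<Sum>g\<in>N. \<Sum>k\<in>{0..<n}. f g $$ (i,k) * A $$ (k,j))" by (rule sum.swap)
  also have "\<dots> = (\<Sum>g\<in>N. (f g * A) $$ (i,j))"
  proof (rule sum.cong[OF refl])
    fix g assume "g \<in> N"
    then show "(\<Sum>k\<in>{0..<n}. f g $$ (i,k) * A $$ (k,j)) = (f g * A) $$ (i,j)"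
      using ij assms(1) assms(2)[of g] by (simp add: scalar_prod_def)
  qed
  finally show "(msum m n N f * A) $$ (i,j) = msum m l N (\<lambda>g. f g * A) $$ (i,j)" using ij by simp
qed (use assms(1) in auto)

lemma is_repD:
  assumes "is_rep G H n \<rho>"
  shows "h \<in> H \<Longrightarrow> \<rho> h \<in> carrier_mat n n" "\<rho> \<one>\<^bsub>G\<^esub> = 1\<^sub>m n"
    "g \<in> H \<Longrightarrow> h \<in> H \<Longrightarrow> \<rho> (g \<otimes>\<^bsub>G\<^esub> h) = \<rho> g * \<rho> h"
  using assms by (auto simp: is_rep_def)

lemma irreducible_repD:
  assumes "irreducible_rep G H n \<rho>"
  shows "is_rep G H n \<rho>" "n > 0"
    "subspace_vec n W \<Longrightarrow> (\<And>h w. h \<in> H \<Longrightarrow> w \<in> W \<Longrightarrow> \<rho> h *\<^sub>v w \<in> W) \<Longrightarrow> W = {0\<^sub>v n} \<or> W = carrier_vec n"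
  using assms by (auto simp: irreducible_rep_def)

text \<open>Kernel and image of S are invariant, so a nonzero S is bijective. The sizes m and n are
  independent here; their equality comes from applying \<open>right_inverse_dim_le\<close> to S and
  to its inverse.\<close>

lemma schur:
  fixes \<rho> \<sigma> :: "'g \<Rightarrow> 'k::field mat"
  assumes \<rho>: "irreducible_rep G H n \<rho>" and \<sigma>: "irreducible_rep G H m \<sigma>"
    and S: "S \<in> carrier_mat m n" and comm: "\<And>h. h \<in> H \<Longrightarrow> S * \<rho> h = \<sigma> h * S"
  shows "S = 0\<^sub>m m n \<or> (m = n \<and> (\<exists>R\<in>carrier_mat n n. S * R = 1\<^sub>m n \<and> R * S = 1\<^sub>m n))"
proof (cases "S = 0\<^sub>m m n")
  case False
  note \<rho>r = is_repD[OF irreducible_repD(1)[OF \<rho>]] and \<sigma>r = is_repD[OF irreducible_repD(1)[OF \<sigma>]]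
  have comm_vec: "\<sigma> h *\<^sub>v (S *\<^sub>v v) = S *\<^sub>v (\<rho> h *\<^sub>v v)" if "h \<in> H" "v \<in> carrier_vec n" for h v
    using assoc_mult_mat_vec[OF S \<rho>r(1)[OF that(1)] that(2)]
      assoc_mult_mat_vec[OF \<sigma>r(1)[OF that(1)] S that(2)] comm[OF that(1)] by simp
  let ?K = "{v \<in> carrier_vec n. S *\<^sub>v v = 0\<^sub>v m}"
  have "subspace_vec n ?K"
    using S by (auto simp: subspace_vec_def mult_add_distrib_mat_vec[OF S] mult_mat_vec[OF S])
  moreover have "\<rho> h *\<^sub>v v \<in> ?K" if "h \<in> H" "v \<in> ?K" for h v
  proof -
    have "S *\<^sub>v (\<rho> h *\<^sub>v v) = \<sigma> h *\<^sub>v 0\<^sub>v m" using comm_vec[of h v] that by simp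
    also have "\<dots> = 0\<^sub>v m" using \<sigma>r(1)[OF that(1)] by auto
    finally show ?thesis using that \<rho>r(1)[OF that(1)] by auto
  qed
  ultimately have "?K = {0\<^sub>v n} \<or> ?K = carrier_vec n" by (rule irreducible_repD(3)[OF \<rho>])
  moreover have "?K \<noteq> carrier_vec n"
  proof
    assume K: "?K = carrier_vec n"
    have "S = 0\<^sub>m m n"
    proof (rule mat_eqI_mult_vec[OF S])
      fix v :: "'k vec" assume v: "v \<in> carrier_vec n"
      then have "S *\<^sub>v v = 0\<^sub>v m" using K by blast
      then show "S *\<^sub>v v = 0\<^sub>m m n *\<^sub>v v" using v by (simp add: zero_mat_mult_vec)
    qed simp
    then show False using False by simp
  qed
  ultimately have ker: "?K = {0\<^sub>v n}" by blast
  let ?I = "(\<lambda>v. S *\<^sub>v v) ` carrier_vec n"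
  have "subspace_vec m ?I"
    unfolding subspace_vec_def
  proof (intro conjI ballI allI)
    show "0\<^sub>v m \<in> ?I" using S by (intro image_eqI[of _ _ "0\<^sub>v n"]) auto
    fix v assume "v \<in> ?I"
    then obtain v' where v: "v' \<in> carrier_vec n" "v = S *\<^sub>v v'" by auto
    show "c \<cdot>\<^sub>v v \<in> ?I" for c
      using v S by (intro image_eqI[of _ _ "c \<cdot>\<^sub>v v'"]) (auto simp: mult_mat_vec[OF S])
    fix w assume "w \<in> ?I"
    then obtain w' where w: "w' \<in> carrier_vec n" "w = S *\<^sub>v w'" by auto
    show "v + w \<in> ?I"
      using v w S by (intro image_eqI[of _ _ "v' + w'"]) (auto simp: mult_add_distrib_mat_vec[OF S])
  qed (use S in auto)
  moreover have "\<sigma> h *\<^sub>v v \<in> ?I" if "h \<in> H" "v \<in> ?I" for h v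
    using that comm_vec \<rho>r(1)[OF that(1)] by (auto intro!: image_eqI[OF _ mult_mat_vec_carrier])
  ultimately have "?I = {0\<^sub>v m} \<or> ?I = carrier_vec m" by (rule irreducible_repD(3)[OF \<sigma>])
  moreover have "?I \<noteq> {0\<^sub>v m}"
  proof
    assume I: "?I = {0\<^sub>v m}"
    have "S = 0\<^sub>m m n"
    proof (rule mat_eqI_mult_vec[OF S])
      fix v :: "'k vec" assume v: "v \<in> carrier_vec n"
      then have "S *\<^sub>v v = 0\<^sub>v m" using I by blast
      then show "S *\<^sub>v v = 0\<^sub>m m n *\<^sub>v v" using v by (simp add: zero_mat_mult_vec)
    qed simp
    then show False using False by simp
  qed
  ultimately have im: "?I = carrier_vec m" by blast
  have "\<exists>v. v \<in> carrier_vec n \<and> S *\<^sub>v v = unit_vec m j" for j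
  proof -
    have "unit_vec m j \<in> ?I" unfolding im by simp
    then show ?thesis by (auto simp: image_iff)
  qed
  \<comment> \<open>The columns of the inverse are preimages of the unit vectors.\<close>
  then obtain r where r: "\<And>j. r j \<in> carrier_vec n" "\<And>j. S *\<^sub>v r j = unit_vec m j" by metis
  define R where "R = mat n m (\<lambda>(i,j). r j $ i)"
  have R: "R \<in> carrier_mat n m" by (simp add: R_def)
  have SR: "S * R = 1\<^sub>m m"
  proof (rule eq_matI)
    fix i j assume "i < dim_row (1\<^sub>m m :: 'k mat)" "j < dim_col (1\<^sub>m m :: 'k mat)"
    then have ij: "i < m" "j < m" by auto
    have "(S * R) $$ (i,j) = (S *\<^sub>v r j) $ i"
      using ij S r(1)[of j] by (simp add: R_def scalar_prod_def)
    then show "(S * R) $$ (i,j) = 1\<^sub>m m $$ (i,j)" using ij r(2)[of j] by simp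
  qed (use S R in auto)
  have RS: "R * S = 1\<^sub>m n"
  proof (rule mat_eqI_mult_vec)
    fix v :: "'k vec" assume v: "v \<in> carrier_vec n"
    have Sv: "S *\<^sub>v v \<in> carrier_vec m" using S v by simp
    have RSv: "R *\<^sub>v (S *\<^sub>v v) \<in> carrier_vec n" using R Sv by simp
    have "S *\<^sub>v (R *\<^sub>v (S *\<^sub>v v) - v) = S *\<^sub>v (R *\<^sub>v (S *\<^sub>v v)) - S *\<^sub>v v"
      by (rule mult_minus_distrib_mat_vec[OF S RSv v])
    also have "S *\<^sub>v (R *\<^sub>v (S *\<^sub>v v)) = S *\<^sub>v v"
      using assoc_mult_mat_vec[OF S R Sv] SR Sv by simp
    finally have "R *\<^sub>v (S *\<^sub>v v) - v \<in> ?K" using RSv v Sv by simp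
    then have "R *\<^sub>v (S *\<^sub>v v) - v = 0\<^sub>v n" using ker by blast
    then have "R *\<^sub>v (S *\<^sub>v v) - v + v = 0\<^sub>v n + v" by simp
    then have "R *\<^sub>v (S *\<^sub>v v) = v" using RSv v by (simp add: minus_add_uminus_vec)
    then show "(R * S) *\<^sub>v v = 1\<^sub>m n *\<^sub>v v"
      using assoc_mult_mat_vec[OF R S v] v by simp
  qed (use R S in auto)
  have "m = n" using right_inverse_dim_le[OF S R SR] right_inverse_dim_le[OF R S RS] by simp
  then show ?thesis using R SR RS by blast
qed simp

text \<open>Over an algebraically closed field S has an eigenvalue c. The operator S - c commutes
  with the representation and kills an eigenvector, so it is not invertible and must be
  zero.\<close>

lemma schur_scalar:
  fixes \<rho> :: "'g \<Rightarrow> 'k::alg_closed_field mat"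
  assumes \<rho>: "irreducible_rep G H n \<rho>"
    and S: "S \<in> carrier_mat n n" and comm: "\<And>h. h \<in> H \<Longrightarrow> S * \<rho> h = \<rho> h * S"
  shows "\<exists>c. S = c \<cdot>\<^sub>m 1\<^sub>m n"
proof -
  note \<rho>r = is_repD[OF irreducible_repD(1)[OF \<rho>]]
  have "degree (char_poly S) > 0"
    using degree_monic_char_poly[OF S] irreducible_repD(2)[OF \<rho>] by simp
  then obtain c where "poly (char_poly S) c = 0" using alg_closed_imp_poly_has_root by blast
  then obtain v where v: "v \<in> carrier_vec n" "v \<noteq> 0\<^sub>v n" "S *\<^sub>v v = c \<cdot>\<^sub>v v"
    using eigenvalue_root_char_poly[OF S] S by (auto simp: eigenvalue_def eigenvector_def)
  define T where "T = S - c \<cdot>\<^sub>m 1\<^sub>m n"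
  have T: "T \<in> carrier_mat n n" using S by (simp add: T_def minus_carrier_mat)
  have "T * \<rho> h = \<rho> h * T" if h: "h \<in> H" for h
  proof -
    note c = \<rho>r(1)[OF h]
    have "T * \<rho> h = S * \<rho> h - (c \<cdot>\<^sub>m 1\<^sub>m n) * \<rho> h"
      unfolding T_def by (rule minus_mult_distrib_mat[OF S _ c]) simp
    also have "(c \<cdot>\<^sub>m 1\<^sub>m n) * \<rho> h = c \<cdot>\<^sub>m \<rho> h"
      using c mult_smult_assoc_mat[of "1\<^sub>m n" n n "\<rho> h" n c] by simp
    also have "c \<cdot>\<^sub>m \<rho> h = \<rho> h * (c \<cdot>\<^sub>m 1\<^sub>m n)"
      using c mult_smult_distrib[of "\<rho> h" n n "1\<^sub>m n" n c] by simp
    also have "S * \<rho> h - \<rho> h * (c \<cdot>\<^sub>m 1\<^sub>m n) = \<rho> h * T"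
      unfolding T_def comm[OF h] by (rule mult_minus_distrib_mat[OF c S, symmetric]) simp
    finally show ?thesis .
  qed
  from schur[OF \<rho> \<rho> T this]
  have "T = 0\<^sub>m n n"
  proof
    assume "n = n \<and> (\<exists>R\<in>carrier_mat n n. T * R = 1\<^sub>m n \<and> R * T = 1\<^sub>m n)"
    then obtain R where R: "R \<in> carrier_mat n n" "R * T = 1\<^sub>m n" by blast
    have "T *\<^sub>v v = S *\<^sub>v v - (c \<cdot>\<^sub>m 1\<^sub>m n) *\<^sub>v v"
      unfolding T_def by (rule minus_mult_distrib_mat_vec[OF S _ v(1)]) simp
    also have "\<dots> = 0\<^sub>v n" using v by (simp add: smult_mat_mult_vec[of _ n n])
    finally have "R *\<^sub>v (T *\<^sub>v v) = 0\<^sub>v n" using R(1) by auto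
    then have "v = 0\<^sub>v n" using assoc_mult_mat_vec[OF R(1) T v(1)] R(2) v(1) by simp
    then show ?thesis using v(2) by simp
  qed
  have "S = T + c \<cdot>\<^sub>m 1\<^sub>m n" unfolding T_def using S by (intro eq_matI) auto
  then show ?thesis unfolding \<open>T = 0\<^sub>m n n\<close> by (intro exI[of _ c]) (simp add: left_add_zero_mat[of _ n n])
qed

section \<open>The action of kN on its irreducible modules and Fourier inversion\<close>

context p_nilpotent_group
begin

abbreviation irr :: "nat \<Rightarrow> ('a \<Rightarrow> 'k mat) \<Rightarrow> bool" where
  "irr n \<rho> \<equiv> irreducible_rep G N n \<rho>"

text \<open>The linear extension of \<open>\<rho>\<close> to kN, evaluated at the part of a
  supported on N.\<close>

definition hat :: "nat \<Rightarrow> ('a \<Rightarrow> 'k mat) \<Rightarrow> ('a \<Rightarrow> 'k) \<Rightarrow> 'k mat" where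
  "hat n \<rho> a = msum n n N (\<lambda>g. a g \<cdot>\<^sub>m \<rho> g)"

lemma hat_carrier [simp]: "hat n \<rho> a \<in> carrier_mat n n"
  and hat_dim [simp]: "dim_row (hat n \<rho> a) = n" "dim_col (hat n \<rho> a) = n"
  by (simp_all add: hat_def)

lemma hat_index:
  assumes "is_rep G N n \<rho>" "i < n" "j < n"
  shows "hat n \<rho> a $$ (i,j) = (\<Sum>g\<in>N. a g * \<rho> g $$ (i,j))"
proof -
  have "dim_row (\<rho> g) = n" "dim_col (\<rho> g) = n" if "g \<in> N" for g
    using is_repD(1)[OF assms(1) that] by auto
  then show ?thesis unfolding hat_def using assms(2,3) by (simp cong: sum.cong)
qed

lemma hat_add:
  assumes "is_rep G N n \<rho>"
  shows "hat n \<rho> (a + b) = hat n \<rho> a + hat n \<rho> b"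
  by (intro eq_matI) (auto simp: hat_index[OF assms] algebra_simps sum.distrib)

lemma hat_smult:
  assumes "is_rep G N n \<rho>"
  shows "hat n \<rho> (ga_smult c a) = c \<cdot>\<^sub>m hat n \<rho> a"
  by (intro eq_matI) (auto simp: hat_index[OF assms] ga_smult_apply sum_distrib_left mult.assoc)

lemma hat_zero:
  assumes "is_rep G N n \<rho>"
  shows "hat n \<rho> 0 = 0\<^sub>m n n"
  by (intro eq_matI) (auto simp: hat_index[OF assms])

lemma sum_N_translate:
  assumes "h \<in> N"
  shows "(\<Sum>g\<in>N. f (h \<otimes> g)) = (\<Sum>g\<in>N. f g)"
  using assms
  by (intro sum.reindex_bij_witness[of _ "\<lambda>g. inv h \<otimes> g" "\<lambda>g. h \<otimes> g"]) (auto simp: m_assoc[symmetric])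

lemma sum_N_conj:
  assumes "x \<in> carrier G"
  shows "(\<Sum>g\<in>N. f (inv x \<otimes> g \<otimes> x)) = (\<Sum>g\<in>N. f g)"
proof (rule sum.reindex_bij_witness[of _ "\<lambda>g. x \<otimes> g \<otimes> inv x" "\<lambda>g. inv x \<otimes> g \<otimes> x"])
  fix g assume g: "g \<in> N"
  show "x \<otimes> (inv x \<otimes> g \<otimes> x) \<otimes> inv x = g" "inv x \<otimes> (x \<otimes> g \<otimes> inv x) \<otimes> x = g"
    using assms g by (simp add: m_assoc, simp add: m_assoc[symmetric])+
  show "inv x \<otimes> g \<otimes> x \<in> N" "x \<otimes> g \<otimes> inv x \<in> N"
    using assms g conj_N conj_N' by auto
qed simp

lemma hat_mult:
  assumes \<rho>: "is_rep G N n \<rho>" and a: "a \<in> supp_on N"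
  shows "hat n \<rho> (ga_mult G a b) = hat n \<rho> a * hat n \<rho> b"
proof (rule eq_matI)
  fix i j assume "i < dim_row (hat n \<rho> a * hat n \<rho> b)" "j < dim_col (hat n \<rho> a * hat n \<rho> b)"
  then have ij: "i < n" "j < n" by auto
  have mult: "ga_mult G a b g = (\<Sum>h\<in>N. a h * b (inv h \<otimes> g))" if g: "g \<in> N" for g
    unfolding ga_mult_apply[OF N.mem_carrier[OF g]]
    using a by (intro sum.mono_neutral_right) (auto simp: supp_on_def)
  have "hat n \<rho> (ga_mult G a b) $$ (i,j) = (\<Sum>g\<in>N. \<Sum>h\<in>N. a h * b (inv h \<otimes> g) * \<rho> g $$ (i,j))"
    unfolding hat_index[OF \<rho> ij] by (rule sum.cong) (simp_all add: mult sum_distrib_right)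
  also have "\<dots> = (\<Sum>h\<in>N. \<Sum>g\<in>N. a h * b (inv h \<otimes> g) * \<rho> g $$ (i,j))" by (rule sum.swap)
  also have "\<dots> = (\<Sum>h\<in>N. \<Sum>g\<in>N. \<Sum>k\<in>{0..<n}. a h * \<rho> h $$ (i,k) * (b g * \<rho> g $$ (k,j)))"
  proof (rule sum.cong[OF refl])
    fix h assume h: "h \<in> N"
    have "(\<Sum>g\<in>N. a h * b (inv h \<otimes> g) * \<rho> g $$ (i,j)) = (\<Sum>g\<in>N. a h * b (inv h \<otimes> (h \<otimes> g)) * \<rho> (h \<otimes> g) $$ (i,j))"
      by (rule sum_N_translate[OF h, symmetric])
    also have "\<dots> = (\<Sum>g\<in>N. \<Sum>k\<in>{0..<n}. a h * \<rho> h $$ (i,k) * (b g * \<rho> g $$ (k,j)))"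
    proof (rule sum.cong[OF refl])
      fix g assume g: "g \<in> N"
      have "inv h \<otimes> (h \<otimes> g) = g" using h g by (simp add: m_assoc[symmetric])
      moreover have "\<rho> (h \<otimes> g) $$ (i,j) = (\<Sum>k\<in>{0..<n}. \<rho> h $$ (i,k) * \<rho> g $$ (k,j))"
        using is_repD(1)[OF \<rho> h] is_repD(1)[OF \<rho> g] ij
        by (simp add: is_repD(3)[OF \<rho> h g] scalar_prod_def)
      ultimately show "a h * b (inv h \<otimes> (h \<otimes> g)) * \<rho> (h \<otimes> g) $$ (i,j) =
          (\<Sum>k\<in>{0..<n}. a h * \<rho> h $$ (i,k) * (b g * \<rho> g $$ (k,j)))"
        by (simp add: sum_distrib_left mult_ac)
    qed
    finally show "(\<Sum>g\<in>N. a h * b (inv h \<otimes> g) * \<rho> g $$ (i,j)) =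
        (\<Sum>g\<in>N. \<Sum>k\<in>{0..<n}. a h * \<rho> h $$ (i,k) * (b g * \<rho> g $$ (k,j)))" .
  qed
  also have "\<dots> = (\<Sum>h\<in>N. \<Sum>k\<in>{0..<n}. \<Sum>g\<in>N. a h * \<rho> h $$ (i,k) * (b g * \<rho> g $$ (k,j)))"
    by (intro sum.cong refl sum.swap)
  also have "\<dots> = (\<Sum>k\<in>{0..<n}. \<Sum>h\<in>N. \<Sum>g\<in>N. a h * \<rho> h $$ (i,k) * (b g * \<rho> g $$ (k,j)))"
    by (rule sum.swap)
  also have "\<dots> = (\<Sum>k\<in>{0..<n}. hat n \<rho> a $$ (i,k) * hat n \<rho> b $$ (k,j))"
    using ij by (intro sum.cong) (auto simp: hat_index[OF \<rho>] sum_product)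
  also have "\<dots> = (hat n \<rho> a * hat n \<rho> b) $$ (i,j)"
    using ij by (simp add: scalar_prod_def)
  finally show "hat n \<rho> (ga_mult G a b) $$ (i,j) = (hat n \<rho> a * hat n \<rho> b) $$ (i,j)" .
qed auto

lemma msum_smult_mult_left:
  assumes \<rho>: "is_rep G N n \<rho>" and S: "S \<in> carrier_mat m n"
  shows "S * hat n \<rho> a = msum m n N (\<lambda>g. a g \<cdot>\<^sub>m (S * \<rho> g))"
  unfolding hat_def using is_repD(1)[OF \<rho>]
  by (subst mult_msum[OF S]) (auto intro!: msum_cong simp: mult_smult_distrib[OF S is_repD(1)[OF \<rho>]])

lemma msum_smult_mult_right:
  assumes \<rho>: "is_rep G N n \<rho>" and S: "S \<in> carrier_mat n m"
  shows "hat n \<rho> a * S = msum n m N (\<lambda>g. a g \<cdot>\<^sub>m (\<rho> g * S))"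
  unfolding hat_def using is_repD(1)[OF \<rho>]
  by (subst msum_mult[OF S]) (auto intro!: msum_cong simp: mult_smult_assoc_mat[OF is_repD(1)[OF \<rho>] S])

lemma hat_intertwine:
  assumes \<rho>: "is_rep G N n \<rho>" and \<sigma>: "is_rep G N n \<sigma>" and S: "S \<in> carrier_mat n n"
    and "\<And>h. h \<in> N \<Longrightarrow> S * \<rho> h = \<sigma> h * S"
  shows "S * hat n \<rho> a = hat n \<sigma> a * S"
  unfolding msum_smult_mult_left[OF \<rho> S] msum_smult_mult_right[OF \<sigma> S]
  using assms(4) by (intro msum_cong) auto

lemma conj_rep_is_rep:
  assumes \<rho>: "is_rep G N n \<rho>" and x: "x \<in> carrier G"
  shows "is_rep G N n (conj_rep G x \<rho>)"
proof -
  have "inv x \<otimes> (g \<otimes> h) \<otimes> x = (inv x \<otimes> g \<otimes> x) \<otimes> (inv x \<otimes> h \<otimes> x)" if "g \<in> N" "h \<in> N" for g h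
  proof -
    have "x \<otimes> (inv x \<otimes> (h \<otimes> x)) = h \<otimes> x" using x that by (simp add: m_assoc[symmetric])
    then show ?thesis using x that by (simp add: m_assoc)
  qed
  then show ?thesis
    using is_repD[OF \<rho>] x conj_N'[OF x] by (simp add: is_rep_def conj_rep_def)
qed

lemma conj_rep_irr:
  assumes \<rho>: "irr n \<rho>" and x: "x \<in> carrier G"
  shows "irr n (conj_rep G x \<rho>)"
  unfolding irreducible_rep_def
proof (intro conjI allI impI)
  show "is_rep G N n (conj_rep G x \<rho>)" using conj_rep_is_rep irreducible_repD(1)[OF \<rho>] x by blast
  show "0 < n" using irreducible_repD(2)[OF \<rho>] .
  fix W assume W: "subspace_vec n W \<and> (\<forall>h\<in>N. \<forall>w\<in>W. conj_rep G x \<rho> h *\<^sub>v w \<in> W)"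
  show "W = {0\<^sub>v n} \<or> W = carrier_vec n"
  proof (rule irreducible_repD(3)[OF \<rho>])
    fix h w assume h: "h \<in> N" and w: "w \<in> W"
    have "inv x \<otimes> (x \<otimes> h \<otimes> inv x) \<otimes> x = h"
      using x h by (simp add: m_assoc) (simp add: m_assoc[symmetric])
    then have "conj_rep G x \<rho> (x \<otimes> h \<otimes> inv x) = \<rho> h" by (simp add: conj_rep_def)
    then show "\<rho> h *\<^sub>v w \<in> W" using W conj_N[OF x h] w by metis
  qed (use W in blast)
qed

lemma hat_conj:
  assumes \<rho>: "is_rep G N n \<rho>" and y: "y \<in> carrier G"
  shows "hat n \<rho> (ga_conj G y a) = hat n (conj_rep G (inv y) \<rho>) a"
proof -
  have y': "inv y \<in> carrier G" using y by simp
  show ?thesis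
  proof (rule eq_matI)
    fix i j assume "i < dim_row (hat n (conj_rep G (inv y) \<rho>) a)" "j < dim_col (hat n (conj_rep G (inv y) \<rho>) a)"
    then have ij: "i < n" "j < n" by (auto simp: hat_def)
    have "hat n \<rho> (ga_conj G y a) $$ (i,j) = (\<Sum>g\<in>N. a (inv y \<otimes> g \<otimes> y) * \<rho> g $$ (i,j))"
      unfolding hat_index[OF \<rho> ij] by (rule sum.cong) (auto simp: ga_conj_def)
    also have "\<dots> = (\<Sum>g\<in>N. a g * \<rho> (y \<otimes> g \<otimes> inv y) $$ (i,j))"
    proof -
      have "y \<otimes> (inv y \<otimes> g \<otimes> y) \<otimes> inv y = g" if "g \<in> N" for g
        using y that by (simp add: m_assoc) (simp add: m_assoc[symmetric])
      then show ?thesis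
        using sum_N_conj[OF y, of "\<lambda>g. a g * \<rho> (y \<otimes> g \<otimes> inv y) $$ (i,j)"] by (simp cong: sum.cong)
    qed
    also have "\<dots> = hat n (conj_rep G (inv y) \<rho>) a $$ (i,j)"
      unfolding hat_index[OF conj_rep_is_rep[OF \<rho> y'] ij] by (simp add: conj_rep_def y)
    finally show "hat n \<rho> (ga_conj G y a) $$ (i,j) = hat n (conj_rep G (inv y) \<rho>) a $$ (i,j)" .
  qed (auto simp: hat_def)
qed

text \<open>A P-fixed element acts by the same matrix on M and on its P-conjugates. This is why
  (kN)^P sees one factor for each P-orbit of modules.\<close>

lemma hat_conj_rep_fixed:
  assumes \<rho>: "is_rep G N n \<rho>" and y: "y \<in> P" and a: "a \<in> fixed_alg"
  shows "hat n (conj_rep G y \<rho>) a = hat n \<rho> a"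
proof -
  have "ga_conj G (inv y) a = a" using a y by (simp add: fixed_alg_def centralizer_alg_def)
  then show ?thesis using hat_conj[OF \<rho>, of "inv y" a] y by simp
qed

text \<open>The sum of \<open>\<sigma>(g) E\<^sub>k\<^sub>l \<rho>(g\<inverse>)\<close> over \<open>N\<close> for the matrix unit \<open>E\<^sub>k\<^sub>l\<close>.\<close>
definition average :: "nat \<Rightarrow> nat \<Rightarrow> ('a \<Rightarrow> 'k mat) \<Rightarrow> ('a \<Rightarrow> 'k mat) \<Rightarrow> nat \<Rightarrow> nat \<Rightarrow> 'k mat" where
  "average m n \<sigma> \<rho> k l = mat m n (\<lambda>(i,j). \<Sum>g\<in>N. \<sigma> g $$ (i,k) * \<rho> (inv g) $$ (l,j))"

lemma average_intertwines:
  assumes \<sigma>: "is_rep G N m \<sigma>" and \<rho>: "is_rep G N n \<rho>" and kl: "k < m" "l < n" and h: "h \<in> N"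
  shows "average m n \<sigma> \<rho> k l * \<rho> h = \<sigma> h * average m n \<sigma> \<rho> k l"
proof (rule eq_matI)
  note \<sigma>c = is_repD(1)[OF \<sigma>] and \<rho>c = is_repD(1)[OF \<rho>]
  fix i j assume "i < dim_row (\<sigma> h * average m n \<sigma> \<rho> k l)" "j < dim_col (\<sigma> h * average m n \<sigma> \<rho> k l)"
  then have ij: "i < m" "j < n" using \<sigma>c[OF h] by (auto simp: average_def)
  have \<rho>e: "\<rho> (x \<otimes> y) $$ (l,j) = (\<Sum>t\<in>{0..<n}. \<rho> x $$ (l,t) * \<rho> y $$ (t,j))" if "x \<in> N" "y \<in> N" for x y
    using \<rho>c[OF that(1)] \<rho>c[OF that(2)] ij kl by (simp add: is_repD(3)[OF \<rho> that] scalar_prod_def)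
  have \<sigma>e: "\<sigma> (x \<otimes> y) $$ (i,k) = (\<Sum>t\<in>{0..<m}. \<sigma> x $$ (i,t) * \<sigma> y $$ (t,k))" if "x \<in> N" "y \<in> N" for x y
    using \<sigma>c[OF that(1)] \<sigma>c[OF that(2)] ij kl by (simp add: is_repD(3)[OF \<sigma> that] scalar_prod_def)
  have "(average m n \<sigma> \<rho> k l * \<rho> h) $$ (i,j)
      = (\<Sum>t\<in>{0..<n}. \<Sum>g\<in>N. \<sigma> g $$ (i,k) * (\<rho> (inv g) $$ (l,t) * \<rho> h $$ (t,j)))"
    using ij \<rho>c[OF h] by (simp add: average_def scalar_prod_def sum_distrib_right mult.assoc)
  also have "\<dots> = (\<Sum>g\<in>N. \<Sum>t\<in>{0..<n}. \<sigma> g $$ (i,k) * (\<rho> (inv g) $$ (l,t) * \<rho> h $$ (t,j)))"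
    by (rule sum.swap)
  also have "\<dots> = (\<Sum>g\<in>N. \<sigma> g $$ (i,k) * \<rho> (inv g \<otimes> h) $$ (l,j))"
    using h by (intro sum.cong) (auto simp: \<rho>e sum_distrib_left)
  also have "\<dots> = (\<Sum>g\<in>N. \<sigma> (h \<otimes> g) $$ (i,k) * \<rho> (inv (h \<otimes> g) \<otimes> h) $$ (l,j))"
    by (rule sum_N_translate[OF h, symmetric])
  also have "\<dots> = (\<Sum>g\<in>N. \<Sum>t\<in>{0..<m}. \<sigma> h $$ (i,t) * (\<sigma> g $$ (t,k) * \<rho> (inv g) $$ (l,j)))"
    using h by (intro sum.cong) (auto simp: \<sigma>e sum_distrib_right mult.assoc inv_mult_group m_assoc)
  also have "\<dots> = (\<Sum>t\<in>{0..<m}. \<Sum>g\<in>N. \<sigma> h $$ (i,t) * (\<sigma> g $$ (t,k) * \<rho> (inv g) $$ (l,j)))"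
    by (rule sum.swap)
  also have "\<dots> = (\<sigma> h * average m n \<sigma> \<rho> k l) $$ (i,j)"
    using ij \<sigma>c[OF h] by (simp add: average_def scalar_prod_def sum_distrib_left)
  finally show "(average m n \<sigma> \<rho> k l * \<rho> h) $$ (i,j) = (\<sigma> h * average m n \<sigma> \<rho> k l) $$ (i,j)" .
qed (use is_repD(1)[OF \<sigma> h] is_repD(1)[OF \<rho> h] in \<open>auto simp: average_def\<close>)

lemma average_eq_0_or_iso:
  assumes \<sigma>: "irr m \<sigma>" and \<rho>: "irr n \<rho>" and kl: "k < m" "l < n"
  shows "average m n \<sigma> \<rho> k l = 0\<^sub>m m n \<or> (m = n \<and> rep_iso N n \<rho> \<sigma>)"
proof -
  have S: "average m n \<sigma> \<rho> k l \<in> carrier_mat m n" by (simp add: average_def)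
  note c = average_intertwines[OF irreducible_repD(1)[OF \<sigma>] irreducible_repD(1)[OF \<rho>] kl]
  have "average m n \<sigma> \<rho> k l = 0\<^sub>m m n \<or>
    (m = n \<and> (\<exists>R\<in>carrier_mat n n. average m n \<sigma> \<rho> k l * R = 1\<^sub>m n \<and> R * average m n \<sigma> \<rho> k l = 1\<^sub>m n))"
    by (rule schur[OF \<rho> \<sigma> S c])
  moreover have "rep_iso N n \<rho> \<sigma>"
    if "m = n" "R \<in> carrier_mat n n" "average m n \<sigma> \<rho> k l * R = 1\<^sub>m n" "R * average m n \<sigma> \<rho> k l = 1\<^sub>m n" for R
    unfolding rep_iso_def using that S c by blast
  ultimately show ?thesis by blast
qed

text \<open>By Schur's lemma the average of the matrix unit at (k,l) is a scalar c. Taking traces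
  gives n c = |N| if k = l and 0 otherwise. The formula is kept multiplied by n, and the case k = l
  shows that n is invertible in k because |N| is.\<close>

lemma coefficient_orthogonality:
  assumes \<rho>: "irr n \<rho>"
  shows "of_nat n \<noteq> (0::'k)"
    and "\<lbrakk>i < n; j < n; k < n; l < n\<rbrakk> \<Longrightarrow> of_nat n * (\<Sum>g\<in>N. \<rho> g $$ (i,k) * \<rho> (inv g) $$ (l,j)) =
      (if i = j \<and> k = l then of_nat (card N) else 0)"
proof -
  note \<rho>r = is_repD[OF irreducible_repD(1)[OF \<rho>]]
  have ex: "\<exists>c. \<forall>i<n. \<forall>j<n. (\<Sum>g\<in>N. \<rho> g $$ (i,k) * \<rho> (inv g) $$ (l,j)) = (if i = j then c else 0)"
    if kl: "k < n" "l < n" for k l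
  proof -
    have S: "average n n \<rho> \<rho> k l \<in> carrier_mat n n" by (simp add: average_def)
    from schur_scalar[OF \<rho> S average_intertwines[OF irreducible_repD(1)[OF \<rho>] irreducible_repD(1)[OF \<rho>] kl]]
    obtain c where c: "average n n \<rho> \<rho> k l = c \<cdot>\<^sub>m 1\<^sub>m n" by blast
    have "(\<Sum>g\<in>N. \<rho> g $$ (i,k) * \<rho> (inv g) $$ (l,j)) = (if i = j then c else 0)" if "i < n" "j < n" for i j
      using arg_cong[OF c, of "\<lambda>M. M $$ (i,j)"] that by (simp add: average_def split: if_splits)
    then show ?thesis by blast
  qed
  have trace: "(\<Sum>i<n. \<Sum>g\<in>N. \<rho> g $$ (i,k) * \<rho> (inv g) $$ (l,i)) = (if k = l then of_nat (card N) else 0)"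
    if kl: "k < n" "l < n" for k l
  proof -
    have "(\<Sum>i<n. \<Sum>g\<in>N. \<rho> g $$ (i,k) * \<rho> (inv g) $$ (l,i)) = (\<Sum>g\<in>N. \<Sum>i<n. \<rho> (inv g) $$ (l,i) * \<rho> g $$ (i,k))"
      by (subst sum.swap) (simp add: mult.commute)
    also have "\<dots> = (\<Sum>g\<in>N. if k = l then 1 else 0)"
    proof (rule sum.cong[OF refl])
      fix g assume g: "g \<in> N"
      have "\<rho> (inv g) * \<rho> g = 1\<^sub>m n"
        using \<rho>r(3)[OF N.m_inv_closed[OF g] g] \<rho>r(2) g by simp
      then have "(\<rho> (inv g) * \<rho> g) $$ (l,k) = 1\<^sub>m n $$ (l,k)" by simp
      then show "(\<Sum>i<n. \<rho> (inv g) $$ (l,i) * \<rho> g $$ (i,k)) = (if k = l then 1 else 0)"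
        using kl \<rho>r(1)[OF g] \<rho>r(1)[OF N.m_inv_closed[OF g]] by (simp add: scalar_prod_def atLeast0LessThan split: if_splits)
    qed
    also have "\<dots> = (if k = l then of_nat (card N) else 0)" by simp
    finally show ?thesis .
  qed
  have c: "of_nat n * (\<Sum>g\<in>N. \<rho> g $$ (i,k) * \<rho> (inv g) $$ (l,i)) = (if k = l then of_nat (card N) else 0)"
    if "k < n" "l < n" "i < n" for i k l
  proof -
    from ex[OF that(1,2)] obtain c where
      c: "\<And>i j. i < n \<Longrightarrow> j < n \<Longrightarrow> (\<Sum>g\<in>N. \<rho> g $$ (i,k) * \<rho> (inv g) $$ (l,j)) = (if i = j then c else 0)" by blast
    then have "(\<Sum>i<n. \<Sum>g\<in>N. \<rho> g $$ (i,k) * \<rho> (inv g) $$ (l,i)) = of_nat n * c" by simp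
    then show ?thesis using trace[OF that(1,2)] c[OF that(3,3)] by simp
  qed
  have n: "0 < n" by (rule irreducible_repD(2)[OF \<rho>])
  show "of_nat n \<noteq> (0::'k)" using c[OF n n n] card_N_nonzero by auto
  assume "i < n" "j < n" "k < n" "l < n"
  then show "of_nat n * (\<Sum>g\<in>N. \<rho> g $$ (i,k) * \<rho> (inv g) $$ (l,j)) = (if i = j \<and> k = l then of_nat (card N) else 0)"
    using c[of k l i] ex[of k l] by auto
qed

text \<open>The element of \<open>kN\<close> acting as \<open>A\<close> on \<open>\<rho>\<close> and as zero on all other irreducible modules.\<close>
definition fourier :: "nat \<Rightarrow> ('a \<Rightarrow> 'k mat) \<Rightarrow> 'k mat \<Rightarrow> 'a \<Rightarrow> 'k" where
  "fourier n \<rho> A = (\<lambda>g. if g \<in> N then of_nat n / of_nat (card N) * mtrace (A * \<rho> (inv g)) else 0)"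

lemma fourier_supp [simp]: "fourier n \<rho> A \<in> supp_on N"
  by (simp add: fourier_def supp_on_def)

lemma hat_fourier_index:
  assumes \<sigma>: "is_rep G N m \<sigma>" and \<rho>: "is_rep G N n \<rho>" and A: "A \<in> carrier_mat n n" and ij: "i < m" "j < m"
  shows "hat m \<sigma> (fourier n \<rho> A) $$ (i,j) = of_nat n / of_nat (card N) *
    (\<Sum>s<n. \<Sum>t<n. A $$ (s,t) * (\<Sum>g\<in>N. \<sigma> g $$ (i,j) * \<rho> (inv g) $$ (t,s)))"
proof -
  have "hat m \<sigma> (fourier n \<rho> A) $$ (i,j) = (\<Sum>g\<in>N. of_nat n / of_nat (card N) *
      (\<Sum>s<n. \<Sum>t<n. A $$ (s,t) * (\<sigma> g $$ (i,j) * \<rho> (inv g) $$ (t,s))))"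
    unfolding hat_index[OF \<sigma> ij]
  proof (rule sum.cong[OF refl])
    fix g assume g: "g \<in> N"
    show "fourier n \<rho> A g * \<sigma> g $$ (i,j) = of_nat n / of_nat (card N) *
      (\<Sum>s<n. \<Sum>t<n. A $$ (s,t) * (\<sigma> g $$ (i,j) * \<rho> (inv g) $$ (t,s)))"
      using g by (simp add: fourier_def mtrace_mult[OF A is_repD(1)[OF \<rho> N.m_inv_closed[OF g]]]
        sum_distrib_left sum_distrib_right mult_ac)
  qed
  also have "\<dots> = of_nat n / of_nat (card N) *
      (\<Sum>g\<in>N. \<Sum>s<n. \<Sum>t<n. A $$ (s,t) * (\<sigma> g $$ (i,j) * \<rho> (inv g) $$ (t,s)))"
    by (simp only: sum_distrib_left)
  also have "(\<Sum>g\<in>N. \<Sum>s<n. \<Sum>t<n. A $$ (s,t) * (\<sigma> g $$ (i,j) * \<rho> (inv g) $$ (t,s))) =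
      (\<Sum>s<n. \<Sum>g\<in>N. \<Sum>t<n. A $$ (s,t) * (\<sigma> g $$ (i,j) * \<rho> (inv g) $$ (t,s)))"
    by (rule sum.swap)
  also have "\<dots> = (\<Sum>s<n. \<Sum>t<n. \<Sum>g\<in>N. A $$ (s,t) * (\<sigma> g $$ (i,j) * \<rho> (inv g) $$ (t,s)))"
    by (intro sum.cong refl sum.swap)
  finally show ?thesis by (simp only: sum_distrib_left)
qed

text \<open>The factor n/|N| in \<open>fourier\<close> cancels the value |N|/n of the nonzero sums
  in \<open>coefficient_orthogonality\<close>.\<close>

lemma hat_fourier:
  assumes \<rho>: "irr n \<rho>" and A: "A \<in> carrier_mat n n"
  shows "hat n \<rho> (fourier n \<rho> A) = A"
proof (rule eq_matI)
  fix i j assume "i < dim_row A" "j < dim_col A"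
  then have ij: "i < n" "j < n" using A by auto
  note \<rho>r = irreducible_repD(1)[OF \<rho>]
  have "hat n \<rho> (fourier n \<rho> A) $$ (i,j) =
      (\<Sum>s<n. \<Sum>t<n. A $$ (s,t) * (of_nat n * (\<Sum>g\<in>N. \<rho> g $$ (i,j) * \<rho> (inv g) $$ (t,s)))) / of_nat (card N)"
    unfolding hat_fourier_index[OF \<rho>r \<rho>r A ij]
    by (simp add: sum_distrib_left sum_divide_distrib mult_ac)
  also have "(\<Sum>s<n. \<Sum>t<n. A $$ (s,t) * (of_nat n * (\<Sum>g\<in>N. \<rho> g $$ (i,j) * \<rho> (inv g) $$ (t,s)))) =
      (\<Sum>s<n. \<Sum>t<n. if t = j then (if s = i then A $$ (s,t) * of_nat (card N) else 0) else 0)"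
    using ij by (intro sum.cong refl) (auto simp: coefficient_orthogonality(2)[OF \<rho>])
  also have "\<dots> = A $$ (i,j) * of_nat (card N)"
    using ij by (simp add: sum.delta)
  finally show "hat n \<rho> (fourier n \<rho> A) $$ (i,j) = A $$ (i,j)" using card_N_nonzero by simp
qed (use A in auto)

text \<open>The entries involved are entries of averages between two nonisomorphic irreducible
  modules, and those averages vanish.\<close>

lemma hat_fourier_other:
  assumes \<sigma>: "irr m \<sigma>" and \<rho>: "irr n \<rho>" and A: "A \<in> carrier_mat n n"
    and not_iso: "\<not> (m = n \<and> rep_iso N n \<rho> \<sigma>)"
  shows "hat m \<sigma> (fourier n \<rho> A) = 0\<^sub>m m m"
proof (rule eq_matI)
  fix i j assume "i < dim_row (0\<^sub>m m m :: 'k mat)" "j < dim_col (0\<^sub>m m m :: 'k mat)"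
  then have ij: "i < m" "j < m" by auto
  have "(\<Sum>g\<in>N. \<sigma> g $$ (i,j) * \<rho> (inv g) $$ (t,s)) = 0" if "s < n" "t < n" for s t
  proof -
    have "average m n \<sigma> \<rho> j t = 0\<^sub>m m n" using average_eq_0_or_iso[OF \<sigma> \<rho> ij(2) that(2)] not_iso by blast
    from arg_cong[OF this, of "\<lambda>M. M $$ (i,s)"] show ?thesis
      using ij that by (simp add: average_def)
  qed
  then show "hat m \<sigma> (fourier n \<rho> A) $$ (i,j) = 0\<^sub>m m m $$ (i,j)"
    using ij hat_fourier_index[OF irreducible_repD(1)[OF \<sigma>] irreducible_repD(1)[OF \<rho>] A ij] by simp
qed (auto simp: hat_def)

text \<open>The endomorphism algebra \<open>E\<^bsub>T\<^esub>(M)\<close>, \<open>T = T\<^sub>P(M)\<close>, described without a choice of the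
  extension of \<open>M\<close> to its inertia group: by Schur's lemma the extension maps \<open>x \<in> T\<close> to a scalar
  multiple of any \<open>S\<close> as below.\<close>
definition com_alg :: "nat \<Rightarrow> ('a \<Rightarrow> 'k mat) \<Rightarrow> 'k mat set" where
  "com_alg n \<rho> = {A \<in> carrier_mat n n. \<forall>x\<in>P. \<forall>S\<in>carrier_mat n n. \<forall>R\<in>carrier_mat n n.
     S * R = 1\<^sub>m n \<longrightarrow> R * S = 1\<^sub>m n \<longrightarrow> (\<forall>h\<in>N. S * conj_rep G x \<rho> h = \<rho> h * S) \<longrightarrow> A * S = S * A}"

lemma com_algD:
  assumes "A \<in> com_alg n \<rho>"
  shows "A \<in> carrier_mat n n"
    and "\<lbrakk>x \<in> P; S \<in> carrier_mat n n; R \<in> carrier_mat n n; S * R = 1\<^sub>m n; R * S = 1\<^sub>m n;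
      \<And>h. h \<in> N \<Longrightarrow> S * conj_rep G x \<rho> h = \<rho> h * S\<rbrakk> \<Longrightarrow> A * S = S * A"
  using assms unfolding com_alg_def by blast+

lemma com_algI:
  assumes "A \<in> carrier_mat n n"
    and "\<And>x S R. \<lbrakk>x \<in> P; S \<in> carrier_mat n n; R \<in> carrier_mat n n; S * R = 1\<^sub>m n; R * S = 1\<^sub>m n;
      \<And>h. h \<in> N \<Longrightarrow> S * conj_rep G x \<rho> h = \<rho> h * S\<rbrakk> \<Longrightarrow> A * S = S * A"
  shows "A \<in> com_alg n \<rho>"
  using assms unfolding com_alg_def by blast

lemma unital_com_alg: "unital_alg (com_alg n \<rho>) (+) (\<cdot>\<^sub>m) (*) (1\<^sub>m n)"
proof
  note c = com_algD(1)
  fix x y assume x: "x \<in> com_alg n \<rho>" and y: "y \<in> com_alg n \<rho>"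
  show "x + y \<in> com_alg n \<rho>"
  proof (rule com_algI)
    fix g S R assume *: "g \<in> P" "S \<in> carrier_mat n n" "R \<in> carrier_mat n n" "S * R = 1\<^sub>m n" "R * S = 1\<^sub>m n"
      "\<And>h. h \<in> N \<Longrightarrow> S * conj_rep G g \<rho> h = \<rho> h * S"
    have "x * S = S * x" "y * S = S * y"
      using com_algD(2)[OF x *] com_algD(2)[OF y *] by auto
    then show "(x + y) * S = S * (x + y)"
      using add_mult_distrib_mat[OF c[OF x] c[OF y] *(2)] mult_add_distrib_mat[OF *(2) c[OF x] c[OF y]] by simp
  qed (use c[OF x] c[OF y] in auto)
  show "x * y \<in> com_alg n \<rho>"
  proof (rule com_algI)
    fix g S R assume *: "g \<in> P" "S \<in> carrier_mat n n" "R \<in> carrier_mat n n" "S * R = 1\<^sub>m n" "R * S = 1\<^sub>m n"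
      "\<And>h. h \<in> N \<Longrightarrow> S * conj_rep G g \<rho> h = \<rho> h * S"
    have e: "x * S = S * x" "y * S = S * y"
      using com_algD(2)[OF x *] com_algD(2)[OF y *] by auto
    have "x * y * S = x * (y * S)" by (rule assoc_mult_mat[OF c[OF x] c[OF y] *(2)])
    also have "\<dots> = (x * S) * y"
      unfolding e(2) by (rule assoc_mult_mat[OF c[OF x] *(2) c[OF y], symmetric])
    also have "\<dots> = S * (x * y)"
      unfolding e(1) by (rule assoc_mult_mat[OF *(2) c[OF x] c[OF y]])
    finally show "x * y * S = S * (x * y)" .
  qed (use c[OF x] c[OF y] in auto)
  show "t \<cdot>\<^sub>m x \<in> com_alg n \<rho>" for t
  proof (rule com_algI)
    fix g S R assume *: "g \<in> P" "S \<in> carrier_mat n n" "R \<in> carrier_mat n n" "S * R = 1\<^sub>m n" "R * S = 1\<^sub>m n"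
      "\<And>h. h \<in> N \<Longrightarrow> S * conj_rep G g \<rho> h = \<rho> h * S"
    show "t \<cdot>\<^sub>m x * S = S * (t \<cdot>\<^sub>m x)"
      using mult_smult_assoc_mat[OF c[OF x] *(2)] mult_smult_distrib[OF *(2) c[OF x]] com_algD(2)[OF x *] by simp
  qed (use c[OF x] in auto)
  show "t \<cdot>\<^sub>m x * y = t \<cdot>\<^sub>m (x * y)" "x * (t \<cdot>\<^sub>m y) = t \<cdot>\<^sub>m (x * y)" for t
    using mult_smult_assoc_mat[OF c[OF x] c[OF y]] mult_smult_distrib[OF c[OF x] c[OF y]] by auto
  show "1\<^sub>m n * x = x" "x * 1\<^sub>m n = x" using c[OF x] by auto
  fix z assume z: "z \<in> com_alg n \<rho>"
  show "x * y * z = x * (y * z)" using c[OF x] c[OF y] c[OF z] by simp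
  show "x * (y + z) = x * y + x * z" by (rule mult_add_distrib_mat[OF c[OF x] c[OF y] c[OF z]])
  show "(x + y) * z = x * z + y * z" by (rule add_mult_distrib_mat[OF c[OF x] c[OF y] c[OF z]])
qed (auto intro!: com_algI)

text \<open>An isomorphism S from a P-conjugate of M to M intertwines the two actions of b, and
  these are given by the same matrix.\<close>

lemma hat_in_com_alg:
  assumes \<rho>: "is_rep G N n \<rho>" and b: "b \<in> fixed_alg"
  shows "hat n \<rho> b \<in> com_alg n \<rho>"
proof (rule com_algI)
  fix x S R assume x: "x \<in> P" and S: "S \<in> carrier_mat n n"
    and c: "\<And>h. h \<in> N \<Longrightarrow> S * conj_rep G x \<rho> h = \<rho> h * S"
  have "S * hat n (conj_rep G x \<rho>) b = hat n \<rho> b * S"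
    using x by (intro hat_intertwine[OF conj_rep_is_rep[OF \<rho>] \<rho> S c]) auto
  then show "hat n \<rho> b * S = S * hat n \<rho> b" using hat_conj_rep_fixed[OF \<rho> x b] by simp
qed simp

text \<open>The coefficients of \<open>fourier n \<rho> A\<close> are multiples of traces of
  \<open>A * \<rho> (inv g)\<close>. Conjugation by x replaces \<open>\<rho>\<close> by its
  conjugate, which is R \<open>\<rho>\<close> S with R inverse to S. Since A commutes with S,
  cyclicity of the trace gives the old value.\<close>

lemma ga_conj_fourier:
  assumes \<rho>: "is_rep G N n \<rho>" and A: "A \<in> com_alg n \<rho>" and x: "x \<in> P"
    and iso: "rep_iso N n (conj_rep G x \<rho>) \<rho>"
  shows "ga_conj G x (fourier n \<rho> A) = fourier n \<rho> A"
proof (rule group_alg_eqI)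
  from iso obtain S R where S: "S \<in> carrier_mat n n" and R: "R \<in> carrier_mat n n"
    and SR: "S * R = 1\<^sub>m n" "R * S = 1\<^sub>m n" and c: "\<And>h. h \<in> N \<Longrightarrow> S * conj_rep G x \<rho> h = \<rho> h * S"
    unfolding rep_iso_def by blast
  note Ac = com_algD(1)[OF A]
  have AS: "A * S = S * A" by (rule com_algD(2)[OF A x S R SR c])
  have tr: "mtrace (A * conj_rep G x \<rho> h) = mtrace (A * \<rho> h)" if h: "h \<in> N" for h
  proof -
    have \<rho>h: "\<rho> h \<in> carrier_mat n n" using is_repD(1)[OF \<rho> h] .
    have \<rho>h': "conj_rep G x \<rho> h \<in> carrier_mat n n"
      using is_repD(1)[OF conj_rep_is_rep[OF \<rho>], of x h] x h by simp
    have "conj_rep G x \<rho> h = R * (S * conj_rep G x \<rho> h)"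
      using assoc_mult_mat[OF R S \<rho>h'] SR \<rho>h' by simp
    then have "A * conj_rep G x \<rho> h = A * (R * (\<rho> h * S))" using c[OF h] by simp
    also have "\<dots> = (A * R * \<rho> h) * S"
      using assoc_mult_mat[OF mult_carrier_mat[OF Ac R] \<rho>h S] assoc_mult_mat[OF Ac R mult_carrier_mat[OF \<rho>h S]]
      by simp
    finally have "mtrace (A * conj_rep G x \<rho> h) = mtrace (S * (A * R * \<rho> h))"
      using mtrace_comm[OF mult_carrier_mat[OF mult_carrier_mat[OF Ac R] \<rho>h] S] by simp
    also have "S * (A * R * \<rho> h) = (S * A) * (R * \<rho> h)"
      using assoc_mult_mat[OF Ac R \<rho>h] assoc_mult_mat[OF S Ac mult_carrier_mat[OF R \<rho>h]] by simp
    also have "\<dots> = A * ((S * R) * \<rho> h)"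
      unfolding AS[symmetric] using assoc_mult_mat[OF S R \<rho>h] assoc_mult_mat[OF Ac S mult_carrier_mat[OF R \<rho>h]]
      by simp
    also have "\<dots> = A * \<rho> h" using SR \<rho>h by simp
    finally show ?thesis .
  qed
  fix g assume g: "g \<in> carrier G"
  show "ga_conj G x (fourier n \<rho> A) g = fourier n \<rho> A g"
  proof (cases "g \<in> N")
    case True
    have "inv (inv x \<otimes> g \<otimes> x) = inv x \<otimes> inv g \<otimes> x"
      using g x by (simp add: inv_mult_group m_assoc)
    then show ?thesis
      using True g x conj_N'[OF P.mem_carrier[OF x] True] tr[OF N.m_inv_closed[OF True]]
      by (simp add: ga_conj_def fourier_def conj_rep_def)
  next
    case False
    then show ?thesis using g x conj_mem_N_iff[of x g] by (simp add: ga_conj_def fourier_def)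
  qed
qed (simp_all add: supp_in)

text \<open>For A in \<open>com_alg n \<rho>\<close> this is the relative trace from T_P(M) to P.
  The sum runs over the set of distinct conjugates: summing over all of P would multiply it by the
  order of a stabilizer, a power of p, which is zero in k unless the stabilizer is trivial.\<close>

definition lift :: "nat \<Rightarrow> ('a \<Rightarrow> 'k mat) \<Rightarrow> 'k mat \<Rightarrow> 'a \<Rightarrow> 'k" where
  "lift n \<rho> A = \<Sum>((\<lambda>y. ga_conj G y (fourier n \<rho> A)) ` P)"

lemma ga_conj_supp:
  assumes y: "y \<in> carrier G" and a: "a \<in> supp_on N"
  shows "ga_conj G y a \<in> supp_on N"
  unfolding supp_on_def
proof (intro CollectI allI impI)
  fix g assume g: "g \<notin> N"
  show "ga_conj G y a g = 0"
  proof (cases "g \<in> carrier G")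
    case True
    then have "inv y \<otimes> g \<otimes> y \<notin> N" using g y conj_mem_N_iff by simp
    then show ?thesis using a by (simp add: ga_conj_def supp_on_def)
  qed (simp add: ga_conj_def)
qed

lemma ga_conj_sum: "ga_conj G x (sum f I) = (\<Sum>i\<in>I. ga_conj G x (f i))"
  by (induction I rule: infinite_finite_induct)
    (simp_all only: sum.infinite sum.empty sum.insert ga_conj_zero ga_conj_add not_False_eq_True)

text \<open>Conjugation by an element of P permutes the set of conjugates being summed.\<close>

lemma lift_in:
  shows "lift n \<rho> A \<in> fixed_alg"
proof -
  let ?a = "fourier n \<rho> A"
  let ?O = "(\<lambda>y. ga_conj G y ?a) ` P"
  have conj: "ga_conj G x (lift n \<rho> A) = lift n \<rho> A" if x: "x \<in> P" for x
  proof -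
    have inj: "inj_on (ga_conj G x) ?O"
    proof (rule inj_on_inverseI[where g = "ga_conj G (inv x)"])
      fix a assume "a \<in> ?O"
      then obtain y where "y \<in> P" "a = ga_conj G y ?a" by blast
      then show "ga_conj G (inv x) (ga_conj G x a) = a"
        using x by (simp add: ga_conj_conj m_assoc[symmetric])
    qed
    have img: "ga_conj G x ` ?O \<subseteq> ?O"
    proof
      fix b assume "b \<in> ga_conj G x ` ?O"
      then obtain y where y: "y \<in> P" "b = ga_conj G x (ga_conj G y ?a)" by blast
      then have "b = ga_conj G (x \<otimes> y) ?a" using x by (simp add: ga_conj_conj)
      then show "b \<in> ?O" using x y by blast
    qed
    have "ga_conj G x ` ?O = ?O"
      using card_image[OF inj] img by (intro card_subset_eq) auto
    then have "lift n \<rho> A = \<Sum>(ga_conj G x ` ?O)" by (simp only: lift_def)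
    also have "\<dots> = (\<Sum>b\<in>?O. ga_conj G x b)" using sum.reindex[OF inj, of "\<lambda>b. b"] by simp
    also have "\<dots> = ga_conj G x (lift n \<rho> A)" unfolding lift_def by (rule ga_conj_sum[symmetric])
    finally show ?thesis by (rule sym)
  qed
  have "lift n \<rho> A \<in> supp_on N"
  proof -
    have "lift n \<rho> A g = 0" if "g \<notin> N" for g
    proof -
      have *: "\<forall>b\<in>?O. b g = 0"
        using ga_conj_supp[OF P.mem_carrier fourier_supp] that by (auto simp: supp_on_def)
      have sum: "(\<Sum>F) g = (\<Sum>b\<in>F. b g)" for F :: "('a \<Rightarrow> 'k) set"
        by (induction F rule: infinite_finite_induct) auto
      show ?thesis unfolding lift_def sum by (rule sum.neutral[OF *])
    qed
    then show ?thesis by (simp add: supp_on_def)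
  qed
  then show ?thesis using conj supp_in by (simp add: fixed_alg_def centralizer_alg_def)
qed

lemma hat_sum:
  assumes \<rho>: "is_rep G N n \<rho>" and ij: "i < n" "j < n"
  shows "hat n \<rho> (sum f I) $$ (i,j) = (\<Sum>t\<in>I. hat n \<rho> (f t) $$ (i,j))"
proof (induction I rule: infinite_finite_induct)
  case (infinite I)
  then show ?case using ij by (simp only: sum.infinite[OF infinite(1)] hat_zero[OF \<rho>]) simp
next
  case empty
  then show ?case using ij by (simp only: sum.empty hat_zero[OF \<rho>]) simp
next
  case (insert t I)
  have "hat n \<rho> (f t + sum f I) $$ (i,j) = hat n \<rho> (f t) $$ (i,j) + hat n \<rho> (sum f I) $$ (i,j)"
    unfolding hat_add[OF \<rho>] using ij by simp
  then show ?case using insert by (simp only: sum.insert not_False_eq_True)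
qed

text \<open>A label for the P-orbit of the isomorphism class of \<open>\<rho>\<close>: it is
  unchanged under isomorphism and under conjugation by P. As a subset of kG it can be compared
  between modules of different dimensions.\<close>

definition ker :: "nat \<Rightarrow> ('a \<Rightarrow> 'k mat) \<Rightarrow> ('a \<Rightarrow> 'k) set" where
  "ker n \<rho> = {b \<in> fixed_alg. hat n \<rho> b = 0\<^sub>m n n}"

lemma ker_iso:
  assumes \<rho>: "is_rep G N n \<rho>" and \<sigma>: "is_rep G N n \<sigma>" and iso: "rep_iso N n \<rho> \<sigma>"
  shows "ker n \<rho> = ker n \<sigma>"
proof -
  from iso obtain S R where S: "S \<in> carrier_mat n n" and R: "R \<in> carrier_mat n n"
    and SR: "S * R = 1\<^sub>m n" "R * S = 1\<^sub>m n" and c: "\<And>h. h \<in> N \<Longrightarrow> S * \<rho> h = \<sigma> h * S"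
    unfolding rep_iso_def by blast
  have e: "S * hat n \<rho> b = hat n \<sigma> b * S" for b by (rule hat_intertwine[OF \<rho> \<sigma> S c])
  have "hat n \<sigma> b = 0\<^sub>m n n" if "hat n \<rho> b = 0\<^sub>m n n" for b
  proof -
    have "hat n \<sigma> b = hat n \<sigma> b * S * R"
      using assoc_mult_mat[OF hat_carrier S R, of \<sigma> b] SR by simp
    also have "\<dots> = S * hat n \<rho> b * R" by (simp only: e)
    finally show ?thesis using S R that by simp
  qed
  moreover have "hat n \<rho> b = 0\<^sub>m n n" if "hat n \<sigma> b = 0\<^sub>m n n" for b
  proof -
    have "hat n \<rho> b = R * (S * hat n \<rho> b)"
      using assoc_mult_mat[OF R S hat_carrier, of \<rho> b] SR by simp
    also have "\<dots> = R * (hat n \<sigma> b * S)" by (simp only: e)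
    finally show ?thesis using S R that by simp
  qed
  ultimately show ?thesis unfolding ker_def by blast
qed

lemma ker_conj:
  assumes "is_rep G N n \<rho>" "y \<in> P"
  shows "ker n (conj_rep G y \<rho>) = ker n \<rho>"
  unfolding ker_def using hat_conj_rep_fixed[OF assms] by auto

text \<open>If some conjugate of the Fourier element acted nontrivially on \<open>\<sigma>\<close>,
  then \<open>\<rho>\<close> would be isomorphic to a P-conjugate of \<open>\<sigma>\<close>, and
  the two labels \<open>ker\<close> would agree.\<close>

lemma hat_lift_other:
  assumes \<rho>: "irr n \<rho>" and \<sigma>: "irr m \<sigma>" and A: "A \<in> carrier_mat n n" and ne: "ker m \<sigma> \<noteq> ker n \<rho>"
  shows "hat m \<sigma> (lift n \<rho> A) = 0\<^sub>m m m"
proof (rule eq_matI)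
  fix i j assume "i < dim_row (0\<^sub>m m m :: 'k mat)" "j < dim_col (0\<^sub>m m m :: 'k mat)"
  then have ij: "i < m" "j < m" by auto
  note \<rho>r = irreducible_repD(1)[OF \<rho>] and \<sigma>r = irreducible_repD(1)[OF \<sigma>]
  have "hat m \<sigma> (ga_conj G y (fourier n \<rho> A)) = 0\<^sub>m m m" if y: "y \<in> P" for y
  proof -
    have irr: "irr m (conj_rep G (inv y) \<sigma>)" using y by (intro conj_rep_irr \<sigma>) auto
    have "\<not> (m = n \<and> rep_iso N n \<rho> (conj_rep G (inv y) \<sigma>))"
    proof
      assume *: "m = n \<and> rep_iso N n \<rho> (conj_rep G (inv y) \<sigma>)"
      then have "ker n \<rho> = ker n (conj_rep G (inv y) \<sigma>)"
        using irreducible_repD(1)[OF irr] by (intro ker_iso \<rho>r) auto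
      then show False using ne ker_conj[OF \<sigma>r P.m_inv_closed[OF y]] * by simp
    qed
    from hat_fourier_other[OF irr \<rho> A this]
    show ?thesis using y by (simp add: hat_conj[OF \<sigma>r])
  qed
  then have "hat m \<sigma> b $$ (i,j) = 0" if "b \<in> (\<lambda>y. ga_conj G y (fourier n \<rho> A)) ` P" for b
    using that ij by auto
  then show "hat m \<sigma> (lift n \<rho> A) $$ (i,j) = 0\<^sub>m m m $$ (i,j)"
    using ij unfolding lift_def by (simp add: hat_sum[OF \<sigma>r ij])
qed auto

text \<open>A conjugate by y acting nontrivially on \<open>\<rho>\<close> forces y into the inertia
  group, where \<open>ga_conj_fourier\<close> says that conjugation changes nothing. So the Fourier
  element itself is the only summand that contributes, and it is counted once.\<close>

lemma hat_lift:
  assumes \<rho>: "irr n \<rho>" and A: "A \<in> com_alg n \<rho>"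
  shows "hat n \<rho> (lift n \<rho> A) = A"
proof (rule eq_matI)
  note \<rho>r = irreducible_repD(1)[OF \<rho>] and Ac = com_algD(1)[OF A]
  let ?a = "fourier n \<rho> A"
  fix i j assume "i < dim_row A" "j < dim_col A"
  then have ij: "i < n" "j < n" using Ac by auto
  let ?O = "(\<lambda>y. ga_conj G y ?a) ` P"
  have "ga_conj G \<one> ?a = ?a"
    using supp_in[OF fourier_supp] by (simp add: ga_conj_eq)
  then have aO: "?a \<in> ?O" by (metis P.one_closed image_eqI)
  have "hat n \<rho> b = (if b = ?a then A else 0\<^sub>m n n)" if b: "b \<in> ?O" for b
  proof (cases "b = ?a")
    case False
    from b obtain y where y: "y \<in> P" "b = ga_conj G y ?a" by blast
    have irr: "irr n (conj_rep G (inv y) \<rho>)" using y by (intro conj_rep_irr \<rho>) auto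
    have "\<not> rep_iso N n \<rho> (conj_rep G (inv y) \<rho>)"
    proof
      assume "rep_iso N n \<rho> (conj_rep G (inv y) \<rho>)"
      then obtain S R where S: "S \<in> carrier_mat n n" "R \<in> carrier_mat n n" "S * R = 1\<^sub>m n" "R * S = 1\<^sub>m n"
        and c: "\<And>h. h \<in> N \<Longrightarrow> S * \<rho> h = conj_rep G (inv y) \<rho> h * S"
        unfolding rep_iso_def by blast
      have "S * conj_rep G y \<rho> h = \<rho> h * S" if h: "h \<in> N" for h
      proof -
        have "y \<otimes> (inv y \<otimes> h \<otimes> y) \<otimes> inv y = h"
          using y h by (simp add: m_assoc) (simp add: m_assoc[symmetric])
        then show ?thesis
          using c[OF conj_N'[OF P.mem_carrier[OF y(1)] h]] y by (simp add: conj_rep_def)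
      qed
      then have "rep_iso N n (conj_rep G y \<rho>) \<rho>" unfolding rep_iso_def using S by blast
      then show False using ga_conj_fourier[OF \<rho>r A y(1)] y(2) False by simp
    qed
    then have "hat n (conj_rep G (inv y) \<rho>) ?a = 0\<^sub>m n n"
      by (intro hat_fourier_other[OF irr \<rho> Ac]) simp
    then show ?thesis using False y by (simp add: hat_conj[OF \<rho>r])
  qed (simp add: hat_fourier[OF \<rho> Ac])
  then have "hat n \<rho> (lift n \<rho> A) $$ (i,j) = (\<Sum>b\<in>?O. if b = ?a then A $$ (i,j) else 0)"
    unfolding lift_def hat_sum[OF \<rho>r ij] using ij by (intro sum.cong) auto
  then show "hat n \<rho> (lift n \<rho> A) $$ (i,j) = A $$ (i,j)"
    using aO by (simp add: sum.delta)
qed (use com_algD(1)[OF A] in auto)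

end

section \<open>Semisimplicity of $kN$\<close>

lemma vector_space_ga_smult: "vector_space (ga_smult :: 'k::field \<Rightarrow> ('g \<Rightarrow> 'k) \<Rightarrow> 'g \<Rightarrow> 'k)"
  by unfold_locales (auto simp: ga_smult_def fun_eq_iff algebra_simps)

context p_nilpotent_group
begin

interpretation VS: vector_space "ga_smult :: 'k \<Rightarrow> ('a \<Rightarrow> 'k) \<Rightarrow> 'a \<Rightarrow> 'k"
  by (rule vector_space_ga_smult)

lemma supp_on_decomp:
  assumes "a \<in> supp_on N"
  shows "a = (\<Sum>h\<in>N. ga_smult (a h) (delta h))"
proof
  fix g
  have "(\<Sum>h\<in>H. ga_smult (a h) (delta h)) g = (\<Sum>h\<in>H. if h = g then a h else 0)" for H
    by (induction H rule: infinite_finite_induct) (auto simp: ga_smult_apply delta_apply)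
  then show "a g = (\<Sum>h\<in>N. ga_smult (a h) (delta h)) g"
    using assms by (simp add: sum.delta supp_on_def)
qed

lemma supp_on_span: "supp_on N \<subseteq> VS.span (delta ` N)"
proof
  fix a :: "'a \<Rightarrow> 'k" assume "a \<in> supp_on N"
  then have "a = (\<Sum>h\<in>N. ga_smult (a h) (delta h))" by (rule supp_on_decomp)
  also have "\<dots> \<in> VS.span (delta ` N)" by (intro VS.span_sum VS.span_scale VS.span_base) auto
  finally show "a \<in> VS.span (delta ` N)" .
qed

text \<open>The space of all functions on the type may have infinite dimension; this gives the
  finite dimension of kN, on which the choice of bases and of minimal ideals rests.\<close>

lemma independent_supp_on:
  assumes "VS.independent B" "B \<subseteq> supp_on N"
  shows "finite B"
  using VS.independent_span_bound[OF _ assms(1), of "delta ` N"] assms(2) supp_on_span by auto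

lemma mult_supp_on:
  assumes "b \<in> supp_on N"
  shows "ga_mult G b v = (\<Sum>h\<in>N. ga_smult (b h) (ga_mult G (delta h) v))"
  by (subst supp_on_decomp[OF assms]) (simp only: ga_mult_sum_left ga_mult_smultl)

definition left_ideal :: "('a \<Rightarrow> 'k) set \<Rightarrow> bool" where
  "left_ideal L \<longleftrightarrow> VS.subspace L \<and> L \<subseteq> supp_on N \<and> (\<forall>h\<in>N. \<forall>b\<in>L. ga_mult G (delta h) b \<in> L)"

text \<open>A nonzero left ideal of least dimension inside J. A proper subideal has smaller
  dimension, since a basis of it stays independent after adding a vector of L outside it.\<close>

lemma minimal_left_ideal:
  assumes J: "left_ideal J" "J \<noteq> {0}"
  shows "\<exists>L. left_ideal L \<and> L \<subseteq> J \<and> L \<noteq> {0} \<and> (\<forall>L'. left_ideal L' \<and> L' \<subseteq> L \<and> L' \<noteq> {0} \<longrightarrow> L' = L)"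
proof -
  let ?Q = "\<lambda>L. left_ideal L \<and> L \<subseteq> J \<and> L \<noteq> {0}"
  have "?Q J" using J by simp
  from ex_has_least_nat[of ?Q, OF this, of VS.dim]
  obtain L where L: "?Q L" and least: "\<And>L'. ?Q L' \<Longrightarrow> VS.dim L \<le> VS.dim L'" by blast
  have "L' = L" if L': "left_ideal L'" "L' \<subseteq> L" "L' \<noteq> {0}" for L'
  proof (rule ccontr)
    assume "L' \<noteq> L"
    then obtain v where v: "v \<in> L" "v \<notin> L'" using L' by blast
    obtain B' where B': "B' \<subseteq> L'" "VS.independent B'" "card B' = VS.dim L'" using VS.basis_exists by metis
    obtain B where B: "B \<subseteq> L" "VS.independent B" "L \<subseteq> VS.span B" "card B = VS.dim L"
      using VS.basis_exists by metis
    have supp: "L \<subseteq> supp_on N" using L by (simp add: left_ideal_def)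
    have finB: "finite B" using B supp by (intro independent_supp_on) auto
    have finB': "finite B'" using B' supp L' by (intro independent_supp_on) auto
    have "VS.span B' \<subseteq> L'"
      using L'(1) B'(1) by (intro VS.span_minimal) (auto simp: left_ideal_def)
    then have "VS.independent (insert v B')" using v B'(2) by (intro VS.independent_insertI) auto
    moreover have "insert v B' \<subseteq> VS.span B" using v B'(1) L'(2) B(3) by blast
    ultimately have "card (insert v B') \<le> card B" using VS.independent_span_bound[OF finB] by blast
    moreover have "v \<notin> B'" using v B'(1) by blast
    ultimately have "Suc (VS.dim L') \<le> VS.dim L" using finB' B(4) B'(3) by simp
    moreover have "VS.dim L \<le> VS.dim L'" using L L' by (intro least) auto
    ultimately show False by simp
  qed
  then show ?thesis using L by blast
qed

text \<open>Left multiplication on L, written in coordinates with respect to a basis, is a matrix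
  representation, and minimality of L is its irreducibility. The last clause is what remains of the
  identification with L: an element acting as the zero matrix annihilates L.\<close>

lemma minimal_left_ideal_rep:
  assumes L: "left_ideal L" "L \<noteq> {0}"
    and min: "\<And>L'. left_ideal L' \<Longrightarrow> L' \<subseteq> L \<Longrightarrow> L' \<noteq> {0} \<Longrightarrow> L' = L"
  shows "\<exists>n \<rho>. irr n \<rho> \<and> (\<forall>b\<in>supp_on N. hat n \<rho> b = 0\<^sub>m n n \<longrightarrow> (\<forall>v\<in>L. ga_mult G b v = 0))"
proof -
  have sub: "VS.subspace L" and supp: "L \<subseteq> supp_on N"
    and act: "\<And>h v. h \<in> N \<Longrightarrow> v \<in> L \<Longrightarrow> ga_mult G (delta h) v \<in> L"
    using L(1) by (auto simp: left_ideal_def)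
  obtain B where B: "B \<subseteq> L" "VS.independent B" "L \<subseteq> VS.span B" using VS.basis_exists by metis
  have finB: "finite B" using B supp by (intro independent_supp_on) auto
  have span: "VS.span B = L" using B sub VS.span_minimal by blast
  obtain bs where bs: "set bs = B" "distinct bs" using finite_distinct_list[OF finB] by blast
  define n where "n = length bs"
  have bij: "bij_betw (\<lambda>i. bs ! i) {..<n} B" using bij_betw_nth[OF bs(2)] bs(1) n_def by auto
  have bsL: "bs ! i \<in> L" if "i < n" for i using that bs B(1) n_def nth_mem by blast
  define R where "R = VS.representation B"
  define co where "co v = vec n (\<lambda>i. R v (bs ! i))" for v
  have co_carrier [simp]: "co v \<in> carrier_vec n" "dim_vec (co v) = n" for v by (auto simp: co_def)
  have co_index [simp]: "i < n \<Longrightarrow> co v $ i = R v (bs ! i)" for v i by (simp add: co_def)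
  have R_sum: "R (\<Sum>i\<in>I. ga_smult (c i) (f i)) b = (\<Sum>i\<in>I. c i * R (f i) b)"
    if "\<And>i. i \<in> I \<Longrightarrow> f i \<in> L" for I :: "'i set" and c f b
    using that VS.representation_sum[OF B(2), of I "\<lambda>i. ga_smult (c i) (f i)"]
      VS.representation_scale[OF B(2)] VS.subspace_scale[OF sub]
    unfolding R_def span by simp
  have recon: "v = (\<Sum>i<n. ga_smult (R v (bs ! i)) (bs ! i))" if "v \<in> L" for v
  proof -
    have "(\<Sum>b\<in>B. ga_smult (R v b) b) = v"
      unfolding R_def using that span finB B(2) by (intro VS.sum_representation_eq) auto
    then show ?thesis using sum.reindex_bij_betw[OF bij, of "\<lambda>b. ga_smult (R v b) b"] by simp
  qed
  have co_inj: "v = w" if "v \<in> L" "w \<in> L" "co v = co w" for v w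
  proof -
    have "R v (bs ! i) = R w (bs ! i)" if "i < n" for i
      using arg_cong[OF \<open>co v = co w\<close>, of "\<lambda>u. u $ i"] that by simp
    then have "(\<Sum>i<n. ga_smult (R v (bs ! i)) (bs ! i)) = (\<Sum>i<n. ga_smult (R w (bs ! i)) (bs ! i))"
      by (intro sum.cong) auto
    then show ?thesis using recon that(1,2) by simp
  qed
  have co_surj: "\<exists>v\<in>L. co v = w" if w: "w \<in> carrier_vec n" for w
  proof (intro bexI)
    show "(\<Sum>i<n. ga_smult (w $ i) (bs ! i)) \<in> L"
      using bsL by (intro VS.subspace_sum[OF sub] VS.subspace_scale[OF sub]) auto
    show "co (\<Sum>i<n. ga_smult (w $ i) (bs ! i)) = w"
    proof (rule eq_vecI)
      fix j assume "j < dim_vec w"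
      then have j: "j < n" using w by simp
      have "R (bs ! i) (bs ! j) = (if i = j then 1 else 0)" if "i < n" for i
        using that j bs n_def VS.representation_basis[OF B(2), of "bs ! i"] nth_eq_iff_index_eq[OF bs(2)]
        unfolding R_def by (auto dest: nth_mem)
      then have "(\<Sum>i<n. w $ i * R (bs ! i) (bs ! j)) = (\<Sum>i<n. if i = j then w $ i else 0)"
        by (intro sum.cong) auto
      then show "co (\<Sum>i<n. ga_smult (w $ i) (bs ! i)) $ j = w $ j"
        using j bsL R_sum[of "{..<n}" "\<lambda>i. bs ! i" "\<lambda>i. w $ i" "bs ! j"] by simp
    qed (use w in simp)
  qed
  define \<rho> where "\<rho> h = mat n n (\<lambda>(i,j). R (ga_mult G (delta h) (bs ! j)) (bs ! i))" for h
  have \<rho>_carrier: "\<rho> h \<in> carrier_mat n n" for h by (simp add: \<rho>_def)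
  have \<rho>_co: "\<rho> h *\<^sub>v co v = co (ga_mult G (delta h) v)" if h: "h \<in> N" and v: "v \<in> L" for h v
  proof (rule eq_vecI)
    fix i assume "i < dim_vec (co (ga_mult G (delta h) v))"
    then have i: "i < n" by simp
    have "ga_mult G (delta h) v = (\<Sum>j<n. ga_smult (R v (bs ! j)) (ga_mult G (delta h) (bs ! j)))"
      using arg_cong[OF recon[OF v], of "ga_mult G (delta h)"] by (simp only: ga_mult_sum_right ga_mult_smultr)
    then have "co (ga_mult G (delta h) v) $ i = (\<Sum>j<n. R v (bs ! j) * R (ga_mult G (delta h) (bs ! j)) (bs ! i))"
      using i R_sum[of "{..<n}" "\<lambda>j. ga_mult G (delta h) (bs ! j)"] act[OF h bsL] by simp
    then show "(\<rho> h *\<^sub>v co v) $ i = co (ga_mult G (delta h) v) $ i"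
      using i by (simp add: \<rho>_def scalar_prod_def atLeast0LessThan mult.commute)
  qed (simp add: \<rho>_def)
  have Lin: "v \<in> group_alg G" if "v \<in> L" for v using that supp supp_in by blast
  have zero_L: "0 \<in> L" using VS.subspace_0[OF sub] .
  have co_0: "co 0 = 0\<^sub>v n"
    unfolding co_def R_def by (intro eq_vecI) (simp_all add: VS.representation_zero)
  have rep: "is_rep G N n \<rho>"
    unfolding is_rep_def
  proof (intro conjI ballI)
    show "\<rho> \<one> = 1\<^sub>m n"
    proof (rule mat_eqI_mult_vec[OF \<rho>_carrier])
      fix w :: "'k vec" assume w: "w \<in> carrier_vec n"
      then obtain v where "v \<in> L" "co v = w" using co_surj by blast
      then show "\<rho> \<one> *\<^sub>v w = 1\<^sub>m n *\<^sub>v w" using \<rho>_co[of \<one> v] Lin w by simp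
    qed simp
    fix g h assume gh: "g \<in> N" "h \<in> N"
    show "\<rho> (g \<otimes> h) = \<rho> g * \<rho> h"
    proof (rule mat_eqI_mult_vec[OF \<rho>_carrier])
      fix w :: "'k vec" assume w: "w \<in> carrier_vec n"
      then obtain v where v: "v \<in> L" "co v = w" using co_surj by blast
      have "\<rho> (g \<otimes> h) *\<^sub>v w = co (ga_mult G (delta g) (ga_mult G (delta h) v))"
        using gh v \<rho>_co[of "g \<otimes> h" v] by (simp add: ga_mult_assoc[symmetric] delta_mult_delta)
      also have "\<dots> = \<rho> g *\<^sub>v (\<rho> h *\<^sub>v w)" using gh v by (simp add: \<rho>_co[OF gh(1)] \<rho>_co[OF gh(2)] act v(2)[symmetric])
      also have "\<dots> = (\<rho> g * \<rho> h) *\<^sub>v w" by (rule assoc_mult_mat_vec[OF \<rho>_carrier \<rho>_carrier w, symmetric])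
      finally show "\<rho> (g \<otimes> h) *\<^sub>v w = (\<rho> g * \<rho> h) *\<^sub>v w" .
    qed (rule mult_carrier_mat[OF \<rho>_carrier \<rho>_carrier])
  qed (rule \<rho>_carrier)
  have "n > 0"
  proof (rule ccontr)
    assume "\<not> n > 0"
    then have "v = 0" if "v \<in> L" for v using recon[OF that] by simp
    then show False using L(2) zero_L by blast
  qed
  have irr: "irr n \<rho>"
    unfolding irreducible_rep_def
  proof (intro conjI rep \<open>n > 0\<close> allI impI)
    fix W assume W: "subspace_vec n W \<and> (\<forall>h\<in>N. \<forall>w\<in>W. \<rho> h *\<^sub>v w \<in> W)"
    let ?L = "{v \<in> L. co v \<in> W}"
    have Wc: "W \<subseteq> carrier_vec n" "0\<^sub>v n \<in> W" "\<And>v w. v \<in> W \<Longrightarrow> w \<in> W \<Longrightarrow> v + w \<in> W"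
      "\<And>c w. w \<in> W \<Longrightarrow> c \<cdot>\<^sub>v w \<in> W" using W by (auto simp: subspace_vec_def)
    have co_add: "co (v + w) = co v + co w" if "v \<in> L" "w \<in> L" for v w
      using that VS.representation_add[OF B(2)] unfolding R_def co_def span by (intro eq_vecI) auto
    have co_smult: "co (ga_smult c v) = c \<cdot>\<^sub>v co v" if "v \<in> L" for c v
      using that VS.representation_scale[OF B(2)] unfolding R_def co_def span by (intro eq_vecI) auto
    have "VS.subspace ?L"
      using Wc sub co_0 zero_L
      by (intro VS.subspaceI) (auto simp: co_add co_smult VS.subspace_add VS.subspace_scale)
    moreover have "ga_mult G (delta h) v \<in> ?L" if "h \<in> N" "v \<in> ?L" for h v
      using that act \<rho>_co[of h v, symmetric] W by auto
    ultimately have li: "left_ideal ?L" using supp unfolding left_ideal_def by blast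
    show "W = {0\<^sub>v n} \<or> W = carrier_vec n"
    proof (cases "?L = {0}")
      case True
      have "w = 0\<^sub>v n" if w: "w \<in> W" for w
      proof -
        obtain v where v: "v \<in> L" "co v = w" using co_surj[of w] w Wc(1) by blast
        then have "v \<in> ?L" using w by simp
        then have "v = 0" using True by blast
        then show ?thesis using v co_0 by simp
      qed
      then show ?thesis using Wc(2) by blast
    next
      case False
      then have eq: "?L = L" using li by (intro min) auto
      have "w \<in> W" if w: "w \<in> carrier_vec n" for w
      proof -
        obtain v where v: "v \<in> L" "co v = w" using co_surj[OF w] by blast
        then show ?thesis using eq by blast
      qed
      then show ?thesis using Wc(1) by blast
    qed
  qed
  have "ga_mult G b v = 0" if b: "b \<in> supp_on N" "hat n \<rho> b = 0\<^sub>m n n" and v: "v \<in> L" for b v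
  proof (rule co_inj)
    show "ga_mult G b v \<in> L"
      unfolding mult_supp_on[OF b(1)] using act v by (intro VS.subspace_sum[OF sub] VS.subspace_scale[OF sub]) auto
    show "co (ga_mult G b v) = co 0"
      unfolding co_0
    proof (rule eq_vecI)
      fix i assume "i < dim_vec (0\<^sub>v n :: 'k vec)"
      then have i: "i < n" by simp
      have "co (ga_mult G b v) $ i = (\<Sum>h\<in>N. b h * R (ga_mult G (delta h) v) (bs ! i))"
        unfolding mult_supp_on[OF b(1)] co_index[OF i] using act v by (intro R_sum) auto
      also have "\<dots> = (\<Sum>h\<in>N. b h * (\<Sum>j\<in>{0..<n}. \<rho> h $$ (i,j) * R v (bs ! j)))"
      proof (rule sum.cong[OF refl])
        fix h assume h: "h \<in> N"
        have "R (ga_mult G (delta h) v) (bs ! i) = (\<rho> h *\<^sub>v co v) $ i" using \<rho>_co[OF h v] i by simp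
        then show "b h * R (ga_mult G (delta h) v) (bs ! i) = b h * (\<Sum>j\<in>{0..<n}. \<rho> h $$ (i,j) * R v (bs ! j))"
          using i by (simp add: scalar_prod_def \<rho>_def)
      qed
      also have "\<dots> = (\<Sum>j\<in>{0..<n}. \<Sum>h\<in>N. b h * \<rho> h $$ (i,j) * R v (bs ! j))"
        by (simp add: sum_distrib_left mult.assoc) (rule sum.swap)
      also have "\<dots> = (\<Sum>j\<in>{0..<n}. hat n \<rho> b $$ (i,j) * R v (bs ! j))"
        using i by (intro sum.cong) (auto simp: hat_index[OF rep] sum_distrib_right)
      also have "\<dots> = 0" using i by (simp add: b(2))
      finally show "co (ga_mult G b v) $ i = 0\<^sub>v n $ i" using i by simp
    qed simp
  qed (rule zero_L)
  then show ?thesis using irr by blast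
qed

text \<open>Maschke's theorem: averaging a linear projection onto L over N makes it kN-linear, hence
  equal to right multiplication by its value at the unit.\<close>

lemma maschke_idempotent:
  assumes L: "left_ideal L"
  shows "\<exists>e\<in>L. \<forall>b\<in>L. ga_mult G b e = b"
proof -
  have sub: "VS.subspace L" and supp: "L \<subseteq> supp_on N"
    and act: "\<And>h v. h \<in> N \<Longrightarrow> v \<in> L \<Longrightarrow> ga_mult G (delta h) v \<in> L"
    using L by (auto simp: left_ideal_def)
  interpret VP: vector_space_pair "ga_smult :: 'k \<Rightarrow> ('a \<Rightarrow> 'k) \<Rightarrow> 'a \<Rightarrow> 'k" "ga_smult :: 'k \<Rightarrow> ('a \<Rightarrow> 'k) \<Rightarrow> 'a \<Rightarrow> 'k" ..
  have "\<exists>\<pi>. \<pi> ` UNIV \<subseteq> L \<and> Vector_Spaces.linear ga_smult ga_smult \<pi> \<and> (\<forall>v\<in>L. \<pi> (id v) = v)"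
    by (rule VP.linear_exists_left_inverse_on[OF VS.linear_id sub]) simp
  then obtain \<pi> where \<pi>: "\<And>v. \<pi> v \<in> L" "Vector_Spaces.linear ga_smult ga_smult \<pi>" "\<And>v. v \<in> L \<Longrightarrow> \<pi> v = v"
    by auto
  have \<pi>_sum: "\<pi> (\<Sum>i\<in>I. ga_smult (c i) (f i)) = (\<Sum>i\<in>I. ga_smult (c i) (\<pi> (f i)))" for I :: "'i set" and c f
    by (simp only: VP.linear_sum[OF \<pi>(2)] VP.linear_scale[OF \<pi>(2)])
  define t where "t = inverse (of_nat (card N) :: 'k)"
  \<comment> \<open>The averaged projection, evaluated at the unit.\<close>
  define e where "e = ga_smult t (\<Sum>h\<in>N. ga_mult G (delta h) (\<pi> (delta (inv h))))"
  have e: "e \<in> L"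
    unfolding e_def using act \<pi>(1) by (intro VS.subspace_scale[OF sub] VS.subspace_sum[OF sub]) auto
  have ge: "ga_mult G (delta g) e = ga_smult t (\<Sum>h\<in>N. ga_mult G (delta h) (\<pi> (ga_mult G (delta (inv h)) (delta g))))"
    if g: "g \<in> N" for g
  proof -
    have "ga_mult G (delta g) e = ga_smult t (\<Sum>h\<in>N. ga_mult G (delta (g \<otimes> h)) (\<pi> (delta (inv (g \<otimes> h) \<otimes> g))))"
    proof -
      have "ga_mult G (delta g) (ga_mult G (delta h) (\<pi> (delta (inv h)))) =
          ga_mult G (delta (g \<otimes> h)) (\<pi> (delta (inv (g \<otimes> h) \<otimes> g)))" if "h \<in> N" for h
        using g that by (simp add: ga_mult_assoc[symmetric] delta_mult_delta inv_mult_group m_assoc)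
      then show ?thesis unfolding e_def by (simp only: ga_mult_smultr ga_mult_sum_right cong: sum.cong)
    qed
    also have "(\<Sum>h\<in>N. ga_mult G (delta (g \<otimes> h)) (\<pi> (delta (inv (g \<otimes> h) \<otimes> g)))) =
        (\<Sum>h\<in>N. ga_mult G (delta h) (\<pi> (delta (inv h \<otimes> g))))"
      by (rule sum.reindex_bij_witness[of _ "\<lambda>h. inv g \<otimes> h" "\<lambda>h. g \<otimes> h"])
        (use g in \<open>auto simp: m_assoc[symmetric]\<close>)
    also have "\<dots> = (\<Sum>h\<in>N. ga_mult G (delta h) (\<pi> (ga_mult G (delta (inv h)) (delta g))))"
      using g by (intro sum.cong) (auto simp: delta_mult_delta)
    finally show ?thesis .
  qed
  have "ga_mult G b e = b" if b: "b \<in> L" for b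
  proof -
    have bs: "b \<in> supp_on N" using b supp by blast
    have hb: "ga_mult G (delta (inv h)) b = (\<Sum>g\<in>N. ga_smult (b g) (ga_mult G (delta (inv h)) (delta g)))" for h
      using arg_cong[OF supp_on_decomp[OF bs], of "ga_mult G (delta (inv h))"]
      by (simp only: ga_mult_sum_right ga_mult_smultr)
    have "ga_mult G b e = (\<Sum>g\<in>N. ga_smult (b g) (ga_mult G (delta g) e))" by (rule mult_supp_on[OF bs])
    also have "\<dots> = (\<Sum>g\<in>N. ga_smult (b g) (ga_smult t (\<Sum>h\<in>N. ga_mult G (delta h) (\<pi> (ga_mult G (delta (inv h)) (delta g))))))"
      by (intro sum.cong refl) (simp only: ge)
    also have "\<dots> = (\<Sum>g\<in>N. \<Sum>h\<in>N. ga_smult t (ga_smult (b g) (ga_mult G (delta h) (\<pi> (ga_mult G (delta (inv h)) (delta g))))))"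
      by (simp only: VS.scale_sum_right VS.scale_left_commute[of _ t])
    also have "\<dots> = (\<Sum>h\<in>N. \<Sum>g\<in>N. ga_smult t (ga_smult (b g) (ga_mult G (delta h) (\<pi> (ga_mult G (delta (inv h)) (delta g))))))"
      by (rule sum.swap)
    also have "\<dots> = (\<Sum>h\<in>N. ga_smult t (ga_mult G (delta h) (\<pi> (ga_mult G (delta (inv h)) b))))"
      unfolding hb \<pi>_sum by (simp only: ga_mult_sum_right ga_mult_smultr VS.scale_sum_right)
    also have "\<dots> = (\<Sum>h\<in>N. ga_smult t b)"
    proof (rule sum.cong[OF refl])
      fix h assume h: "h \<in> N"
      have "\<pi> (ga_mult G (delta (inv h)) b) = ga_mult G (delta (inv h)) b"
        using h b act by (intro \<pi>(3)) auto
      moreover have "ga_mult G (delta h) (ga_mult G (delta (inv h)) b) = b"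
        using h supp_in[OF bs] by (simp add: ga_mult_assoc[symmetric] delta_mult_delta)
      ultimately show "ga_smult t (ga_mult G (delta h) (\<pi> (ga_mult G (delta (inv h)) b))) = ga_smult t b" by simp
    qed
    also have "\<dots> = b"
    proof
      fix g
      show "(\<Sum>h\<in>N. ga_smult t b) g = b g"
        using card_N_nonzero by (simp add: t_def ga_smult_apply)
    qed
    finally show ?thesis .
  qed
  then show ?thesis using e by blast
qed

text \<open>The common annihilator J of the irreducible modules is a left ideal. If it were nonzero,
  it would contain a minimal left ideal L, and J, in particular L, would annihilate L. But L has a
  right identity e, so b = b e = 0 for all b in L.\<close>

lemma hat_faithful:
  assumes a: "a \<in> supp_on N" and 0: "\<And>n \<rho>. irr n \<rho> \<Longrightarrow> hat n \<rho> a = 0\<^sub>m n n"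
  shows "a = 0"
proof (rule ccontr)
  assume "a \<noteq> 0"
  let ?J = "{b \<in> supp_on N. \<forall>n \<rho>. irr n \<rho> \<longrightarrow> hat n \<rho> b = 0\<^sub>m n n}"
  have "left_ideal ?J"
    unfolding left_ideal_def
  proof (intro conjI ballI)
    show "VS.subspace ?J"
    proof (rule VS.subspaceI)
      show "0 \<in> ?J" by (simp add: hat_zero[OF irreducible_repD(1)] supp_on_def)
    next
      fix x y assume "x \<in> ?J" "y \<in> ?J"
      then show "x + y \<in> ?J" by (simp add: hat_add[OF irreducible_repD(1)] supp_on_def)
    next
      fix c x assume "x \<in> ?J"
      then show "ga_smult c x \<in> ?J"
        by (simp add: hat_smult[OF irreducible_repD(1)] supp_on_def ga_smult_apply)
    qed
    fix h b assume h: "h \<in> N" and b: "b \<in> ?J"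
    have \<delta>: "delta h \<in> supp_on N" using h by (auto simp: supp_on_def delta_apply)
    have "hat n \<rho> (ga_mult G (delta h) b) = 0\<^sub>m n n" if "irr n \<rho>" for n \<rho>
      unfolding hat_mult[OF irreducible_repD(1)[OF that] \<delta>] using b that by simp
    then show "ga_mult G (delta h) b \<in> ?J"
      using supp_on_mult[OF N.subgroup_axioms \<delta>, of b] b by simp
  qed (rule Collect_restrict)
  moreover have "a \<in> ?J" using a 0 by simp
  then have "?J \<noteq> {0}" using \<open>a \<noteq> 0\<close> by (metis singletonD)
  ultimately have "\<exists>L. left_ideal L \<and> L \<subseteq> ?J \<and> L \<noteq> {0} \<and> (\<forall>L'. left_ideal L' \<and> L' \<subseteq> L \<and> L' \<noteq> {0} \<longrightarrow> L' = L)"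
    by (rule minimal_left_ideal)
  then obtain L where L0: "left_ideal L \<and> L \<subseteq> ?J \<and> L \<noteq> {0} \<and>
      (\<forall>L'. left_ideal L' \<and> L' \<subseteq> L \<and> L' \<noteq> {0} \<longrightarrow> L' = L)" ..
  note L = L0[THEN conjunct1] L0[THEN conjunct2, THEN conjunct1] L0[THEN conjunct2, THEN conjunct2, THEN conjunct1]
  have min: "L' = L" if "left_ideal L'" "L' \<subseteq> L" "L' \<noteq> {0}" for L'
    using L0 that by simp
  have "\<exists>n \<rho>. irr n \<rho> \<and> (\<forall>b\<in>supp_on N. hat n \<rho> b = 0\<^sub>m n n \<longrightarrow> (\<forall>v\<in>L. ga_mult G b v = 0))"
    by (rule minimal_left_ideal_rep[OF L(1,3)]) (rule min)
  then obtain n \<rho> where \<rho>0: "irr n \<rho> \<and> (\<forall>b\<in>supp_on N. hat n \<rho> b = 0\<^sub>m n n \<longrightarrow> (\<forall>v\<in>L. ga_mult G b v = 0))"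
    by (elim exE)
  note \<rho> = \<rho>0[THEN conjunct1] \<rho>0[THEN conjunct2, rule_format]
  obtain e where e: "e \<in> L" "\<And>b. b \<in> L \<Longrightarrow> ga_mult G b e = b" using maschke_idempotent[OF L(1)] by blast
  have "b = 0" if b: "b \<in> L" for b
  proof -
    have "b \<in> supp_on N" "hat n \<rho> b = 0\<^sub>m n n" using subsetD[OF L(2) b] \<rho>(1) by simp_all
    from \<rho>(2)[OF this e(1)] show ?thesis unfolding e(2)[OF b] .
  qed
  moreover have "0 \<in> L" using L(1) VS.subspace_0 by (auto simp: left_ideal_def)
  ultimately show False using L(3) by blast
qed

section \<open>Uniqueness and linearity of the lift to (kN)^P\<close>

lemma fixed_diff:
  assumes "b \<in> fixed_alg" "c \<in> fixed_alg"
  shows "b + ga_smult (- 1) c \<in> fixed_alg"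
proof -
  interpret B: unital_alg fixed_alg "(+)" ga_smult "ga_mult G" "delta \<one>" by (rule unital_fixed)
  show ?thesis using assms by (intro B.add_closed B.smult_closed)
qed

lemma fixed_eqI:
  assumes b: "b \<in> fixed_alg" and c: "c \<in> fixed_alg"
    and eq: "\<And>n \<rho>. irr n \<rho> \<Longrightarrow> hat n \<rho> (b + ga_smult (- 1) c) = 0\<^sub>m n n"
  shows "b = c"
proof -
  have "b + ga_smult (- 1) c \<in> supp_on N" using fixed_diff[OF b c] by (simp add: fixed_alg_def)
  from hat_faithful[OF this eq] have *: "b + ga_smult (- 1) c = 0" .
  show ?thesis
  proof
    fix g show "b g = c g" using fun_cong[OF *, of g] by (simp add: ga_smult_apply)
  qed
qed

lemma hat_diff:
  assumes "is_rep G N n \<rho>"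
  shows "hat n \<rho> (b + ga_smult (- 1) c) = hat n \<rho> b - hat n \<rho> c"
  unfolding hat_add[OF assms] hat_smult[OF assms] by (intro eq_matI) auto

text \<open>The difference of b and the lift acts as zero on \<open>\<rho>\<close>, so it lies in
  \<open>ker n \<rho>\<close> and acts as zero on every module with that label. On all other modules
  both elements vanish, and faithfulness applies.\<close>

lemma lift_unique:
  assumes \<rho>: "irr n \<rho>" and b: "b \<in> fixed_alg" and A: "hat n \<rho> b \<in> com_alg n \<rho>"
    and other: "\<And>m \<sigma>. irr m \<sigma> \<Longrightarrow> ker m \<sigma> \<noteq> ker n \<rho> \<Longrightarrow> hat m \<sigma> b = 0\<^sub>m m m"
  shows "b = lift n \<rho> (hat n \<rho> b)"
proof (rule fixed_eqI[OF b lift_in])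
  fix m \<sigma> assume \<sigma>: "irr m \<sigma>"
  let ?d = "b + ga_smult (- 1) (lift n \<rho> (hat n \<rho> b))"
  show "hat m \<sigma> ?d = 0\<^sub>m m m"
  proof (cases "ker m \<sigma> = ker n \<rho>")
    case True
    have "hat n \<rho> ?d = 0\<^sub>m n n"
      unfolding hat_diff[OF irreducible_repD(1)[OF \<rho>]] hat_lift[OF \<rho> A] by simp
    then have "?d \<in> ker n \<rho>" using fixed_diff[OF b lift_in] by (simp add: ker_def)
    then show ?thesis unfolding True[symmetric] by (simp add: ker_def)
  next
    case False
    show ?thesis
      unfolding hat_diff[OF irreducible_repD(1)[OF \<sigma>]] other[OF \<sigma> False]
        hat_lift_other[OF \<rho> \<sigma> hat_carrier False] by simp
  qed
qed

lemma lift_eqI: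
  assumes "irr n \<rho>" "b \<in> fixed_alg" "hat n \<rho> b = A" "A \<in> com_alg n \<rho>"
    and "\<And>m \<sigma>. irr m \<sigma> \<Longrightarrow> ker m \<sigma> \<noteq> ker n \<rho> \<Longrightarrow> hat m \<sigma> b = 0\<^sub>m m m"
  shows "b = lift n \<rho> A"
proof -
  have "hat n \<rho> b \<in> com_alg n \<rho>" unfolding assms(3) by (rule assms(4))
  from lift_unique[OF assms(1,2) this assms(5)] show ?thesis unfolding assms(3) .
qed

lemma fixed_supp: "b \<in> fixed_alg \<Longrightarrow> b \<in> supp_on N"
  by (simp add: fixed_alg_def)

text \<open>Additivity cannot be read off term by term, because the set of conjugates summed in
  \<open>lift\<close> depends on the matrix: conjugates that differ for x may coincide for x + y. It
  follows from the characterization in \<open>lift_eqI\<close>.\<close>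

lemma lift_add:
  assumes \<rho>: "irr n \<rho>" and x: "x \<in> com_alg n \<rho>" and y: "y \<in> com_alg n \<rho>"
  shows "lift n \<rho> (x + y) = lift n \<rho> x + lift n \<rho> y"
proof -
  interpret B: unital_alg fixed_alg "(+)" ga_smult "ga_mult G" "delta \<one>" by (rule unital_fixed)
  interpret E: unital_alg "com_alg n \<rho>" "(+)" "(\<cdot>\<^sub>m)" "(*)" "1\<^sub>m n" by (rule unital_com_alg)
  note \<rho>r = irreducible_repD(1)[OF \<rho>]
  show ?thesis
  proof (rule lift_eqI[OF \<rho>, symmetric])
    show "lift n \<rho> x + lift n \<rho> y \<in> fixed_alg" by (intro B.add_closed lift_in)
    show "hat n \<rho> (lift n \<rho> x + lift n \<rho> y) = x + y"
      unfolding hat_add[OF \<rho>r] hat_lift[OF \<rho> x] hat_lift[OF \<rho> y] ..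
    show "hat m \<sigma> (lift n \<rho> x + lift n \<rho> y) = 0\<^sub>m m m" if "irr m \<sigma>" "ker m \<sigma> \<noteq> ker n \<rho>" for m \<sigma>
      unfolding hat_add[OF irreducible_repD(1)[OF that(1)]] hat_lift_other[OF \<rho> that(1) com_algD(1)[OF x] that(2)]
        hat_lift_other[OF \<rho> that(1) com_algD(1)[OF y] that(2)] by simp
  qed (use x y E.add_closed in auto)
qed

lemma lift_smult:
  assumes \<rho>: "irr n \<rho>" and x: "x \<in> com_alg n \<rho>"
  shows "lift n \<rho> (c \<cdot>\<^sub>m x) = ga_smult c (lift n \<rho> x)"
proof -
  interpret B: unital_alg fixed_alg "(+)" ga_smult "ga_mult G" "delta \<one>" by (rule unital_fixed)
  interpret E: unital_alg "com_alg n \<rho>" "(+)" "(\<cdot>\<^sub>m)" "(*)" "1\<^sub>m n" by (rule unital_com_alg)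
  note \<rho>r = irreducible_repD(1)[OF \<rho>]
  show ?thesis
  proof (rule lift_eqI[OF \<rho>, symmetric])
    show "ga_smult c (lift n \<rho> x) \<in> fixed_alg" by (intro B.smult_closed lift_in)
    show "hat n \<rho> (ga_smult c (lift n \<rho> x)) = c \<cdot>\<^sub>m x"
      unfolding hat_smult[OF \<rho>r] hat_lift[OF \<rho> x] ..
    show "hat m \<sigma> (ga_smult c (lift n \<rho> x)) = 0\<^sub>m m m" if "irr m \<sigma>" "ker m \<sigma> \<noteq> ker n \<rho>" for m \<sigma>
      unfolding hat_smult[OF irreducible_repD(1)[OF that(1)]] hat_lift_other[OF \<rho> that(1) com_algD(1)[OF x] that(2)]
      by simp
  qed (use x E.smult_closed in auto)
qed

text \<open>The image of \<open>lift n \<rho>\<close> is the block of (kN)^P belonging to the orbit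
  of \<open>\<rho>\<close>, an ideal on which (kN)^P acts through \<open>hat n \<rho>\<close>. Forms
  extend from it by composition with \<open>hat n \<rho>\<close>.\<close>

lemma frobenius_com_alg_if_fixed:
  assumes frob: "frobenius_alg fixed_alg (+) ga_smult (ga_mult G)" and \<rho>: "irr n \<rho>"
  shows "frobenius_alg (com_alg n \<rho>) (+) (\<cdot>\<^sub>m) (*)"
proof (rule frobenius_alg_descend[OF unital_fixed unital_com_alg frob, where \<Phi> = "lift n \<rho>" and r = "hat n \<rho>"])
  interpret B: unital_alg fixed_alg "(+)" ga_smult "ga_mult G" "delta \<one>" by (rule unital_fixed)
  interpret E: unital_alg "com_alg n \<rho>" "(+)" "(\<cdot>\<^sub>m)" "(*)" "1\<^sub>m n" by (rule unital_com_alg)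
  note \<rho>r = irreducible_repD(1)[OF \<rho>]
  show "inj_on (lift n \<rho>) (com_alg n \<rho>)"
    by (rule inj_on_inverseI[where g = "hat n \<rho>"]) (rule hat_lift[OF \<rho>])
  show "hat n \<rho> b \<in> com_alg n \<rho>" if "b \<in> fixed_alg" for b by (rule hat_in_com_alg[OF \<rho>r that])
  show "lift n \<rho> (x + y) = lift n \<rho> x + lift n \<rho> y" if "x \<in> com_alg n \<rho>" "y \<in> com_alg n \<rho>" for x y
    by (rule lift_add[OF \<rho> that])
  show "lift n \<rho> (c \<cdot>\<^sub>m x) = ga_smult c (lift n \<rho> x)" if "x \<in> com_alg n \<rho>" for c x
    by (rule lift_smult[OF \<rho> that])
  show "ga_mult G b (lift n \<rho> x) = lift n \<rho> (hat n \<rho> b * x)" if b: "b \<in> fixed_alg" and x: "x \<in> com_alg n \<rho>" for b x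
  proof (rule lift_eqI[OF \<rho>])
    show "ga_mult G b (lift n \<rho> x) \<in> fixed_alg" by (intro B.mult_closed lift_in b)
    show "hat n \<rho> (ga_mult G b (lift n \<rho> x)) = hat n \<rho> b * x"
      unfolding hat_mult[OF \<rho>r fixed_supp[OF b]] hat_lift[OF \<rho> x] ..
    show "hat m \<sigma> (ga_mult G b (lift n \<rho> x)) = 0\<^sub>m m m" if "irr m \<sigma>" "ker m \<sigma> \<noteq> ker n \<rho>" for m \<sigma>
      unfolding hat_mult[OF irreducible_repD(1)[OF that(1)] fixed_supp[OF b]]
        hat_lift_other[OF \<rho> that(1) com_algD(1)[OF x] that(2)] by simp
  qed (rule E.mult_closed[OF hat_in_com_alg[OF \<rho>r b] x])
  show "ga_mult G (lift n \<rho> x) b = lift n \<rho> (x * hat n \<rho> b)" if b: "b \<in> fixed_alg" and x: "x \<in> com_alg n \<rho>" for b x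
  proof (rule lift_eqI[OF \<rho>])
    show "ga_mult G (lift n \<rho> x) b \<in> fixed_alg" by (intro B.mult_closed lift_in b)
    show "hat n \<rho> (ga_mult G (lift n \<rho> x) b) = x * hat n \<rho> b"
      unfolding hat_mult[OF \<rho>r fixed_supp[OF lift_in]] hat_lift[OF \<rho> x] ..
    show "hat m \<sigma> (ga_mult G (lift n \<rho> x) b) = 0\<^sub>m m m" if "irr m \<sigma>" "ker m \<sigma> \<noteq> ker n \<rho>" for m \<sigma>
      unfolding hat_mult[OF irreducible_repD(1)[OF that(1)] fixed_supp[OF lift_in]]
        hat_lift_other[OF \<rho> that(1) com_algD(1)[OF x] that(2)] by simp
  qed (rule E.mult_closed[OF x hat_in_com_alg[OF \<rho>r b]])
  show "\<exists>\<psi>. lin_functional fixed_alg (+) ga_smult \<psi> \<and> (\<forall>x\<in>com_alg n \<rho>. \<psi> (lift n \<rho> x) = \<phi> x)"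
    if \<phi>: "lin_functional (com_alg n \<rho>) (+) (\<cdot>\<^sub>m) \<phi>" for \<phi> :: "'k mat \<Rightarrow> 'k"
  proof (intro exI[of _ "\<lambda>b. \<phi> (hat n \<rho> b)"] conjI ballI)
    show "lin_functional fixed_alg (+) ga_smult (\<lambda>b. \<phi> (hat n \<rho> b))"
      unfolding lin_functional_def hat_add[OF \<rho>r] hat_smult[OF \<rho>r]
      using \<phi> hat_in_com_alg[OF \<rho>r] by (simp add: lin_functional_def)
  qed (simp add: hat_lift[OF \<rho>])
qed (rule lift_in)

text \<open>One representative module is chosen for each label \<open>ker\<close>, and (kN)^P is the
  product of the corresponding algebras.\<close>

lemma frobenius_fixed_if_com_alg:
  assumes frob: "\<And>n \<rho>. irr n \<rho> \<Longrightarrow> frobenius_alg (com_alg n \<rho>) (+) (\<cdot>\<^sub>m) (*)"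
  shows "frobenius_alg fixed_alg (+) ga_smult (ga_mult G)"
proof -
  define I where "I = {K. \<exists>n \<rho>. irr n \<rho> \<and> K = ker n \<rho>}"
  have "\<exists>n \<rho>. irr n \<rho> \<and> K = ker n \<rho>" if "K \<in> I" for K using that by (simp add: I_def)
  then obtain d s where ds: "\<And>K. K \<in> I \<Longrightarrow> irr (d K) (s K)" "\<And>K. K \<in> I \<Longrightarrow> ker (d K) (s K) = K"
    by metis
  note sr = irreducible_repD(1)[OF ds(1)]
  have other: "hat (d J) (s J) (lift (d K) (s K) A) = 0\<^sub>m (d J) (d J)"
    if "K \<in> I" "J \<in> I" "K \<noteq> J" "A \<in> carrier_mat (d K) (d K)" for K J A
    using that ds(2) by (intro hat_lift_other[OF ds(1)[OF that(1)] ds(1)[OF that(2)] that(4)]) auto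
  have one: "1\<^sub>m (d K) \<in> com_alg (d K) (s K)" for K by (rule com_algI) auto
  have fin: "finite I"
  proof -
    \<comment> \<open>The block units \<open>e K\<close> show that there are finitely many labels.
      Evaluating the entry at (0,0) on the chosen modules separates them, so they are linearly
      independent in the finite-dimensional kN.\<close>
    define e where "e K = lift (d K) (s K) (1\<^sub>m (d K))" for K
    have he: "hat (d J) (s J) (e K) $$ (0,0) = (if K = J then 1 else 0)" if "K \<in> I" "J \<in> I" for K J
      using that other[OF that, of "1\<^sub>m (d K)"] hat_lift[OF ds(1)[OF that(2)] one] irreducible_repD(2)[OF ds(1)[OF that(2)]]
      by (auto simp: e_def)
    have inj: "inj_on e I"
    proof (rule inj_onI, rule ccontr)
      fix K J assume "K \<in> I" "J \<in> I" "e K = e J" "K \<noteq> J"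
      then show False using he[of K J] he[of J J] by simp
    qed
    have "VS.independent (e ` I)"
      unfolding VS.independent_explicit_finite_subsets
    proof (intro allI impI ballI)
      fix S u v assume S: "S \<subseteq> e ` I" "finite S" and z: "(\<Sum>v\<in>S. ga_smult (u v) v) = 0" and v: "v \<in> S"
      obtain J where J: "J \<in> I" "v = e J" using S v by blast
      have d: "0 < d J" by (rule irreducible_repD(2)[OF ds(1)[OF J(1)]])
      have "0 = hat (d J) (s J) (\<Sum>v\<in>S. ga_smult (u v) v) $$ (0,0)"
        unfolding z hat_zero[OF sr[OF J(1)]] using d by simp
      also have "\<dots> = (\<Sum>w\<in>S. u w * hat (d J) (s J) w $$ (0,0))"
        unfolding hat_sum[OF sr[OF J(1)] d d] hat_smult[OF sr[OF J(1)]] using d by simp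
      also have "\<dots> = (\<Sum>w\<in>S. if w = v then u w else 0)"
      proof (rule sum.cong[OF refl])
        fix w assume "w \<in> S"
        then obtain K where K: "K \<in> I" "w = e K" using S by blast
        then have "w = v \<longleftrightarrow> K = J" using J inj_on_eq_iff[OF inj K(1) J(1)] by simp
        then show "u w * hat (d J) (s J) w $$ (0,0) = (if w = v then u w else 0)"
          using he[OF K(1) J(1)] K(2) by simp
      qed
      also have "\<dots> = u v" using S v by simp
      finally show "u v = 0" by simp
    qed
    then have "finite (e ` I)"
      using fixed_supp[OF lift_in] by (intro independent_supp_on) (auto simp: e_def)
    then show ?thesis using finite_imageD[OF _ inj] by blast
  qed
  show ?thesis
  proof (rule frobenius_alg_product[OF unital_fixed zero_fixed fin, where E = "\<lambda>K. com_alg (d K) (s K)"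
        and r = "\<lambda>K. hat (d K) (s K)" and \<Phi> = "\<lambda>K. lift (d K) (s K)"])
    show "unital_alg (com_alg (d K) (s K)) (+) (\<cdot>\<^sub>m) (*) (1\<^sub>m (d K))" for K by (rule unital_com_alg)
    show "frobenius_alg (com_alg (d K) (s K)) (+) (\<cdot>\<^sub>m) (*)" if "K \<in> I" for K by (rule frob[OF ds(1)[OF that]])
    show "hat (d K) (s K) (b + c) = hat (d K) (s K) b + hat (d K) (s K) c" if "K \<in> I" for K b c
      by (rule hat_add[OF sr[OF that]])
    show "hat (d K) (s K) (ga_smult t b) = t \<cdot>\<^sub>m hat (d K) (s K) b" if "K \<in> I" for K b t
      by (rule hat_smult[OF sr[OF that]])
    show "hat (d K) (s K) (ga_mult G b c) = hat (d K) (s K) b * hat (d K) (s K) c"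
      if "K \<in> I" "b \<in> fixed_alg" for K b c
      by (rule hat_mult[OF sr[OF that(1)] fixed_supp[OF that(2)]])
    show "lift (d K) (s K) (x + y) = lift (d K) (s K) x + lift (d K) (s K) y"
      if "K \<in> I" "x \<in> com_alg (d K) (s K)" "y \<in> com_alg (d K) (s K)" for K x y
      by (rule lift_add[OF ds(1)[OF that(1)] that(2,3)])
    show "lift (d K) (s K) (t \<cdot>\<^sub>m x) = ga_smult t (lift (d K) (s K) x)"
      if "K \<in> I" "x \<in> com_alg (d K) (s K)" for K t x
      by (rule lift_smult[OF ds(1)[OF that(1)] that(2)])
    show "hat (d K) (s K) (lift (d K) (s K) x) = x" if "K \<in> I" "x \<in> com_alg (d K) (s K)" for K x
      by (rule hat_lift[OF ds(1)[OF that(1)] that(2)])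
    show "hat (d J) (s J) (lift (d K) (s K) x) = 0 \<cdot>\<^sub>m 1\<^sub>m (d J)"
      if "K \<in> I" "J \<in> I" "K \<noteq> J" "x \<in> com_alg (d K) (s K)" for K J x
      unfolding other[OF that(1-3) com_algD(1)[OF that(4)]] by (intro eq_matI) auto
    show "hat (d K) (s K) b \<in> com_alg (d K) (s K)" if "K \<in> I" "b \<in> fixed_alg" for K b
      by (rule hat_in_com_alg[OF sr[OF that(1)] that(2)])
    show "b = c" if b: "b \<in> fixed_alg" and c: "c \<in> fixed_alg"
      and eq: "\<And>K. K \<in> I \<Longrightarrow> hat (d K) (s K) b = hat (d K) (s K) c" for b c
    proof (rule fixed_eqI[OF b c])
      fix m \<sigma> assume \<sigma>: "irr m \<sigma>"
      define K where "K = ker m \<sigma>"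
      have K: "K \<in> I" using \<sigma> unfolding I_def K_def by blast
      \<comment> \<open>Agreement on the chosen representative puts the difference in the kernel,
        and the kernel is the same for every module with this label.\<close>
      have "hat (d K) (s K) (b + ga_smult (- 1) c) = 0\<^sub>m (d K) (d K)"
        unfolding hat_diff[OF sr[OF K]] eq[OF K] by simp
      then have "b + ga_smult (- 1) c \<in> ker (d K) (s K)" using fixed_diff[OF b c] by (simp add: ker_def)
      then have "b + ga_smult (- 1) c \<in> ker m \<sigma>" using ds(2)[OF K] by (simp only: K_def)
      then show "hat m \<sigma> (b + ga_smult (- 1) c) = 0\<^sub>m m m" by (simp add: ker_def)
    qed
  qed (rule lift_in)
qed

end

section \<open>Extension to the inertia group\<close>

text \<open>Powers of the Frobenius map are additive with trivial kernel; this makes the roots in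
  \<open>exists_extension\<close> unique.\<close>

lemma power_prime_power_char_inj:
  fixes a b :: "'k::field"
  assumes "prime p" "CHAR('k) = p" "a ^ (p ^ m) = b ^ (p ^ m)"
  shows "a = b"
proof -
  have "a ^ (p ^ m) = ((a - b) + b) ^ (p ^ m)" by simp
  also have "\<dots> = (a - b) ^ (p ^ m) + b ^ (p ^ m)"
    using assms(1,2) by (intro freshmans_dream') auto
  finally have "(a - b) ^ (p ^ m) = 0" using assms(3) by simp
  then show ?thesis by simp
qed

lemma smult_smult_mat: "a \<cdot>\<^sub>m (b \<cdot>\<^sub>m A) = (a * b) \<cdot>\<^sub>m (A :: 'k::field mat)"
  by (intro eq_matI) (auto simp: mult.assoc)

context p_nilpotent_group
begin

text \<open>The isomorphisms S from the conjugate of the module by x to the module itself.\<close>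

definition intw :: "nat \<Rightarrow> ('a \<Rightarrow> 'k mat) \<Rightarrow> 'a \<Rightarrow> 'k mat \<Rightarrow> bool" where
  "intw n \<rho> x S \<longleftrightarrow> S \<in> carrier_mat n n \<and> (\<exists>R\<in>carrier_mat n n. S * R = 1\<^sub>m n \<and> R * S = 1\<^sub>m n) \<and>
     (\<forall>h\<in>N. S * conj_rep G x \<rho> h = \<rho> h * S)"

lemma intwI:
  assumes "S \<in> carrier_mat n n" "R \<in> carrier_mat n n" "S * R = 1\<^sub>m n" "R * S = 1\<^sub>m n"
    "\<And>h. h \<in> N \<Longrightarrow> S * conj_rep G x \<rho> h = \<rho> h * S"
  shows "intw n \<rho> x S"
  using assms unfolding intw_def by blast

lemma inertia_iff: "x \<in> inertia G N H n \<rho> \<longleftrightarrow> x \<in> H \<and> (\<exists>S. intw n \<rho> x S)"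
  unfolding inertia_def rep_iso_def intw_def by blast

lemma com_alg_iff:
  "A \<in> com_alg n \<rho> \<longleftrightarrow> A \<in> carrier_mat n n \<and> (\<forall>x\<in>P. \<forall>S. intw n \<rho> x S \<longrightarrow> A * S = S * A)"
  unfolding com_alg_def intw_def by blast

lemma intw_mult:
  assumes \<rho>: "is_rep G N n \<rho>" and x: "x \<in> carrier G" "intw n \<rho> x S" and y: "y \<in> carrier G" "intw n \<rho> y U"
  shows "intw n \<rho> (x \<otimes> y) (S * U)"
proof -
  obtain R where S: "S \<in> carrier_mat n n" "R \<in> carrier_mat n n" "S * R = 1\<^sub>m n" "R * S = 1\<^sub>m n"
    "\<And>h. h \<in> N \<Longrightarrow> S * conj_rep G x \<rho> h = \<rho> h * S" using x(2) unfolding intw_def by blast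
  obtain V where U: "U \<in> carrier_mat n n" "V \<in> carrier_mat n n" "U * V = 1\<^sub>m n" "V * U = 1\<^sub>m n"
    "\<And>h. h \<in> N \<Longrightarrow> U * conj_rep G y \<rho> h = \<rho> h * U" using y(2) unfolding intw_def by blast
  have SU: "S * U \<in> carrier_mat n n" and VR: "V * R \<in> carrier_mat n n" using S U by auto
  show ?thesis
  proof (rule intwI[OF SU VR])
    have "S * U * (V * R) = S * (U * (V * R))" by (rule assoc_mult_mat[OF S(1) U(1) VR])
    also have "U * (V * R) = (U * V) * R" by (rule assoc_mult_mat[OF U(1,2) S(2), symmetric])
    finally show "S * U * (V * R) = 1\<^sub>m n" using S U by simp
    have "V * R * (S * U) = V * (R * (S * U))" by (rule assoc_mult_mat[OF U(2) S(2) SU])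
    also have "R * (S * U) = (R * S) * U" by (rule assoc_mult_mat[OF S(2,1) U(1), symmetric])
    finally show "V * R * (S * U) = 1\<^sub>m n" using S U by simp
    fix h assume h: "h \<in> N"
    have h': "inv x \<otimes> h \<otimes> x \<in> N" using conj_N' x h by blast
    have e: "conj_rep G (x \<otimes> y) \<rho> h = conj_rep G y \<rho> (inv x \<otimes> h \<otimes> x)"
      using x(1) y(1) h by (simp add: conj_rep_def inv_mult_group m_assoc)
    have c: "conj_rep G y \<rho> (inv x \<otimes> h \<otimes> x) \<in> carrier_mat n n" "\<rho> h \<in> carrier_mat n n"
        "\<rho> (inv x \<otimes> h \<otimes> x) \<in> carrier_mat n n"
      using is_repD(1)[OF conj_rep_is_rep[OF \<rho> y(1)] h'] is_repD(1)[OF \<rho> h] is_repD(1)[OF \<rho> h'] .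
    have "S * U * conj_rep G (x \<otimes> y) \<rho> h = S * (U * conj_rep G y \<rho> (inv x \<otimes> h \<otimes> x))"
      unfolding e by (rule assoc_mult_mat[OF S(1) U(1) c(1)])
    also have "\<dots> = (S * \<rho> (inv x \<otimes> h \<otimes> x)) * U"
      unfolding U(5)[OF h'] by (rule assoc_mult_mat[OF S(1) c(3) U(1), symmetric])
    also have "S * \<rho> (inv x \<otimes> h \<otimes> x) = \<rho> h * S" using S(5)[OF h] by (simp add: conj_rep_def)
    also have "\<rho> h * S * U = \<rho> h * (S * U)" by (rule assoc_mult_mat[OF c(2) S(1) U(1)])
    finally show "S * U * conj_rep G (x \<otimes> y) \<rho> h = \<rho> h * (S * U)" .
  qed
qed

lemma intw_inv:
  assumes \<rho>: "is_rep G N n \<rho>" and x: "x \<in> carrier G" "intw n \<rho> x S"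
  shows "\<exists>R. intw n \<rho> (inv x) R"
proof -
  obtain R where S: "S \<in> carrier_mat n n" "R \<in> carrier_mat n n" "S * R = 1\<^sub>m n" "R * S = 1\<^sub>m n"
    "\<And>h. h \<in> N \<Longrightarrow> S * conj_rep G x \<rho> h = \<rho> h * S" using x(2) unfolding intw_def by blast
  have "intw n \<rho> (inv x) R"
  proof (rule intwI[OF S(2,1,4,3)])
    fix h assume h: "h \<in> N"
    have h': "x \<otimes> h \<otimes> inv x \<in> N" using conj_N x h by blast
    have "inv x \<otimes> (x \<otimes> h \<otimes> inv x) \<otimes> x = h"
      using x h by (simp add: m_assoc) (simp add: m_assoc[symmetric])
    then have e: "conj_rep G x \<rho> (x \<otimes> h \<otimes> inv x) = \<rho> h" by (simp add: conj_rep_def)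
    have e': "conj_rep G (inv x) \<rho> h = \<rho> (x \<otimes> h \<otimes> inv x)" using x by (simp add: conj_rep_def)
    have c: "\<rho> h \<in> carrier_mat n n" "\<rho> (x \<otimes> h \<otimes> inv x) \<in> carrier_mat n n"
      using is_repD(1)[OF \<rho>] h h' by auto
    have "R * \<rho> (x \<otimes> h \<otimes> inv x) = R * (\<rho> (x \<otimes> h \<otimes> inv x) * (S * R))"
      using S(3) c by simp
    also have "\<rho> (x \<otimes> h \<otimes> inv x) * (S * R) = (\<rho> (x \<otimes> h \<otimes> inv x) * S) * R"
      by (rule assoc_mult_mat[OF c(2) S(1,2), symmetric])
    also have "\<dots> = S * \<rho> h * R" using S(5)[OF h'] e by simp
    also have "\<dots> = S * (\<rho> h * R)" by (rule assoc_mult_mat[OF S(1) c(1) S(2)])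
    also have "R * (S * (\<rho> h * R)) = (R * S) * (\<rho> h * R)"
      by (rule assoc_mult_mat[OF S(2,1) mult_carrier_mat[OF c(1) S(2)], symmetric])
    also have "\<dots> = \<rho> h * R" unfolding S(4) by (rule left_mult_one_mat[OF mult_carrier_mat[OF c(1) S(2)]])
    finally show "R * conj_rep G (inv x) \<rho> h = \<rho> h * R" unfolding e' .
  qed
  then show ?thesis by blast
qed

lemma intw_N:
  assumes \<rho>: "is_rep G N n \<rho>" and x: "x \<in> N"
  shows "intw n \<rho> x (\<rho> x)"
proof (rule intwI)
  note \<rho>r = is_repD[OF \<rho>]
  show "\<rho> x \<in> carrier_mat n n" "\<rho> (inv x) \<in> carrier_mat n n" using \<rho>r(1) x by auto
  show "\<rho> x * \<rho> (inv x) = 1\<^sub>m n" "\<rho> (inv x) * \<rho> x = 1\<^sub>m n"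
    using \<rho>r(3)[of x "inv x"] \<rho>r(3)[of "inv x" x] \<rho>r(2) x by auto
  fix h assume h: "h \<in> N"
  have e: "x \<otimes> (inv x \<otimes> h \<otimes> x) = h \<otimes> x" using x h by (simp add: m_assoc[symmetric])
  show "\<rho> x * conj_rep G x \<rho> h = \<rho> h * \<rho> x"
    using \<rho>r(3)[of x "inv x \<otimes> h \<otimes> x"] \<rho>r(3)[OF h x] x h unfolding conj_rep_def e by simp
qed

lemma smult_mat_eq_0:
  fixes S :: "'k mat"
  assumes "intw n \<rho> x S" "n > 0" "c \<cdot>\<^sub>m S = d \<cdot>\<^sub>m S"
  shows "c = d"
proof -
  obtain R where S: "S \<in> carrier_mat n n" "R \<in> carrier_mat n n" "S * R = 1\<^sub>m n"
    using assms(1) unfolding intw_def by blast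
  have "c \<cdot>\<^sub>m (S * R) = d \<cdot>\<^sub>m (S * R)"
    using arg_cong[OF assms(3), of "\<lambda>M. M * R"] mult_smult_assoc_mat[OF S(1,2)] by simp
  from arg_cong[OF this, of "\<lambda>M. M $$ (0,0)"] show ?thesis using S(3) assms(2) by simp
qed

text \<open>U times the inverse of S commutes with \<open>\<rho>\<close>, so it is a scalar by
  Schur's lemma.\<close>

lemma intw_unique:
  assumes \<rho>: "irr n \<rho>" and x: "x \<in> carrier G" and S: "intw n \<rho> x S" and U: "intw n \<rho> x U"
  shows "\<exists>c. c \<noteq> 0 \<and> U = c \<cdot>\<^sub>m S"
proof -
  note \<rho>r = irreducible_repD(1)[OF \<rho>]
  obtain R where S: "S \<in> carrier_mat n n" "R \<in> carrier_mat n n" "S * R = 1\<^sub>m n" "R * S = 1\<^sub>m n"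
    "\<And>h. h \<in> N \<Longrightarrow> S * conj_rep G x \<rho> h = \<rho> h * S" using S unfolding intw_def by blast
  obtain V where U: "U \<in> carrier_mat n n" "V \<in> carrier_mat n n" "U * V = 1\<^sub>m n" "V * U = 1\<^sub>m n"
    "\<And>h. h \<in> N \<Longrightarrow> U * conj_rep G x \<rho> h = \<rho> h * U" using U unfolding intw_def by blast
  have UR: "U * R \<in> carrier_mat n n" using U S by simp
  have "U * R * \<rho> h = \<rho> h * (U * R)" if h: "h \<in> N" for h
  proof -
    have c: "\<rho> h \<in> carrier_mat n n" "conj_rep G x \<rho> h \<in> carrier_mat n n"
      using is_repD(1)[OF \<rho>r h] is_repD(1)[OF conj_rep_is_rep[OF \<rho>r x] h] .
    have Rc: "R * \<rho> h = conj_rep G x \<rho> h * R"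
    proof -
      have "R * \<rho> h = R * (\<rho> h * (S * R))" using S(3) c by simp
      also have "\<rho> h * (S * R) = (\<rho> h * S) * R" by (rule assoc_mult_mat[OF c(1) S(1,2), symmetric])
      also have "\<rho> h * S = S * conj_rep G x \<rho> h" by (rule S(5)[OF h, symmetric])
      also have "S * conj_rep G x \<rho> h * R = S * (conj_rep G x \<rho> h * R)" by (rule assoc_mult_mat[OF S(1) c(2) S(2)])
      also have "R * (S * (conj_rep G x \<rho> h * R)) = (R * S) * (conj_rep G x \<rho> h * R)"
        by (rule assoc_mult_mat[OF S(2,1) mult_carrier_mat[OF c(2) S(2)], symmetric])
      also have "\<dots> = conj_rep G x \<rho> h * R" unfolding S(4) by (rule left_mult_one_mat[OF mult_carrier_mat[OF c(2) S(2)]])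
      finally show ?thesis .
    qed
    have "U * R * \<rho> h = U * (R * \<rho> h)" by (rule assoc_mult_mat[OF U(1) S(2) c(1)])
    also have "\<dots> = (U * conj_rep G x \<rho> h) * R" unfolding Rc by (rule assoc_mult_mat[OF U(1) c(2) S(2), symmetric])
    also have "\<dots> = \<rho> h * (U * R)" unfolding U(5)[OF h] by (rule assoc_mult_mat[OF c(1) U(1) S(2)])
    finally show ?thesis .
  qed
  from schur_scalar[OF \<rho> UR this] obtain c where c: "U * R = c \<cdot>\<^sub>m 1\<^sub>m n" by blast
  have "U = U * (R * S)" using S(4) U(1) by simp
  also have "\<dots> = U * R * S" by (rule assoc_mult_mat[OF U(1) S(2,1), symmetric])
  also have "\<dots> = c \<cdot>\<^sub>m S" unfolding c using mult_smult_assoc_mat[of "1\<^sub>m n" n n S n c] S(1) by simp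
  finally have Uc: "U = c \<cdot>\<^sub>m S" .
  have "c \<noteq> 0"
  proof
    assume "c = 0"
    then have "U = 0\<^sub>m n n" unfolding Uc using S(1) by (intro eq_matI) auto
    then have "(0\<^sub>m n n :: 'k mat) = 1\<^sub>m n" using U(2,3) by simp
    from arg_cong[OF this, of "\<lambda>M. M $$ (0,0)"] show False using irreducible_repD(2)[OF \<rho>] by simp
  qed
  then show ?thesis using Uc by blast
qed

text \<open>Both sides of the intertwining relation are the value of \<open>\<rho>'\<close> at
  \<open>h \<otimes> x\<close>, because
  \<open>x \<otimes> (inv x \<otimes> h \<otimes> x) = h \<otimes> x\<close>.\<close>

lemma rep_intw:
  assumes \<rho>: "irr n \<rho>" and \<rho>': "is_rep G (inertia G N (carrier G) n \<rho>) n \<rho>'"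
    and ext: "\<And>g. g \<in> N \<Longrightarrow> \<rho>' g = \<rho> g" and x: "x \<in> inertia G N (carrier G) n \<rho>"
  shows "intw n \<rho> x (\<rho>' x)"
proof (rule intwI)
  let ?T = "inertia G N (carrier G) n \<rho>"
  note \<rho>r = irreducible_repD(1)[OF \<rho>]
  have xG: "x \<in> carrier G" and xi: "inv x \<in> ?T" using x intw_inv[OF \<rho>r] by (auto simp: inertia_iff)
  have NT: "h \<in> ?T" if "h \<in> N" for h using intw_N[OF \<rho>r that] that by (auto simp: inertia_iff)
  show "\<rho>' x \<in> carrier_mat n n" "\<rho>' (inv x) \<in> carrier_mat n n"
    using is_repD(1)[OF \<rho>'] x xi by auto
  show "\<rho>' x * \<rho>' (inv x) = 1\<^sub>m n" "\<rho>' (inv x) * \<rho>' x = 1\<^sub>m n"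
    using is_repD(3)[OF \<rho>' x xi] is_repD(3)[OF \<rho>' xi x] is_repD(2)[OF \<rho>'] xG by auto
  fix h assume h: "h \<in> N"
  have h': "inv x \<otimes> h \<otimes> x \<in> N" using conj_N' xG h by blast
  have e: "x \<otimes> (inv x \<otimes> h \<otimes> x) = h \<otimes> x" using xG h by (simp add: m_assoc[symmetric])
  show "\<rho>' x * conj_rep G x \<rho> h = \<rho> h * \<rho>' x"
    unfolding conj_rep_def ext[OF h', symmetric] ext[OF h, symmetric]
      is_repD(3)[OF \<rho>' x NT[OF h'], symmetric] is_repD(3)[OF \<rho>' NT[OF h] x, symmetric] e ..
qed

text \<open>In particular the endomorphism algebra is the same for every extension
  \<open>\<rho>'\<close>.\<close>

lemma end_alg_eq_com_alg:
  assumes \<rho>: "irr n \<rho>" and \<rho>': "is_rep G (inertia G N (carrier G) n \<rho>) n \<rho>'"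
    and ext: "\<And>g. g \<in> N \<Longrightarrow> \<rho>' g = \<rho> g"
  shows "end_alg (inertia G N P n \<rho>) n \<rho>' = com_alg n \<rho>"
proof -
  have T: "x \<in> inertia G N (carrier G) n \<rho>" "x \<in> P" if "x \<in> inertia G N P n \<rho>" for x
    using that by (auto simp: inertia_iff)
  show ?thesis
  proof (intro equalityI subsetI)
    fix A assume A: "A \<in> end_alg (inertia G N P n \<rho>) n \<rho>'"
    then have Ac: "A \<in> carrier_mat n n" by (simp add: end_alg_def)
    have "A * S = S * A" if x: "x \<in> P" and S: "intw n \<rho> x S" for x S
    proof -
      have xT: "x \<in> inertia G N P n \<rho>" using x S by (auto simp: inertia_iff)
      have comm: "A * \<rho>' x = \<rho>' x * A" using A xT by (simp add: end_alg_def)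
      have c': "\<rho>' x \<in> carrier_mat n n" by (rule is_repD(1)[OF \<rho>' T(1)[OF xT]])
      have "intw n \<rho> x (\<rho>' x)" by (rule rep_intw[OF \<rho> \<rho>' _ T(1)[OF xT]]) (rule ext)
      from intw_unique[OF \<rho> P.mem_carrier[OF x] this S] obtain c where c: "S = c \<cdot>\<^sub>m \<rho>' x" by blast
      show ?thesis
        unfolding c mult_smult_assoc_mat[OF c' Ac] mult_smult_distrib[OF Ac c'] comm ..
    qed
    then show "A \<in> com_alg n \<rho>" using Ac by (simp add: com_alg_iff)
  next
    fix A assume A: "A \<in> com_alg n \<rho>"
    have "A * \<rho>' x = \<rho>' x * A" if x: "x \<in> inertia G N P n \<rho>" for x
    proof -
      have "intw n \<rho> x (\<rho>' x)" by (rule rep_intw[OF \<rho> \<rho>' _ T(1)[OF x]]) (rule ext)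
      then show ?thesis using A T(2)[OF x] by (simp add: com_alg_iff)
    qed
    then show "A \<in> end_alg (inertia G N P n \<rho>) n \<rho>'"
      using com_algD(1)[OF A] by (simp add: end_alg_def)
  qed
qed

text \<open>The intertwiners \<open>S\<^sub>x\<close> form a projective representation of \<open>T\<^sub>P(M)\<close>. Multiplying its cocycle identity
  over the third argument shows that the \<open>|T\<^sub>P(M)|\<close>-th power of the cocycle is a coboundary,
  and \<open>|T\<^sub>P(M)|\<close>-th roots exist uniquely in \<open>k\<close>.\<close>
lemma exists_extension:
  assumes \<rho>: "irr n \<rho>"
  shows "\<exists>\<rho>'. is_rep G (inertia G N (carrier G) n \<rho>) n \<rho>' \<and> (\<forall>g\<in>N. \<rho>' g = \<rho> g)"
proof -
  note \<rho>r = irreducible_repD(1)[OF \<rho>] and n = irreducible_repD(2)[OF \<rho>]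
  define T where "T = inertia G N P n \<rho>"
  have TP: "x \<in> P" "x \<in> carrier G" if "x \<in> T" for x using that by (auto simp: T_def inertia_iff)
  have T_mult: "x \<otimes> y \<in> T" if "x \<in> T" "y \<in> T" for x y
  proof -
    obtain S U where "intw n \<rho> x S" "intw n \<rho> y U" using \<open>x \<in> T\<close> \<open>y \<in> T\<close> unfolding T_def inertia_iff by blast
    from intw_mult[OF \<rho>r TP(2)[OF \<open>x \<in> T\<close>] this(1) TP(2)[OF \<open>y \<in> T\<close>] this(2)]
    show ?thesis using TP(1)[OF \<open>x \<in> T\<close>] TP(1)[OF \<open>y \<in> T\<close>] by (auto simp: T_def inertia_iff)
  qed
  have T_inv: "inv x \<in> T" if "x \<in> T" for x
  proof -
    obtain S where "intw n \<rho> x S" using \<open>x \<in> T\<close> unfolding T_def inertia_iff by blast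
    from intw_inv[OF \<rho>r TP(2)[OF that] this] show ?thesis using TP(1)[OF that] by (simp add: T_def inertia_iff)
  qed
  have T_one: "\<one> \<in> T" using intw_N[OF \<rho>r N.one_closed] by (auto simp: T_def inertia_iff)
  have finT: "finite T" using TP(1) by (intro finite_subset[OF _ finite_P]) auto
  interpret GP: group "G\<lparr>carrier := P\<rparr>" by (rule P.subgroup_is_group[OF is_group])
  have "subgroup T (G\<lparr>carrier := P\<rparr>)"
  proof (rule GP.subgroupI)
    show "T \<subseteq> carrier (G\<lparr>carrier := P\<rparr>)" using TP(1) by auto
    show "T \<noteq> {}" using T_one by blast
    fix x assume x: "x \<in> T"
    show "inv\<^bsub>G\<lparr>carrier := P\<rparr>\<^esub> x \<in> T"
      unfolding m_inv_consistent[OF subgroup_P TP(1)[OF x]] by (rule T_inv[OF x])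
    fix y assume "y \<in> T"
    then show "x \<otimes>\<^bsub>G\<lparr>carrier := P\<rparr>\<^esub> y \<in> T" using T_mult[OF x] by simp
  qed
  from GP.lagrange[OF this] have "card T dvd p ^ e"
    by (simp add: Coset.order_def card_P[symmetric]) (metis dvd_triv_right)
  then obtain m where m: "card T = p ^ m" using prime_p divides_primepow_nat by blast
  have "\<exists>S. intw n \<rho> x S" if "x \<in> T" for x using that by (simp add: T_def inertia_iff)
  then obtain S where S: "\<And>x. x \<in> T \<Longrightarrow> intw n \<rho> x (S x)" by metis
  have Sc: "S x \<in> carrier_mat n n" if "x \<in> T" for x using S[OF that] by (simp add: intw_def)
  define c where "c x y = (SOME c. c \<noteq> 0 \<and> S x * S y = c \<cdot>\<^sub>m S (x \<otimes> y))" for x y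
  have c_ex: "c x y \<noteq> 0 \<and> S x * S y = c x y \<cdot>\<^sub>m S (x \<otimes> y)" if "x \<in> T" "y \<in> T" for x y
    unfolding c_def
    by (rule someI_ex, rule intw_unique[OF \<rho> m_closed[OF TP(2)[OF that(1)] TP(2)[OF that(2)]] S[OF T_mult[OF that]]])
      (rule intw_mult[OF \<rho>r TP(2)[OF that(1)] S[OF that(1)] TP(2)[OF that(2)] S[OF that(2)]])
  note c = c_ex[THEN conjunct1] c_ex[THEN conjunct2]
  have cocycle: "c x y * c (x \<otimes> y) z = c y z * c x (y \<otimes> z)" if xyz: "x \<in> T" "y \<in> T" "z \<in> T" for x y z
  proof (rule smult_mat_eq_0[OF S[OF T_mult[OF xyz(1) T_mult[OF xyz(2,3)]]] n])
    have a: "x \<otimes> y \<otimes> z = x \<otimes> (y \<otimes> z)" using xyz TP by (simp add: m_assoc)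
    have "(S x * S y) * S z = c x y \<cdot>\<^sub>m (S (x \<otimes> y) * S z)"
      unfolding c(2)[OF xyz(1,2)] by (rule mult_smult_assoc_mat[OF Sc[OF T_mult[OF xyz(1,2)]] Sc[OF xyz(3)]])
    also have "\<dots> = (c x y * c (x \<otimes> y) z) \<cdot>\<^sub>m S (x \<otimes> (y \<otimes> z))"
      unfolding c(2)[OF T_mult[OF xyz(1,2)] xyz(3)] a by (simp add: smult_smult_mat)
    finally have 1: "(S x * S y) * S z = (c x y * c (x \<otimes> y) z) \<cdot>\<^sub>m S (x \<otimes> (y \<otimes> z))" .
    have "S x * (S y * S z) = c y z \<cdot>\<^sub>m (S x * S (y \<otimes> z))"
      unfolding c(2)[OF xyz(2,3)] by (rule mult_smult_distrib[OF Sc[OF xyz(1)] Sc[OF T_mult[OF xyz(2,3)]]])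
    also have "\<dots> = (c y z * c x (y \<otimes> z)) \<cdot>\<^sub>m S (x \<otimes> (y \<otimes> z))"
      unfolding c(2)[OF xyz(1) T_mult[OF xyz(2,3)]] by (simp add: smult_smult_mat)
    finally have 2: "S x * (S y * S z) = (c y z * c x (y \<otimes> z)) \<cdot>\<^sub>m S (x \<otimes> (y \<otimes> z))" .
    have "(S x * S y) * S z = S x * (S y * S z)" by (rule assoc_mult_mat[OF Sc[OF xyz(1)] Sc[OF xyz(2)] Sc[OF xyz(3)]])
    then show "(c x y * c (x \<otimes> y) z) \<cdot>\<^sub>m S (x \<otimes> (y \<otimes> z)) = (c y z * c x (y \<otimes> z)) \<cdot>\<^sub>m S (x \<otimes> (y \<otimes> z))"
      using 1 2 by simp
  qed
  define f where "f x = (\<Prod>z\<in>T. c x z)" for x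
  have f0: "f x \<noteq> 0" if "x \<in> T" for x using c(1) that finT by (simp add: f_def)
  have f_mult: "c x y ^ (p ^ m) * f (x \<otimes> y) = f x * f y" if xy: "x \<in> T" "y \<in> T" for x y
  proof -
    have "c x y ^ (p ^ m) * f (x \<otimes> y) = (\<Prod>z\<in>T. c x y * c (x \<otimes> y) z)"
      by (simp add: f_def prod.distrib m)
    also have "\<dots> = (\<Prod>z\<in>T. c y z * c x (y \<otimes> z))" by (rule prod.cong[OF refl]) (rule cocycle[OF xy])
    also have "\<dots> = f y * (\<Prod>z\<in>T. c x (y \<otimes> z))" by (simp add: f_def prod.distrib)
    also have "(\<Prod>z\<in>T. c x (y \<otimes> z)) = f x"
      unfolding f_def
    proof (rule prod.reindex_bij_witness[of _ "\<lambda>z. inv y \<otimes> z" "\<lambda>z. y \<otimes> z"])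
      fix z assume z: "z \<in> T"
      show "inv y \<otimes> (y \<otimes> z) = z" "y \<otimes> (inv y \<otimes> z) = z" using z xy TP by (simp_all add: m_assoc[symmetric])
      show "y \<otimes> z \<in> T" "inv y \<otimes> z \<in> T" using z xy T_mult T_inv by auto
    qed simp
    finally show ?thesis by simp
  qed
  define g where "g x = (SOME g. g ^ (p ^ m) = f x)" for x
  have g: "g x ^ (p ^ m) = f x" for x
    unfolding g_def by (rule someI_ex, rule nth_root_exists) (use prime_gt_0_nat[OF prime_p] in simp)
  have g0: "g x \<noteq> 0" if "x \<in> T" for x
  proof
    assume "g x = 0"
    then have "f x = 0" using g[of x] prime_gt_0_nat[OF prime_p] by (simp add: power_0_left)
    then show False using f0[OF that] by simp
  qed
  \<comment> \<open>The p^m-th powers of both sides agree by \<open>f_mult\<close>, so injectivity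
    of the Frobenius map makes the independently chosen roots fit together. Dividing
    \<open>S\<close> by \<open>g\<close> then removes the cocycle.\<close>
  have g_mult: "c x y * g (x \<otimes> y) = g x * g y" if "x \<in> T" "y \<in> T" for x y
    by (rule power_prime_power_char_inj[OF prime_p CHAR, of _ m])
      (simp only: power_mult_distrib g f_mult[OF that])
  define U where "U x = inverse (g x) \<cdot>\<^sub>m S x" for x
  have Uc: "U x \<in> carrier_mat n n" if "x \<in> T" for x using Sc[OF that] by (simp add: U_def)
  have U_mult: "U x * U y = U (x \<otimes> y)" if xy: "x \<in> T" "y \<in> T" for x y
  proof -
    have "U x * U y = inverse (g x) \<cdot>\<^sub>m (S x * U y)"
      unfolding U_def[of x] by (rule mult_smult_assoc_mat[OF Sc[OF xy(1)] Uc[OF xy(2)]])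
    also have "S x * U y = inverse (g y) \<cdot>\<^sub>m (S x * S y)"
      unfolding U_def[of y] by (rule mult_smult_distrib[OF Sc[OF xy(1)] Sc[OF xy(2)]])
    finally have "U x * U y = (inverse (g x) * inverse (g y) * c x y) \<cdot>\<^sub>m S (x \<otimes> y)"
      unfolding c(2)[OF xy] smult_smult_mat mult.assoc .
    moreover have "inverse (g x) * inverse (g y) * c x y = inverse (g (x \<otimes> y))"
      using g_mult[OF xy] g0[OF xy(1)] g0[OF xy(2)] g0[OF T_mult[OF xy]] by (simp add: field_simps)
    ultimately show ?thesis by (simp only: U_def)
  qed
  have U_int: "U x * conj_rep G x \<rho> h = \<rho> h * U x" if x: "x \<in> T" and h: "h \<in> N" for x h
  proof -
    have "S x * conj_rep G x \<rho> h = \<rho> h * S x" using S[OF x] h by (simp add: intw_def)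
    then show ?thesis
      using mult_smult_assoc_mat[OF Sc[OF x] is_repD(1)[OF conj_rep_is_rep[OF \<rho>r TP(2)[OF x]] h]]
        mult_smult_distrib[OF is_repD(1)[OF \<rho>r h] Sc[OF x]] by (simp only: U_def)
  qed
  have U_one: "U \<one> = 1\<^sub>m n"
  proof -
    obtain R where R: "R \<in> carrier_mat n n" "S \<one> * R = 1\<^sub>m n" using S[OF T_one] unfolding intw_def by blast
    define V where "V = g \<one> \<cdot>\<^sub>m R"
    have V: "V \<in> carrier_mat n n" using R by (simp add: V_def)
    have UV: "U \<one> * V = 1\<^sub>m n"
    proof -
      have "U \<one> * V = inverse (g \<one>) \<cdot>\<^sub>m (S \<one> * V)"
        unfolding U_def by (rule mult_smult_assoc_mat[OF Sc[OF T_one] V])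
      also have "S \<one> * V = g \<one> \<cdot>\<^sub>m (S \<one> * R)" unfolding V_def by (rule mult_smult_distrib[OF Sc[OF T_one] R(1)])
      finally show ?thesis unfolding R(2) using g0[OF T_one] by (intro eq_matI) auto
    qed
    \<comment> \<open>\<open>U \<one>\<close> is idempotent and invertible, hence the identity,
      although \<open>S \<one>\<close> was an arbitrary intertwiner.\<close>
    have "U \<one> * U \<one> = U \<one>" using U_mult[OF T_one T_one] by simp
    then have "U \<one> * U \<one> * V = U \<one> * V" by simp
    then have "U \<one> * (U \<one> * V) = U \<one> * V" unfolding assoc_mult_mat[OF Uc[OF T_one] Uc[OF T_one] V] .
    then show ?thesis unfolding UV using Uc[OF T_one] by simp
  qed
  define \<rho>' where "\<rho>' g = (THE A. \<exists>h\<in>N. \<exists>x\<in>T. g = h \<otimes> x \<and> A = \<rho> h * U x)" for g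
  have \<rho>'_eq: "\<rho>' (h \<otimes> x) = \<rho> h * U x" if hx: "h \<in> N" "x \<in> T" for h x
    unfolding \<rho>'_def
  proof (rule the_equality)
    show "\<exists>h'\<in>N. \<exists>x'\<in>T. h \<otimes> x = h' \<otimes> x' \<and> \<rho> h * U x = \<rho> h' * U x'" using hx by blast
    fix A assume "\<exists>h'\<in>N. \<exists>x'\<in>T. h \<otimes> x = h' \<otimes> x' \<and> A = \<rho> h' * U x'"
    then obtain h' x' where h'x': "h' \<in> N" "x' \<in> T" "h \<otimes> x = h' \<otimes> x'" "A = \<rho> h' * U x'" by blast
    then show "A = \<rho> h * U x" using decomp_unique[OF hx(1) h'x'(1) TP(1)[OF hx(2)] TP(1)[OF h'x'(2)] h'x'(3)] by simp
  qed
  \<comment> \<open>The inertia group in G is N T: composing an intertwiner for h x with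
    \<open>\<rho> (inv h)\<close> gives one for x.\<close>
  have split: "\<exists>h\<in>N. \<exists>x\<in>T. g = h \<otimes> x" if g: "g \<in> inertia G N (carrier G) n \<rho>" for g
  proof -
    have gG: "g \<in> carrier G" using g by (simp add: inertia_iff)
    obtain A where A: "intw n \<rho> g A" using g by (auto simp: inertia_iff)
    obtain h x where hx: "h \<in> N" "x \<in> P" "g = h \<otimes> x" using decomp[OF gG] by blast
    have "intw n \<rho> (inv h \<otimes> g) (\<rho> (inv h) * A)"
      using hx gG A by (intro intw_mult[OF \<rho>r] intw_N[OF \<rho>r]) auto
    moreover have "inv h \<otimes> g = x" using hx by (simp add: m_assoc[symmetric])
    ultimately have "x \<in> T" using hx(2) by (auto simp: T_def inertia_iff)
    then show ?thesis using hx by blast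
  qed
  have ext: "\<rho>' h = \<rho> h" if h: "h \<in> N" for h
    using \<rho>'_eq[OF h T_one] is_repD(1)[OF \<rho>r h] h by (simp add: U_one)
  have "is_rep G (inertia G N (carrier G) n \<rho>) n \<rho>'"
    unfolding is_rep_def
  proof (intro conjI ballI)
    fix a assume "a \<in> inertia G N (carrier G) n \<rho>"
    then obtain h x where hx: "h \<in> N" "x \<in> T" "a = h \<otimes> x" using split by blast
    show "\<rho>' a \<in> carrier_mat n n"
      unfolding hx(3) \<rho>'_eq[OF hx(1,2)] by (rule mult_carrier_mat[OF is_repD(1)[OF \<rho>r hx(1)] Uc[OF hx(2)]])
    fix b assume "b \<in> inertia G N (carrier G) n \<rho>"
    then obtain l y where ly: "l \<in> N" "y \<in> T" "b = l \<otimes> y" using split by blast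
    \<comment> \<open>Conjugating l by x moves it past x, so that the product of
      \<open>h \<otimes> x\<close> and \<open>l \<otimes> y\<close> is again an element of N times
      an element of T.\<close>
    define q where "q = x \<otimes> l \<otimes> inv x"
    have xG: "x \<in> carrier G" "y \<in> carrier G" using TP hx ly by auto
    have q: "q \<in> N" unfolding q_def using conj_N[OF xG(1) ly(1)] .
    have "inv x \<otimes> q \<otimes> x = l" unfolding q_def
      using xG ly by (simp add: m_assoc) (simp add: m_assoc[symmetric])
    then have Uq: "U x * \<rho> l = \<rho> q * U x" using U_int[OF hx(2) q] by (simp add: conj_rep_def)
    have ab: "a \<otimes> b = (h \<otimes> q) \<otimes> (x \<otimes> y)"
    proof -
      have "inv x \<otimes> (x \<otimes> y) = y" using xG by (simp add: m_assoc[symmetric])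
      then show ?thesis unfolding hx(3) ly(3) q_def using hx(1) ly(1) xG by (simp add: m_assoc)
    qed
    note cs = is_repD(1)[OF \<rho>r hx(1)] is_repD(1)[OF \<rho>r ly(1)] is_repD(1)[OF \<rho>r q] Uc[OF hx(2)] Uc[OF ly(2)]
    have "\<rho>' (a \<otimes> b) = \<rho> (h \<otimes> q) * U (x \<otimes> y)"
      unfolding ab by (rule \<rho>'_eq) (use hx ly q T_mult in auto)
    also have "\<dots> = (\<rho> h * \<rho> q) * (U x * U y)"
      using is_repD(3)[OF \<rho>r hx(1) q] U_mult[OF hx(2) ly(2)] by simp
    also have "\<dots> = \<rho> h * (\<rho> q * (U x * U y))"
      by (rule assoc_mult_mat[OF cs(1,3) mult_carrier_mat[OF cs(4,5)]])
    also have "\<rho> q * (U x * U y) = (\<rho> q * U x) * U y" by (rule assoc_mult_mat[OF cs(3,4,5), symmetric])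
    also have "\<dots> = U x * (\<rho> l * U y)" unfolding Uq[symmetric] by (rule assoc_mult_mat[OF cs(4,2,5)])
    also have "\<rho> h * (U x * (\<rho> l * U y)) = (\<rho> h * U x) * (\<rho> l * U y)"
      by (rule assoc_mult_mat[OF cs(1,4) mult_carrier_mat[OF cs(2,5)], symmetric])
    also have "\<dots> = \<rho>' a * \<rho>' b" unfolding hx(3) ly(3) \<rho>'_eq[OF hx(1,2)] \<rho>'_eq[OF ly(1,2)] ..
    finally show "\<rho>' (a \<otimes> b) = \<rho>' a * \<rho>' b" .
  next
    show "\<rho>' \<one> = 1\<^sub>m n" using ext[OF N.one_closed] is_repD(2)[OF \<rho>r] by simp
  qed
  then show ?thesis using ext by blast
qed

end

section \<open>Complements of $O_{p'}(G)$\<close>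

context fin_group
begin

lemma pow_card_subgroup:
  assumes H: "subgroup H G" and x: "x \<in> H"
  shows "x [^] card H = \<one>"
proof -
  interpret H: group "G\<lparr>carrier := H\<rparr>" by (rule subgroup.subgroup_is_group[OF H is_group])
  have "x [^]\<^bsub>G\<lparr>carrier := H\<rparr>\<^esub> card H = \<one>"
    using H.pow_order_eq_1[of x] x by (simp add: Coset.order_def)
  then show ?thesis using nat_pow_consistent[of x "card H" H] by simp
qed

lemma pow_coprime_eq_one:
  assumes x: "x \<in> carrier G" and "x [^] (m::nat) = \<one>" "x [^] (n::nat) = \<one>" "coprime m n"
  shows "x = \<one>"
proof -
  have "ord x dvd m" "ord x dvd n" using pow_eq_id[OF x] assms by auto
  then have "ord x dvd gcd m n" by (rule gcd_greatest)
  then have "ord x = 1" using assms(4) by simp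
  then show ?thesis using ord_eq_1[OF x] by simp
qed

text \<open>The image of an element of H in G/K has order dividing both |H| and the index q, so it
  is trivial.\<close>

lemma normal_coprime_subset:
  assumes K: "K \<lhd> G" and card: "card (carrier G) = card K * q"
    and H: "subgroup H G" and cop: "coprime (card H) q"
  shows "H \<subseteq> K"
proof
  interpret K: normal K G by fact
  fix h assume h: "h \<in> H"
  have hG: "h \<in> carrier G" using subgroup.mem_carrier[OF H h] .
  interpret Q: group "G Mod K" by (rule K.factorgroup_is_group)
  have finK: "finite K" using finite_subset[OF K.subset fin] .
  have "card (rcosets K) * card K = card (carrier G)"
    using lagrange[OF K.subgroup_axioms] by (simp add: Coset.order_def)
  moreover have "card K > 0" using finK K.subgroup_axioms by (metis card_gt_0_iff empty_iff subgroup.one_closed)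
  ultimately have q: "Coset.order (G Mod K) = q"
    using card by (simp add: Coset.order_def FactGroup_def mult.commute)
  have finQ: "finite (carrier (G Mod K))"
    by (simp add: FactGroup_def RCOSETS_def)
  interpret Q: fin_group "G Mod K" by unfold_locales (rule finQ)
  interpret f: group_hom G "G Mod K" "\<lambda>a. K #> a"
    by unfold_locales (rule K.r_coset_hom_Mod)
  have c: "K #> h \<in> carrier (G Mod K)" using f.hom_closed[OF hG] .
  have 1: "(K #> h) [^]\<^bsub>G Mod K\<^esub> q = \<one>\<^bsub>G Mod K\<^esub>" using Q.pow_order_eq_1[OF c] q by simp
  have 2: "(K #> h) [^]\<^bsub>G Mod K\<^esub> card H = \<one>\<^bsub>G Mod K\<^esub>"
    using f.hom_nat_pow[OF hG, of "card H"] f.hom_one by (simp only: pow_card_subgroup[OF H h])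
  have "K #> h = \<one>\<^bsub>G Mod K\<^esub>" by (rule Q.pow_coprime_eq_one[OF c 2 1 cop])
  then have "K #> h = K" by (simp add: FactGroup_def)
  then show "h \<in> K" using rcos_self[OF hG K.subgroup_axioms] by simp
qed

text \<open>The index of K is a power of p, so K contains all normal p'-subgroups and is itself one
  of them.\<close>

lemma O_p'_eq:
  assumes p: "prime p" and K: "K \<lhd> G" "\<not> p dvd card K" "card (carrier G) = card K * p ^ e"
  shows "O_p' G p = K"
proof
  interpret K: normal K G by fact
  have "H \<subseteq> K" if "H \<lhd> G" "\<not> p dvd card H" for H
  proof (rule normal_coprime_subset[OF K(1,3) normal_imp_subgroup[OF that(1)]])
    have "coprime p (card H)" using p that(2) by (rule prime_imp_coprime)
    then show "coprime (card H) (p ^ e)" by (simp add: coprime_commute)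
  qed
  then have "\<Union>{H. H \<lhd> G \<and> \<not> p dvd card H} \<subseteq> K" by blast
  then show "O_p' G p \<subseteq> K"
    unfolding O_p'_def by (rule generate_subgroup_incl[OF _ K.subgroup_axioms])
  show "K \<subseteq> O_p' G p"
  proof
    fix k assume "k \<in> K"
    then have "k \<in> \<Union>{H. H \<lhd> G \<and> \<not> p dvd card H}" using K(1,2) by blast
    then show "k \<in> O_p' G p" unfolding O_p'_def by (rule generate.incl)
  qed
qed

text \<open>Multiplication from the product set N x P to G is injective, and both sides have the
  same finite size.\<close>

lemma complement_decomp:
  assumes N: "subgroup N G" and P: "subgroup P G" and card: "card (carrier G) = card N * card P"
    and int: "N \<inter> P = {\<one>}" and g: "g \<in> carrier G"
  shows "\<exists>n\<in>N. \<exists>x\<in>P. g = n \<otimes> x"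
proof -
  interpret N: subgroup N G by fact
  interpret P: subgroup P G by fact
  let ?f = "\<lambda>(n, x). n \<otimes> x"
  have "inj_on ?f (N \<times> P)"
    by (rule inj_onI) (auto dest: complement_unique[OF N P int])
  then have "card (?f ` (N \<times> P)) = card (carrier G)"
    by (simp add: card_image card_cartesian_product card)
  moreover have "?f ` (N \<times> P) \<subseteq> carrier G" by auto
  ultimately have "?f ` (N \<times> P) = carrier G" using fin by (intro card_subset_eq)
  then have "g \<in> ?f ` (N \<times> P)" using g by simp
  then show ?thesis by auto
qed

end

theorem theorem2p4:
  fixes G :: "('g, 'b) monoid_scheme" and p :: nat and P :: "'g set"
    and k_type :: "'k::alg_closed_field itself"
  assumes "group G" and "finite (carrier G)"
    and "CHAR('k) = p" and "p > 0"
    and "p_nilpotent G p"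
    and "N = O_p' G p"
    and "sylow_subgroup G p P"
  shows "frobenius_alg (centralizer_alg G P :: ('g \<Rightarrow> 'k) set) ga_add ga_smult (ga_mult G)
    \<longleftrightarrow>
    (abelian_set G P \<and>
     (\<forall>n (\<rho> :: 'g \<Rightarrow> 'k mat). irreducible_rep G N n \<rho> \<longrightarrow>
        (\<forall>\<rho>'. is_rep G (inertia G N (carrier G) n \<rho>) n \<rho>' \<and> (\<forall>g\<in>N. \<rho>' g = \<rho> g) \<longrightarrow>
           frobenius_alg (end_alg (inertia G N P n \<rho>) n \<rho>') (+) (\<cdot>\<^sub>m) (*))))"
proof -
  interpret fin_group G using assms(1,2) by (simp add: fin_group_def fin_group_axioms_def)
  have p: "prime p" using prime_CHAR_semidom[where 'a = 'k] assms(3,4) by simp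
  obtain K e where K: "K \<lhd> G" "\<not> p dvd card K" "card (carrier G) = card K * p ^ e"
    using assms(5) unfolding p_nilpotent_def by blast
  have NK: "N = K" unfolding assms(6) by (rule O_p'_eq[OF p K])
  have P: "subgroup P G" using assms(7) by (simp add: sylow_subgroup_def)
  \<comment> \<open>This identifies the order of the Sylow subgroup P with the index of K.\<close>
  have "multiplicity p (card K * p ^ e) = e"
    by (rule multiplicity_decomposeI[OF mult.commute K(2)]) (use assms(4) in simp)
  then have cardP: "card P = p ^ e" using assms(7) K(3) by (simp add: sylow_subgroup_def)
  have subK: "subgroup K G" by (rule normal_imp_subgroup[OF K(1)])
  have "coprime (card K) (p ^ e)"
    using prime_imp_coprime[OF p K(2)] by (simp add: coprime_commute)
  then have cop: "coprime (card K) (card P)" by (simp only: cardP)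
  have int: "K \<inter> P = {\<one>\<^bsub>G\<^esub>}"
  proof
    show "K \<inter> P \<subseteq> {\<one>\<^bsub>G\<^esub>}"
    proof
      fix x assume "x \<in> K \<inter> P"
      then have x: "x \<in> K" "x \<in> P" by simp_all
      have "x = \<one>\<^bsub>G\<^esub>"
        by (rule pow_coprime_eq_one[OF subgroup.mem_carrier[OF P x(2)] pow_card_subgroup[OF subK x(1)]
          pow_card_subgroup[OF P x(2)] cop])
      then show "x \<in> {\<one>\<^bsub>G\<^esub>}" by simp
    qed
    show "{\<one>\<^bsub>G\<^esub>} \<subseteq> K \<inter> P"
      using subgroup.one_closed[OF subK] subgroup.one_closed[OF P] by simp
  qed
  interpret p_nilpotent_group G p e N P "TYPE('k)"
  proof (intro p_nilpotent_group.intro p_nilpotent_group_axioms.intro)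
    show "\<exists>n\<in>N. \<exists>x\<in>P. g = n \<otimes>\<^bsub>G\<^esub> x" if "g \<in> carrier G" for g
      unfolding NK by (rule complement_decomp[OF subK P _ int that]) (simp add: K(3) cardP)
  qed (use p assms(3) K P cardP int NK fin_group_axioms in simp_all)
  have end_eq: "end_alg (inertia G N P n \<rho>) n \<rho>' = com_alg n \<rho>"
    if "irr n \<rho>" "is_rep G (inertia G N (carrier G) n \<rho>) n \<rho>' \<and> (\<forall>g\<in>N. \<rho>' g = \<rho> g)" for n \<rho> \<rho>'
    by (rule end_alg_eq_com_alg[OF that(1) conjunct1[OF that(2)] bspec[OF conjunct2[OF that(2)]]])
  show ?thesis
    unfolding ga_add_eq
  proof (intro iffI conjI allI impI)
    assume frob: "frobenius_alg (centralizer_alg G P :: ('g \<Rightarrow> 'k) set) (+) ga_smult (ga_mult G)"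
    show "abelian_set G P" by (rule abelian_if_frobenius[OF frob])
    fix n and \<rho> \<rho>' :: "'g \<Rightarrow> 'k mat"
    assume \<rho>: "irr n \<rho>"
      and \<rho>': "is_rep G (inertia G N (carrier G) n \<rho>) n \<rho>' \<and> (\<forall>g\<in>N. \<rho>' g = \<rho> g)"
    show "frobenius_alg (end_alg (inertia G N P n \<rho>) n \<rho>') (+) (\<cdot>\<^sub>m) (*)"
      unfolding end_eq[OF \<rho> \<rho>'] by (rule frobenius_com_alg_if_fixed[OF frobenius_fixed_if_centralizer[OF frob] \<rho>])
  next
    assume *: "abelian_set G P \<and>
     (\<forall>n (\<rho> :: 'g \<Rightarrow> 'k mat). irr n \<rho> \<longrightarrow>
        (\<forall>\<rho>'. is_rep G (inertia G N (carrier G) n \<rho>) n \<rho>' \<and> (\<forall>g\<in>N. \<rho>' g = \<rho> g) \<longrightarrow>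
           frobenius_alg (end_alg (inertia G N P n \<rho>) n \<rho>') (+) (\<cdot>\<^sub>m) (*)))"
    show "frobenius_alg (centralizer_alg G P :: ('g \<Rightarrow> 'k) set) (+) ga_smult (ga_mult G)"
    proof (rule frobenius_centralizer_if_fixed[OF conjunct1[OF *] frobenius_fixed_if_com_alg])
      fix n and \<rho> :: "'g \<Rightarrow> 'k mat" assume \<rho>: "irr n \<rho>"
      \<comment> \<open>The assumption speaks about extensions of \<open>\<rho>\<close>, so one must
        be exhibited before it yields anything.\<close>
      from exists_extension[OF \<rho>] obtain \<rho>' where
        \<rho>': "is_rep G (inertia G N (carrier G) n \<rho>) n \<rho>' \<and> (\<forall>g\<in>N. \<rho>' g = \<rho> g)" ..
      from conjunct2[OF *, rule_format, OF \<rho> \<rho>']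
      show "frobenius_alg (com_alg n \<rho>) (+) (\<cdot>\<^sub>m) (*)" unfolding end_eq[OF \<rho> \<rho>'] .
    qed
  qed
qed

end
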